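(* The problem $1||\sum_{\le k}e_j+\sum w_jC_j$ is $\mathsf{W}[1]$-hard when parameterized by the maximum number $k$ of rejected jobs.
   Context: Problem $1||\sum_{\le k}e_j+\sum w_jC_j$ (scheduling with rejection): given an integer $k$ and a set $J$ of $n$ jobs, all released at time $0$, each job $j$ having processing time $p_j\in\mathbb{N}$, weight $w_j\in\mathbb{N}$ and rejection cost $e_j\in\mathbb{N}$, choose a set $J'\subseteq J$ of at most $k$ rejected jobs and schedule all jobs of $J\setminus J'$ non-preemptively on a single machine so as to minimize $\sum_{j\in J\setminus J'}w_jC_j+\sum_{j\in J'}e_j$, where $C_j$ is the completion time of $j$. *)

theory Defs
  imports Main
begin

datatype sym = Bl | Zero | One
datatype move = Lm | Rm | Nm

text \<open>A machine is a finite transition table: row q (for q < length M) lists the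
  actions for the scanned symbols Bl, Zero, One (in this order); an action is
  (next state, written symbol, head move).  State 0 is the start state; every state
  q >= length M is a halting state.\<close>
type_synonym tm = "(nat \<times> sym \<times> move) list list"

text \<open>Configuration: (state, tape left of head (nearest cell first), scanned symbol,
  tape right of head); all other cells are blank.\<close>
type_synonym conf = "nat \<times> sym list \<times> sym \<times> sym list"

definition wf_tm :: "tm \<Rightarrow> bool" where
  "wf_tm M \<longleftrightarrow> (\<forall>row \<in> set M. length row = 3)"

definition sym_idx :: "sym \<Rightarrow> nat" where
  "sym_idx s = (case s of Bl \<Rightarrow> 0 | Zero \<Rightarrow> 1 | One \<Rightarrow> 2)"

fun mv :: "move \<Rightarrow> sym list \<Rightarrow> sym \<Rightarrow> sym list \<Rightarrow> sym list \<times> sym \<times> sym list" where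
  "mv Nm l h r = (l, h, r)"
| "mv Lm [] h r = ([], Bl, h # r)"
| "mv Lm (a # l) h r = (l, a, h # r)"
| "mv Rm l h [] = (h # l, Bl, [])"
| "mv Rm l h (a # r) = (h # l, a, r)"

definition tm_step :: "tm \<Rightarrow> conf \<Rightarrow> conf" where
  "tm_step M c = (case c of (q, l, h, r) \<Rightarrow>
     if q < length M then
       (case M ! q ! sym_idx h of (q', w, m) \<Rightarrow>
          (case mv m l w r of (l', h', r') \<Rightarrow> (q', l', h', r')))
     else c)"

definition halted :: "tm \<Rightarrow> conf \<Rightarrow> bool" where
  "halted M c \<longleftrightarrow> length M \<le> fst c"

definition bit_sym :: "bool \<Rightarrow> sym" where
  "bit_sym b = (if b then One else Zero)"

definition tm_init :: "bool list \<Rightarrow> conf" where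
  "tm_init x = (case x of [] \<Rightarrow> (0, [], Bl, []) | b # bs \<Rightarrow> (0, [], bit_sym b, map bit_sym bs))"

definition tm_output :: "conf \<Rightarrow> bool list" where
  "tm_output c = (case c of (q, l, h, r) \<Rightarrow> map (\<lambda>s. s = One) (takeWhile (\<lambda>s. s \<noteq> Bl) (h # r)))"

definition tm_computes_on :: "tm \<Rightarrow> bool list set \<Rightarrow> (bool list \<Rightarrow> bool list) \<Rightarrow> (bool list \<Rightarrow> nat) \<Rightarrow> bool" where
  "tm_computes_on M D F T \<longleftrightarrow> wf_tm M \<and>
     (\<forall>x \<in> D. \<exists>t \<le> T x. halted M ((tm_step M ^^ t) (tm_init x))
                         \<and> tm_output ((tm_step M ^^ t) (tm_init x)) = F x)"

fun bits :: "nat \<Rightarrow> bool list" where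
  "bits n = (if n = 0 then [] else odd n # bits (n div 2))"

text \<open>Self-delimiting: every binary digit doubled, terminated by 01.\<close>
definition enc_nat :: "nat \<Rightarrow> bool list" where
  "enc_nat n = concat (map (\<lambda>b. [b, b]) (bits n)) @ [False, True]"

definition enc_list :: "nat list \<Rightarrow> bool list" where
  "enc_list xs = enc_nat (length xs) @ concat (map enc_nat xs)"

definition computable_nat :: "(nat \<Rightarrow> nat) \<Rightarrow> bool" where
  "computable_nat f \<longleftrightarrow> (\<exists>M. wf_tm M \<and> (\<forall>n. \<exists>t. halted M ((tm_step M ^^ t) (tm_init (enc_nat n)))
       \<and> tm_output ((tm_step M ^^ t) (tm_init (enc_nat n))) = enc_nat (f n)))"

text \<open>A parameterized problem is a pair (Q, kappa) with Q a set of binary strings and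
  kappa a polynomial-time computable parameterization.\<close>
definition poly_time :: "(bool list \<Rightarrow> bool list) \<Rightarrow> bool" where
  "poly_time F \<longleftrightarrow> (\<exists>M a c. tm_computes_on M UNIV F (\<lambda>x. a * (length x + 1) ^ c))"

definition param_problem :: "(bool list \<Rightarrow> nat) \<Rightarrow> bool" where
  "param_problem \<kappa> \<longleftrightarrow> poly_time (\<lambda>x. enc_nat (\<kappa> x))"

definition fpt_reduction ::
  "bool list set \<times> (bool list \<Rightarrow> nat) \<Rightarrow> bool list set \<times> (bool list \<Rightarrow> nat) \<Rightarrow> (bool list \<Rightarrow> bool list) \<Rightarrow> bool" where
  "fpt_reduction P P' R \<longleftrightarrow>
     (case P of (Q, \<kappa>) \<Rightarrow> case P' of (Q', \<kappa>') \<Rightarrow>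
        (\<forall>x. x \<in> Q \<longleftrightarrow> R x \<in> Q')
      \<and> (\<exists>f M c. computable_nat f \<and> tm_computes_on M UNIV R (\<lambda>x. f (\<kappa> x) * (length x + 1) ^ c))
      \<and> (\<exists>g. computable_nat g \<and> (\<forall>x. \<kappa>' (R x) \<le> g (\<kappa> x))))"

definition fpt_reducible ::
  "bool list set \<times> (bool list \<Rightarrow> nat) \<Rightarrow> bool list set \<times> (bool list \<Rightarrow> nat) \<Rightarrow> bool" where
  "fpt_reducible P P' \<longleftrightarrow> (\<exists>R. fpt_reduction P P' R)"

definition enc_clique :: "nat \<Rightarrow> nat \<Rightarrow> (nat \<times> nat) list \<Rightarrow> bool list" where
  "enc_clique n k E = enc_nat n @ enc_nat k @ enc_list (concat (map (\<lambda>(u, v). [u, v]) E))"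

definition has_clique :: "nat \<Rightarrow> nat \<Rightarrow> (nat \<times> nat) list \<Rightarrow> bool" where
  "has_clique n k E \<longleftrightarrow> (\<exists>S. S \<subseteq> {..<n} \<and> card S = k \<and>
      (\<forall>u \<in> S. \<forall>v \<in> S. u \<noteq> v \<longrightarrow> (u, v) \<in> set E \<or> (v, u) \<in> set E))"

definition CLIQUE :: "bool list set" where
  "CLIQUE = {enc_clique n k E | n k E. has_clique n k E}"

definition kappa_clique :: "bool list \<Rightarrow> nat" where
  "kappa_clique x = (if \<exists>n k E. x = enc_clique n k E
                     then (THE k. \<exists>n E. x = enc_clique n k E) else 0)"

text \<open>W[1] = the closure of p-CLIQUE under fpt-reductions (Clique is W[1]-complete).\<close>
definition W1 :: "(bool list set \<times> (bool list \<Rightarrow> nat)) set" where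
  "W1 = {(Q, \<kappa>). param_problem \<kappa> \<and> fpt_reducible (Q, \<kappa>) (CLIQUE, kappa_clique)}"

definition W1_hard :: "bool list set \<times> (bool list \<Rightarrow> nat) \<Rightarrow> bool" where
  "W1_hard P \<longleftrightarrow> (\<forall>P' \<in> W1. fpt_reducible P' P)"

text \<open>Job j < length J is J ! j = (p_j, w_j, e_j).  A solution is a set Rej of at most k
  rejected jobs and non-negative integer start times S of the accepted jobs such that
  the processing intervals [S j, S j + p j) of accepted jobs do not overlap
  (non-preemptive single machine); C_j = S j + p_j.\<close>
definition ptime :: "(nat \<times> nat \<times> nat) list \<Rightarrow> nat \<Rightarrow> nat" where
  "ptime J j = fst (J ! j)"
definition weight :: "(nat \<times> nat \<times> nat) list \<Rightarrow> nat \<Rightarrow> nat" where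
  "weight J j = fst (snd (J ! j))"
definition rejcost :: "(nat \<times> nat \<times> nat) list \<Rightarrow> nat \<Rightarrow> nat" where
  "rejcost J j = snd (snd (J ! j))"

definition feasible_sched :: "(nat \<times> nat \<times> nat) list \<Rightarrow> nat \<Rightarrow> nat set \<Rightarrow> (nat \<Rightarrow> nat) \<Rightarrow> bool" where
  "feasible_sched J k Rej S \<longleftrightarrow> Rej \<subseteq> {..<length J} \<and> card Rej \<le> k \<and>
     (\<forall>i \<in> {..<length J} - Rej. \<forall>j \<in> {..<length J} - Rej. i \<noteq> j \<longrightarrow>
        S i + ptime J i \<le> S j \<or> S j + ptime J j \<le> S i)"

definition sched_cost :: "(nat \<times> nat \<times> nat) list \<Rightarrow> nat set \<Rightarrow> (nat \<Rightarrow> nat) \<Rightarrow> nat" where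
  "sched_cost J Rej S = (\<Sum>j \<in> {..<length J} - Rej. weight J j * (S j + ptime J j))
                        + (\<Sum>j \<in> Rej. rejcost J j)"

definition enc_sched :: "nat \<Rightarrow> nat \<Rightarrow> (nat \<times> nat \<times> nat) list \<Rightarrow> bool list" where
  "enc_sched k B J = enc_nat k @ enc_nat B @ enc_list (concat (map (\<lambda>(p, w, e). [p, w, e]) J))"

definition SCHED_REJ :: "bool list set" where
  "SCHED_REJ = {enc_sched k B J | k B J.
      \<exists>Rej S. feasible_sched J k Rej S \<and> sched_cost J Rej S \<le> B}"

definition kappa_sched :: "bool list \<Rightarrow> nat" where
  "kappa_sched x = (if \<exists>k B J. x = enc_sched k B J
                    then (THE k. \<exists>B J. x = enc_sched k B J) else 0)"

end

theory Submission
  imports Defs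
begin

text \<open>A graph is turned into numbers: a code h(v) is attached to every vertex such that sums of codes with small
  coefficients determine their coefficients, and C exceeds all such sums. With items C - (k-1) h(v) for the
  vertices and h(u) + h(v) for the edges, a k-clique corresponds to a selection of at most k^2 items with sum
  kC. Subset sum with a cardinality bound becomes scheduling with rejection by giving item x processing time
  x, weight 2x and rejection cost x(x + 2(P-T)), where P is the sum of all items and T = kC: the cost of the
  best schedule that rejects a set of size X is a constant plus (X-T)^2.

  The reduction has to be carried out by a Turing machine. Programs of a while language on stacks of numbers are
  translated into programs on stacks of bits, and these into single-tape machines that keep the stacks as
  interleaved tracks, with polynomial overhead. As stack programs also simulate Turing machines, a given
  reduction to Clique and the program for the step from Clique to scheduling are composed within one machine.\<close>

section \<open>Machines with arbitrary state types on a two-way infinite tape\<close>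

text \<open>Hardness ranges over all problems in \<open>W1\<close>, and of each only the existence
  of some machine reducing it to Clique is known. The step to scheduling must therefore run after an
  unknown machine inside one explicit table, and the bounding functions of
  \<open>fpt_reduction\<close> need explicit tables as well. Two facts shape the arithmetic. Vertex
  names are given in binary, so a place value such as B^v could have exponentially many digits;
  positions in the list of edge endpoints serve as digit places instead, which leaves polynomially
  many digits. As values the items are still exponentially large, so programs compute in binary and
  costs are measured by the digit length of a common bound Z. On the scheduling side a budget is a
  single inequality, while subset sum asks for an equation: the square (X-T)^2 supplies it, since a
  budget equal to the constant term admits X = T alone. Weights are 2x because the sum of x_i C_i
  over a sequence is half of (sum x)^2 + sum x^2; doubling removes the half from the rejection
  costs.\<close>

definition cell :: "sym list \<Rightarrow> nat \<Rightarrow> sym" where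
  "cell l i = (if i < length l then l ! i else Bl)"

fun dir :: "move \<Rightarrow> int" where
  "dir Lm = -1" | "dir Rm = 1" | "dir Nm = 0"

type_synonym 'q mconf = "'q \<times> int \<times> (int \<Rightarrow> sym)"

definition mstep :: "('q \<Rightarrow> sym \<Rightarrow> 'q \<times> sym \<times> move) \<Rightarrow> 'q mconf \<Rightarrow> 'q mconf" where
  "mstep \<delta> c = (case c of (q, p, \<tau>) \<Rightarrow>
     (case \<delta> q (\<tau> p) of (q', w, m) \<Rightarrow> (q', p + dir m, \<tau>(p := w))))"

lemma mstep_simp:
  "mstep \<delta> (q, p, \<tau>) = (case \<delta> q (\<tau> p) of (q', w, m) \<Rightarrow> (q', p + dir m, \<tau>(p := w)))"
  by (simp add: mstep_def)

definition represents :: "sym list \<Rightarrow> sym \<Rightarrow> sym list \<Rightarrow> int \<Rightarrow> (int \<Rightarrow> sym) \<Rightarrow> bool" where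
  "represents l h r p \<tau> \<longleftrightarrow> \<tau> p = h \<and> (\<forall>i. \<tau> (p + 1 + int i) = cell r i) \<and> (\<forall>i. \<tau> (p - 1 - int i) = cell l i)"

definition index_of :: "'q list \<Rightarrow> 'q \<Rightarrow> nat" where
  "index_of qs q = length (takeWhile (\<lambda>x. x \<noteq> q) qs)"

lemma index_of_less: "q \<in> set qs \<Longrightarrow> index_of qs q < length qs"
  by (induction qs) (auto simp: index_of_def)

lemma nth_index_of: "q \<in> set qs \<Longrightarrow> qs ! index_of qs q = q"
  by (induction qs) (auto simp: index_of_def)

text \<open>A state outside the list receives the first index beyond the table, and
  \<open>tm_step\<close> treats such an index as halting.\<close>

lemma index_of_absent: "q \<notin> set qs \<Longrightarrow> index_of qs q = length qs"
  by (induction qs) (auto simp: index_of_def)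

definition tm_of :: "'q list \<Rightarrow> ('q \<Rightarrow> sym \<Rightarrow> 'q \<times> sym \<times> move) \<Rightarrow> tm" where
  "tm_of qs \<delta> = map (\<lambda>q. map (\<lambda>h. case \<delta> q h of (q', w, m) \<Rightarrow> (index_of qs q', w, m)) [Bl, Zero, One]) qs"

lemma wf_tm_of: "wf_tm (tm_of qs \<delta>)"
  by (auto simp: wf_tm_def tm_of_def)

lemma tm_of_entry:
  assumes "q \<in> set qs"
  shows "tm_of qs \<delta> ! index_of qs q ! sym_idx h = (case \<delta> q h of (q', w, m) \<Rightarrow> (index_of qs q', w, m))"
  using index_of_less[OF assms]
  by (cases h) (auto simp: tm_of_def sym_idx_def nth_index_of[OF assms])

lemma cell_Cons: "cell (x # l) i = (case i of 0 \<Rightarrow> x | Suc j \<Rightarrow> cell l j)"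
  by (cases i) (auto simp: cell_def)

lemma cell_Nil: "cell [] i = Bl"
  by (simp add: cell_def)

text \<open>The finite halves and the infinite tape differ only in trailing blanks, which
  \<open>cell\<close> supplies; so the cases with an empty half, where \<open>mv\<close> creates a
  blank, agree with the tape too.\<close>

lemma represents_mv:
  assumes rep: "represents l h r p \<tau>" and mv: "mv m l w r = (l', h', r')"
  shows "represents l' h' r' (p + dir m) (\<tau>(p := w))"
proof -
  have R: "\<tau> (p + 1 + int i) = cell r i" and L: "\<tau> (p - 1 - int i) = cell l i" for i
    using rep by (auto simp: represents_def)
  have R': "\<tau> (p + int i) = cell r (i - 1)" and L': "\<tau> (p - int i) = cell l (i - 1)" if "i > 0" for i
    using R[of "i - 1"] L[of "i - 1"] that by (auto simp: algebra_simps of_nat_diff)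
  show ?thesis
  proof (cases m)
    case Nm
    then show ?thesis using mv R L by (auto simp: represents_def)
  next
    case Lm
    show ?thesis
    proof (cases l)
      case Nil
      have "l' = []" "h' = Bl" "r' = w # r" using mv Lm Nil by auto
      moreover have "\<tau> (p - 2 - int i) = Bl" for i
        using L[of "Suc i"] Nil by (simp add: cell_Nil algebra_simps)
      moreover have "\<tau> (p - 1) = Bl" using L[of 0] Nil by (simp add: cell_Nil)
      ultimately show ?thesis
        using Lm R' by (auto simp: represents_def cell_Cons cell_Nil algebra_simps split: nat.split)
    next
      case (Cons a l0)
      have "l' = l0" "h' = a" "r' = w # r" using mv Lm Cons by auto
      moreover have "\<tau> (p - 2 - int i) = cell l0 i" for i
        using L[of "Suc i"] Cons by (simp add: cell_Cons algebra_simps)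
      moreover have "\<tau> (p - 1) = a" using L[of 0] Cons by (simp add: cell_Cons)
      ultimately show ?thesis
        using Lm R' by (auto simp: represents_def cell_Cons algebra_simps split: nat.split)
    qed
  next
    case Rm
    show ?thesis
    proof (cases r)
      case Nil
      have e: "l' = w # l" "h' = Bl" "r' = []" using mv Rm Nil by auto
      moreover have "\<tau> (p + 2 + int i) = Bl" for i
        using R[of "Suc i"] Nil by (simp add: cell_Nil algebra_simps)
      ultimately show ?thesis
        using Rm Nil R[of 0] L' by (auto simp: represents_def cell_Cons cell_Nil algebra_simps split: nat.split)
    next
      case (Cons a r0)
      have "l' = w # l" "h' = a" "r' = r0" using mv Rm Cons by auto
      moreover have "\<tau> (p + 2 + int i) = cell r0 i" for i
        using R[of "Suc i"] Cons by (simp add: cell_Cons algebra_simps)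
      moreover have "\<tau> (p + 1) = a" using R[of 0] Cons by (simp add: cell_Cons)
      ultimately show ?thesis
        using Rm L' by (auto simp: represents_def cell_Cons algebra_simps split: nat.split)
    qed
  qed
qed

text \<open>Both machines are followed with equal step counts. The halting state \<open>qh\<close>
  is absorbing in \<delta> and lies outside \<open>qs\<close>, so after halting both stand still
  together.\<close>

lemma tm_of_simulates:
  assumes closed: "\<And>q h q' w m. q \<in> set qs \<Longrightarrow> \<delta> q h = (q', w, m) \<Longrightarrow> q' \<in> insert qh (set qs)"
    and halt: "\<And>h. \<delta> qh h = (qh, h, Nm)" "qh \<notin> set qs"
    and q: "q \<in> insert qh (set qs)"
    and rep: "represents l h r p \<tau>"
  shows "\<exists>q' p' \<tau>' l' h' r'. (mstep \<delta> ^^ n) (q, p, \<tau>) = (q', p', \<tau>') \<and> q' \<in> insert qh (set qs)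
     \<and> (tm_step (tm_of qs \<delta>) ^^ n) (index_of qs q, l, h, r) = (index_of qs q', l', h', r')
     \<and> represents l' h' r' p' \<tau>'"
proof (induction n)
  case 0
  then show ?case using q rep by auto
next
  case (Suc n)
  then obtain q' p' \<tau>' l' h' r' where
    a: "(mstep \<delta> ^^ n) (q, p, \<tau>) = (q', p', \<tau>')" "q' \<in> insert qh (set qs)"
    and b: "(tm_step (tm_of qs \<delta>) ^^ n) (index_of qs q, l, h, r) = (index_of qs q', l', h', r')"
    and c: "represents l' h' r' p' \<tau>'" by blast
  have h': "\<tau>' p' = h'" using c by (simp add: represents_def)
  obtain q2 w m where d: "\<delta> q' h' = (q2, w, m)" by (cases "\<delta> q' h'")
  obtain l2 h2 r2 where mv: "mv m l' w r' = (l2, h2, r2)" by (cases "mv m l' w r'")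
  have s1: "(mstep \<delta> ^^ Suc n) (q, p, \<tau>) = (q2, p' + dir m, \<tau>'(p' := w))"
    using a d h' by (simp add: mstep_simp)
  have rep2: "represents l2 h2 r2 (p' + dir m) (\<tau>'(p' := w))"
    by (rule represents_mv[OF c mv])
  show ?case
  proof (cases "q' = qh")
    case True
    then have e: "q2 = qh" "w = h'" "m = Nm" using d halt by auto
    have "index_of qs q' = length (tm_of qs \<delta>)"
      using halt True by (simp add: index_of_absent tm_of_def)
    then have "(tm_step (tm_of qs \<delta>) ^^ Suc n) (index_of qs q, l, h, r) = (index_of qs q', l', h', r')"
      using b by (simp add: tm_step_def)
    then show ?thesis using s1 rep2 e mv True by auto
  next
    case False
    then have q': "q' \<in> set qs" using a by auto
    have "index_of qs q' < length (tm_of qs \<delta>)" using index_of_less[OF q'] by (simp add: tm_of_def)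
    then have "(tm_step (tm_of qs \<delta>) ^^ Suc n) (index_of qs q, l, h, r) = (index_of qs q2, l2, h2, r2)"
      using b d mv by (simp add: tm_step_def tm_of_entry[OF q'])
    moreover have "q2 \<in> insert qh (set qs)" using closed[OF q' d] .
    ultimately show ?thesis using s1 rep2 by auto
  qed
qed

lemma represents_init:
  assumes "tm_init x = (q, l, h, r)"
  shows "represents l h r 0 (\<lambda>p. if p < 0 then Bl else cell (map bit_sym x) (nat p)) \<and> q = 0"
  using assms by (cases x) (auto simp: tm_init_def represents_def cell_def nth_Cons' nat_add_distrib)

lemma bit_sym_neq_Bl: "bit_sym b \<noteq> Bl" "Bl \<noteq> bit_sym b"
  by (auto simp: bit_sym_def)

lemma bit_sym_One: "(bit_sym b = One) = b" "bit_sym False = Zero" "bit_sym True = One"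
  by (auto simp: bit_sym_def)

text \<open>Only the cells up to the first blank matter, so it makes no difference whether that
  blank is stored in \<open>zs\<close> or lies beyond its end.\<close>

lemma takeWhile_cells:
  assumes "\<And>i. i < length y \<Longrightarrow> cell zs i = bit_sym (y ! i)" "cell zs (length y) = Bl"
  shows "map (\<lambda>s. s = One) (takeWhile (\<lambda>s. s \<noteq> Bl) zs) = y"
  using assms
proof (induction zs arbitrary: y)
  case Nil
  then have "y = []" by (cases y) (auto simp: cell_def bit_sym_neq_Bl)
  then show ?case by simp
next
  case (Cons z zs)
  show ?case
  proof (cases y)
    case Nil
    then show ?thesis using Cons.prems by (simp add: cell_def)
  next
    case (Cons b ys)
    have "z = bit_sym b" using Cons.prems(1)[of 0] Cons by (simp add: cell_def)
    moreover have "map (\<lambda>s. s = One) (takeWhile (\<lambda>s. s \<noteq> Bl) zs) = ys"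
      using Cons.prems(1)[of "Suc i" for i] Cons.prems(2) Cons
      by (intro Cons.IH) (auto simp: cell_Cons)
    ultimately show ?thesis using Cons by (simp add: bit_sym_neq_Bl bit_sym_One)
  qed
qed

lemma output_represents:
  assumes "represents l h r p \<tau>" "\<And>i. \<tau> (p + int i) = cell (map bit_sym y) i"
  shows "tm_output (q, l, h, r) = y"
proof -
  have "cell (h # r) i = cell (map bit_sym y) i" for i
  proof (cases i)
    case 0
    then show ?thesis using assms(1) assms(2)[of 0] by (simp add: represents_def cell_Cons)
  next
    case (Suc j)
    have "\<tau> (p + 1 + int j) = cell r j" using assms(1) by (simp add: represents_def)
    then show ?thesis using Suc assms(2)[of i] by (simp add: cell_Cons algebra_simps)
  qed
  then have "map (\<lambda>s. s = One) (takeWhile (\<lambda>s. s \<noteq> Bl) (h # r)) = y"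
    by (intro takeWhile_cells) (auto simp: cell_def[of "map _ _"])
  then show ?thesis by (simp add: tm_output_def)
qed

section \<open>Stack programs and their translation into Turing machines\<close>

text \<open>The stack Tp carries the input and the output, the stacks V hold encoded lists of numbers, and the
  stacks X are scratch space for single bits. Both Case and Loop pop the bit they inspect.\<close>
datatype reg = Tp | V nat | X nat

datatype com = Skip | Push reg bool | Case reg com com com | Seq com com (infixr ";;" 60) | Loop reg com com

type_synonym store = "reg \<Rightarrow> bool list"

text \<open>Control is a list of pending commands, so that such a list can serve directly as the
  control state of a machine.\<close>

fun sstep :: "com list \<times> store \<Rightarrow> com list \<times> store" where
  "sstep ([], s) = ([], s)"
| "sstep (Skip # K, s) = (K, s)"
| "sstep (Push r b # K, s) = (K, s(r := b # s r))"
| "sstep (Case r c0 c1 c2 # K, s) = (case s r of [] \<Rightarrow> (c0 # K, s)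
     | b # bs \<Rightarrow> ((if b then c2 else c1) # K, s(r := bs)))"
| "sstep ((c1 ;; c2) # K, s) = (c1 # c2 # K, s)"
| "sstep (Loop r c1 c2 # K, s) = (case s r of [] \<Rightarrow> (K, s)
     | b # bs \<Rightarrow> ((if b then c2 else c1) # Loop r c1 c2 # K, s(r := bs)))"

text \<open>Over-approximates the continuations met while a command runs on top of K. A loop body
  always continues with the same list, so iteration adds nothing new and the set stays finite, as a
  machine table requires.\<close>

fun conts :: "com \<Rightarrow> com list \<Rightarrow> com list set" where
  "conts Skip K = {Skip # K}"
| "conts (Push r b) K = {Push r b # K}"
| "conts (Case r c0 c1 c2) K = {Case r c0 c1 c2 # K} \<union> conts c0 K \<union> conts c1 K \<union> conts c2 K"
| "conts (c1 ;; c2) K = {(c1 ;; c2) # K} \<union> conts c1 (c2 # K) \<union> conts c2 K"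
| "conts (Loop r c1 c2) K = {Loop r c1 c2 # K} \<union> conts c1 (Loop r c1 c2 # K) \<union> conts c2 (Loop r c1 c2 # K)"

lemma finite_conts: "finite (conts c K)"
  by (induction c arbitrary: K) auto

lemma head_conts: "c # K \<in> conts c K"
  by (cases c) auto

fun idx :: "reg \<Rightarrow> nat" where
  "idx Tp = 0" | "idx (V a) = 2 * a + 1" | "idx (X a) = 2 * a + 2"

lemma idx_inj: "(idx r = idx r') = (r = r')"
  by (cases r; cases r'; simp; presburger)

lemma idx_0: "(idx r = 0) = (r = Tp)"
  by (cases r) auto

fun width :: "com \<Rightarrow> nat" where
  "width Skip = 2"
| "width (Push r b) = idx r + 2"
| "width (Case r c0 c1 c2) = max (idx r + 2) (max (width c0) (max (width c1) (width c2)))"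
| "width (c1 ;; c2) = max (width c1) (width c2)"
| "width (Loop r c1 c2) = max (idx r + 2) (max (width c1) (width c2))"

text \<open>On the tracks, the counter of a phase is the track of the scanned cell
  (\<open>Out W\<close> stands for track 0). When a pop has found the blank above the stack,
  \<open>Back\<close> goes to the next track-0 cell towards home: if this is the blank home cell,
  the stack is empty; otherwise \<open>Fetch\<close> continues into the adjacent block to the top
  bit.\<close>

datatype loc = Out nat | Back nat | Fetch nat | Home bool nat | Start | Halt

definition locs :: "nat \<Rightarrow> loc set" where
  "locs W = insert Start (Out ` {..W} \<union> Back ` {..W} \<union> Fetch ` {..W} \<union> case_prod Home ` (UNIV \<times> {..W}))"

lemma finite_locs: "finite (locs W)"
  by (auto simp: locs_def)

lemma locs_iff [simp]: "Out j \<in> locs W \<longleftrightarrow> j \<le> W" "Back j \<in> locs W \<longleftrightarrow> j \<le> W" "Fetch j \<in> locs W \<longleftrightarrow> j \<le> W"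
  "Home b j \<in> locs W \<longleftrightarrow> j \<le> W" "Start \<in> locs W" "Halt \<notin> locs W"
  by (auto simp: locs_def)

type_synonym state = "com list \<times> loc"

text \<open>One operation on a stack with track number r: op = Some b pushes b and continues with K, op = None
  pops and continues with kE, kF or kT (empty, popped False, popped True). Out j walks outward from the home
  cell to the top of the stack. It turns every cell of track 0 that it passes into Zero, so that afterwards
  the home cell is the only blank of track 0 on the way back; Home recognises it by this.\<close>
fun micro :: "nat \<Rightarrow> nat \<Rightarrow> bool option \<Rightarrow> com list \<Rightarrow> com list \<Rightarrow> com list \<Rightarrow> com list \<Rightarrow> loc \<Rightarrow> sym \<Rightarrow> state \<times> sym \<times> move" where
  "micro W r op K kE kF kT (Out j) h =
     (if r = 0 then
        if j = 0 then ((K, Out 1), h, Rm)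
        else if h = Bl then (case op of Some b \<Rightarrow> ((K, Home b 0), bit_sym b, Lm) | None \<Rightarrow> ((K, Back 0), Bl, Lm))
        else ((K, Out 1), h, Rm)
      else if j = r then
        if h = Bl then (case op of Some b \<Rightarrow> ((K, Home b (r - 1)), bit_sym b, Rm) | None \<Rightarrow> ((K, Back (r - 1)), Bl, Rm))
        else ((K, Out (j + 1)), h, Lm)
      else if j \<ge> W then ((K, Out 1), Zero, Lm)
      else ((K, Out (j + 1)), h, Lm))"
| "micro W r op K kE kF kT (Back j) h =
     (if j = 0 then
        if h = Bl then ((kE, Out 0), Bl, Nm)
        else if r = 0 then ((K, Home (h = One) 0), Bl, Lm)
        else ((K, Fetch (W - 1)), h, Rm)
      else ((K, Back (j - 1)), h, Rm))"
| "micro W r op K kE kF kT (Fetch j) h =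
     (if j = r then ((K, Home (h = One) (r - 1)), Bl, Rm) else ((K, Fetch (j - 1)), h, Rm))"
| "micro W r op K kE kF kT (Home b j) h =
     (if h = Bl \<and> j = 0 then ((if b then kT else kF, Out 0), Bl, Nm)
      else if r = 0 then ((K, Home b 0), h, Lm)
      else if j = 0 then ((K, Home b (W - 1)), h, Rm)
      else ((K, Home b (j - 1)), h, Rm))"
| "micro W r op K kE kF kT l h = (([], Halt), h, Nm)"

text \<open>\<open>Start\<close> leads from input cell 0 to home cell -1, and the last step leads
  back, so that the head stands on cell 0 when the output is read.\<close>

fun trans :: "nat \<Rightarrow> state \<Rightarrow> sym \<Rightarrow> state \<times> sym \<times> move" where
  "trans W (K, Halt) h = (([], Halt), h, Nm)"
| "trans W (K, Start) h = ((K, Out 0), h, Lm)"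
| "trans W ([], l) h = (([], Halt), h, Rm)"
| "trans W (Skip # K, l) h = ((K, Out 0), h, Nm)"
| "trans W ((c1 ;; c2) # K, l) h = ((c1 # c2 # K, Out 0), h, Nm)"
| "trans W (Push r b # K, l) h = micro W (idx r) (Some b) (Push r b # K) K K K l h"
| "trans W (Case r c0 c1 c2 # K, l) h =
     micro W (idx r) None (Case r c0 c1 c2 # K) (c0 # K) (c1 # K) (c2 # K) l h"
| "trans W (Loop r c1 c2 # K, l) h =
     micro W (idx r) None (Loop r c1 c2 # K) K (c1 # Loop r c1 c2 # K) (c2 # Loop r c1 c2 # K) l h"

text \<open>The stack Tp grows to the right from cell 0; the other stacks grow to the left as the tracks 1,
  ..., W - 1 of the cells -2, -3, ..., which are interleaved with period W. Track 0 serves for navigation and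
  is unconstrained apart from the blank home cell -1.\<close>
definition mem :: "nat \<Rightarrow> store \<Rightarrow> (int \<Rightarrow> sym) \<Rightarrow> bool" where
  "mem W s \<tau> \<longleftrightarrow> \<tau> (-1) = Bl \<and> (\<forall>i. \<tau> (int i) = cell (map bit_sym (rev (s Tp))) i) \<and>
     (\<forall>r i. r \<noteq> Tp \<longrightarrow> idx r < W \<longrightarrow> \<tau> (-1 - int (i * W + idx r)) = cell (map bit_sym (rev (s r))) i)"

section \<open>Head movements during a single stack operation\<close>

definition reach :: "(state \<Rightarrow> sym \<Rightarrow> state \<times> sym \<times> move) \<Rightarrow> state mconf \<Rightarrow> nat \<Rightarrow> state mconf \<Rightarrow> bool" where
  "reach \<delta> c n c' \<longleftrightarrow> (mstep \<delta> ^^ n) c = c'"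

lemma reach_0: "reach \<delta> c 0 c"
  by (simp add: reach_def)

lemma reach_1: "mstep \<delta> c = c' \<Longrightarrow> reach \<delta> c 1 c'"
  by (simp add: reach_def)

lemma reach_trans: "reach \<delta> c m c' \<Longrightarrow> reach \<delta> c' n c'' \<Longrightarrow> reach \<delta> c (m + n) c''"
  by (auto simp: reach_def funpow_add add.commute[of m])

lemma reach_Suc: "mstep \<delta> c = c' \<Longrightarrow> reach \<delta> c' n c'' \<Longrightarrow> reach \<delta> c (Suc n) c''"
  using reach_trans[OF reach_1, of \<delta> c c' n c''] by simp

lemma reach_snoc: "reach \<delta> c n c' \<Longrightarrow> mstep \<delta> c' = c'' \<Longrightarrow> reach \<delta> c (Suc n) c''"
  by (simp add: reach_def)

text \<open>Isolates one stack instruction, so that the walks are analysed once for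
  \<open>Push\<close>, \<open>Case\<close> and \<open>Loop\<close>; these differ only in
  \<open>op\<close> and in the exits \<open>kE\<close>, \<open>kF\<close>,
  \<open>kT\<close>.\<close>

locale microcode =
  fixes W r :: nat and op :: "bool option" and K kE kF kT :: "com list"
    and \<delta> :: "state \<Rightarrow> sym \<Rightarrow> state \<times> sym \<times> move"
  assumes delta: "l \<noteq> Halt \<Longrightarrow> l \<noteq> Start \<Longrightarrow> \<delta> (K, l) h = micro W r op K kE kF kT l h"
    and W: "r < W"
begin

text \<open>\<open>ast\<close> and \<open>marked\<close> give the phase and the tape after n outward
  steps; together they form the invariant of \<open>outward\<close>.\<close>

definition ast :: "nat \<Rightarrow> loc" where
  "ast n = (if n = 0 then Out 0 else Out ((n - 1) mod W + 1))"

definition marked :: "nat \<Rightarrow> (int \<Rightarrow> sym) \<Rightarrow> int \<Rightarrow> sym" where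
  "marked n \<tau> = (\<lambda>p. if \<exists>m. 0 < m \<and> m < n \<and> W dvd m \<and> p = -1 - int m then Zero else \<tau> p)"

lemma marked_same: "n mod W \<noteq> 0 \<Longrightarrow> marked m \<tau> (-1 - int n) = \<tau> (-1 - int n)"
  by (auto simp: marked_def)

lemma marked_Suc:
  "marked (Suc n) \<tau> = (if 0 < n \<and> W dvd n then (marked n \<tau>)(-1 - int n := Zero) else marked n \<tau>)"
  by (rule ext) (auto simp: marked_def less_Suc_eq)

lemma ast_Suc: "r > 0 \<Longrightarrow> ast (Suc n) = (if n mod W = 0 then Out 1 else Out (n mod W + 1))"
  by (simp add: ast_def)

lemma ast_pos: "r > 0 \<Longrightarrow> n > 0 \<Longrightarrow> ast n = (if n mod W = 0 then Out W else Out (n mod W))"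
  using W by (cases n) (auto simp: ast_def mod_Suc)

lemma outward:
  assumes r: "r > 0" and nb: "\<And>m. m < n \<Longrightarrow> m mod W = r \<Longrightarrow> \<tau> (-1 - int m) \<noteq> Bl"
  shows "reach \<delta> ((K, Out 0), -1, \<tau>) n ((K, ast n), -1 - int n, marked n \<tau>)"
  using nb
proof (induction n)
  case 0
  then show ?case by (simp add: reach_0 ast_def marked_def)
next
  case (Suc n)
  have "mstep \<delta> ((K, ast n), -1 - int n, marked n \<tau>) = ((K, ast (Suc n)), -1 - int (Suc n), marked (Suc n) \<tau>)"
  proof (cases "n = 0")
    case True
    then show ?thesis using W r by (auto simp: mstep_simp ast_def delta marked_Suc)
  next
    case False
    show ?thesis
    proof (cases "n mod W = 0")
      case True
      then have "W dvd n" by auto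
      moreover have "ast n = Out W" using True False r by (simp add: ast_pos)
      moreover have "ast (Suc n) = Out 1" using True r by (simp only: ast_Suc) simp
      ultimately show ?thesis using W r False True by (auto simp: mstep_simp delta marked_Suc)
    next
      case f: False
      then have "\<not> W dvd n" "(W \<le> n mod W) = False" using W by (auto simp: not_le)
      moreover have "ast n = Out (n mod W)" using f False r by (simp add: ast_pos)
      moreover have "ast (Suc n) = Out (n mod W + 1)" using f r by (simp only: ast_Suc) simp
      ultimately show ?thesis using W r False f Suc.prems[of n] marked_same[OF f, of n \<tau>]
        by (auto simp: mstep_simp delta marked_Suc)
    qed
  qed
  then show ?case using Suc reach_snoc by fastforce
qed

text \<open>The phase tells when track 0 is scanned, and there the home cell is the first blank met.
  The way back thus needs no distance counter, only finitely many phases.\<close>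

lemma homeward:
  assumes r: "r > 0" and nb: "\<And>m. 0 < m \<Longrightarrow> m \<le> n \<Longrightarrow> W dvd m \<Longrightarrow> \<tau> (-1 - int m) \<noteq> Bl" and hm: "\<tau> (-1) = Bl"
  shows "reach \<delta> ((K, Home b (n mod W)), -1 - int n, \<tau>) (Suc n) ((if b then kT else kF, Out 0), -1, \<tau>)"
  using nb
proof (induction n)
  case 0
  then show ?case using hm by (intro reach_1[simplified]) (auto simp: mstep_simp delta)
next
  case (Suc n)
  have "mstep \<delta> ((K, Home b (Suc n mod W)), -1 - int (Suc n), \<tau>) = ((K, Home b (n mod W)), -1 - int n, \<tau>)"
  proof (cases "Suc n mod W = 0")
    case True
    then have "n mod W = W - 1" using mod_Suc[of n W] W by (auto split: if_splits)
    then show ?thesis using True Suc.prems[of "Suc n"] r by (auto simp: mstep_simp delta)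
  next
    case False
    then have "Suc n mod W = Suc (n mod W)" by (simp add: mod_Suc split: if_splits)
    then show ?thesis using r by (auto simp: mstep_simp delta)
  qed
  then show ?case using Suc.IH Suc.prems by (intro reach_Suc[where n = "Suc n"]) auto
qed

lemma rightE:
  assumes "d \<le> j"
  shows "reach \<delta> ((K, Back j), p, \<tau>) d ((K, Back (j - d)), p + int d, \<tau>)"
  using assms
proof (induction d)
  case (Suc d)
  then have "mstep \<delta> ((K, Back (j - d)), p + int d, \<tau>) = ((K, Back (j - Suc d)), p + int (Suc d), \<tau>)"
    by (auto simp: mstep_simp delta)
  then show ?case using Suc reach_snoc by fastforce
qed (simp add: reach_0)

lemma rightF:
  assumes "d + r \<le> j"
  shows "reach \<delta> ((K, Fetch j), p, \<tau>) d ((K, Fetch (j - d)), p + int d, \<tau>)"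
  using assms
proof (induction d)
  case (Suc d)
  then have "mstep \<delta> ((K, Fetch (j - d)), p + int d, \<tau>) = ((K, Fetch (j - Suc d)), p + int (Suc d), \<tau>)"
    by (auto simp: mstep_simp delta)
  then show ?case using Suc reach_snoc by fastforce
qed (simp add: reach_0)

text \<open>\<open>mem\<close> leaves track 0 free apart from the home cell, and marking touches
  nothing else.\<close>

lemma mem_marked: "mem W s \<tau> \<Longrightarrow> mem W s (marked n \<tau>)"
  by (auto simp: mem_def marked_same idx_0 simp del: of_nat_add of_nat_mult) (auto simp: marked_def)

end

lemma block_eq:
  assumes "a < (W::nat)" "a' < W"
  shows "i * W + a = i' * W + a' \<longleftrightarrow> i = i' \<and> a = a'"
proof
  assume e: "i * W + a = i' * W + a'"
  have "(i * W + a) div W = i" "(i' * W + a') div W = i'" "(i * W + a) mod W = a" "(i' * W + a') mod W = a'"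
    using assms by auto
  then show "i = i' \<and> a = a'" using e by metis
qed simp

lemma block_eq': 
  assumes "a < (W::nat)" "a' < W"
  shows "-1 - int (i * W + a) = -1 - int (i' * W + a') \<longleftrightarrow> i = i' \<and> a = a'"
proof -
  have "-1 - int (i * W + a) = -1 - int (i' * W + a') \<longleftrightarrow> i * W + a = i' * W + a'" by linarith
  then show ?thesis using block_eq[OF assms] by simp
qed

lemma cell_snoc: "cell (l @ [x]) i = (if i = length l then x else cell l i)"
  by (auto simp: cell_def nth_append)

lemma cell_beyond: "length l \<le> i \<Longrightarrow> cell l i = Bl"
  by (simp add: cell_def)

lemma mem_push:
  assumes "mem W s \<tau>" "\<rho> \<noteq> Tp" "idx \<rho> < W"
  shows "mem W (s(\<rho> := b # s \<rho>)) (\<tau>(-1 - int (length (s \<rho>) * W + idx \<rho>) := bit_sym b))"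
  using assms unfolding mem_def
  by (auto simp: idx_0 block_eq' idx_inj cell_snoc simp del: of_nat_add of_nat_mult)

lemma neg_neq_int: "-1 - int a \<noteq> int b" "int b \<noteq> -1 - int a"
  by linarith+

lemma mem_push_Tp:
  assumes "mem W s \<tau>"
  shows "mem W (s(Tp := b # s Tp)) (\<tau>(int (length (s Tp)) := bit_sym b))"
  using assms unfolding mem_def
  by (auto simp: cell_snoc neg_neq_int simp del: of_nat_add of_nat_mult)

lemma mem_pop:
  assumes "mem W s \<tau>" "\<rho> \<noteq> Tp" "idx \<rho> < W" "s \<rho> = b # bs"
  shows "mem W (s(\<rho> := bs)) (\<tau>(-1 - int (length bs * W + idx \<rho>) := Bl))"
  using assms unfolding mem_def
  by (auto simp: idx_0 block_eq' idx_inj cell_snoc cell_beyond simp del: of_nat_add of_nat_mult)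

lemma mem_pop_Tp:
  assumes "mem W s \<tau>" "s Tp = b # bs"
  shows "mem W (s(Tp := bs)) (\<tau>(int (length bs) := Bl))"
  using assms unfolding mem_def
  by (auto simp: cell_snoc cell_beyond neg_neq_int simp del: of_nat_add of_nat_mult)

lemma mem_cell:
  assumes "mem W s \<tau>" "\<rho> \<noteq> Tp" "idx \<rho> < W"
  shows "\<tau> (-1 - int (i * W + idx \<rho>)) = (if i < length (s \<rho>) then bit_sym (rev (s \<rho>) ! i) else Bl)"
  using assms unfolding mem_def by (auto simp: cell_def)

context microcode begin

text \<open>Offset i*W + r from home holds bit i counted from the bottom of the stack. So every cell
  of track r passed on the way is nonblank, and the first blank appears at i =
  \<open>length (s \<rho>)\<close>.\<close>

lemma reach_end:
  assumes m: "mem W s \<tau>" and \<rho>: "\<rho> \<noteq> Tp" "idx \<rho> = r" and n: "n = length (s \<rho>) * W + r"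
  shows "reach \<delta> ((K, Out 0), -1, \<tau>) n ((K, Out r), -1 - int n, marked n \<tau>)"
    and "marked n \<tau> (-1 - int n) = Bl"
proof -
  have r: "r > 0" using \<rho> by (cases "r = 0") (auto simp: idx_0)
  have nm: "n mod W = r" using W n by simp
  have "\<tau> (-1 - int k) \<noteq> Bl" if "k < n" "k mod W = r" for k
  proof -
    have k: "k = (k div W) * W + r" using that by (metis div_mult_mod_eq)
    have "(k div W) * W < length (s \<rho>) * W" using that(1) k n by linarith
    then have "k div W < length (s \<rho>)" by simp
    then show ?thesis using mem_cell[OF m \<rho>(1), of "k div W"] \<rho> W k by (metis bit_sym_neq_Bl(1))
  qed
  from outward[where n = n and \<tau> = \<tau>, OF r this] show "reach \<delta> ((K, Out 0), -1, \<tau>) n ((K, Out r), -1 - int n, marked n \<tau>)"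
    using nm r n by (simp add: ast_pos)
  show "marked n \<tau> (-1 - int n) = Bl"
    using mem_cell[OF mem_marked[OF m, of n] \<rho>(1), of "length (s \<rho>)"] \<rho> W n by simp
qed

lemma go_home:
  assumes r: "r > 0" and n: "n = i * W + r" and hm: "\<tau> (-1) = Bl" 
    and nb: "\<And>m. 0 < m \<Longrightarrow> m < n \<Longrightarrow> W dvd m \<Longrightarrow> \<tau> (-1 - int m) \<noteq> Bl"
  shows "reach \<delta> ((K, Home b (r - 1)), - int n, \<tau>) n ((if b then kT else kF, Out 0), -1, \<tau>)"
proof -
  have e: "n - 1 = i * W + (r - 1)" using n r by simp
  have "(n - 1) mod W = r - 1" unfolding e using W by (simp add: less_imp_diff_less)
  moreover have "\<tau> (-1 - int m) \<noteq> Bl" if "0 < m" "m \<le> n - 1" "W dvd m" for m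
    using nb[of m] that n r by auto
  ultimately show ?thesis using homeward[OF r, of "n - 1" \<tau> b] hm n r by (simp add: of_nat_diff)
qed

lemma marked_neq_Bl: "0 < m \<Longrightarrow> m < n \<Longrightarrow> W dvd m \<Longrightarrow> marked n \<tau> (-1 - int m) \<noteq> Bl"
  by (auto simp: marked_def)

lemma push_track:
  assumes m: "mem W s \<tau>" and \<rho>: "\<rho> \<noteq> Tp" "idx \<rho> = r" and op: "op = Some b" and ex: "kT = K'" "kF = K'"
  shows "\<exists>n \<tau>'. n \<le> 4 * W * (length (s \<rho>) + 2) \<and> mem W (s(\<rho> := b # s \<rho>)) \<tau>'
     \<and> reach \<delta> ((K, Out 0), -1, \<tau>) n ((K', Out 0), -1, \<tau>')"
proof -
  have r: "r > 0" using \<rho> by (cases "r = 0") (auto simp: idx_0)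
  define n where "n = length (s \<rho>) * W + r"
  define \<tau>' where "\<tau>' = (marked n \<tau>)(-1 - int n := bit_sym b)"
  note re = reach_end[OF m \<rho> n_def]
  have 1: "mstep \<delta> ((K, Out r), -1 - int n, marked n \<tau>) = ((K, Home b (r - 1)), - int n, \<tau>')"
    using re(2) r op by (simp add: mstep_simp delta \<tau>'_def)
  have mm: "mem W (s(\<rho> := b # s \<rho>)) \<tau>'"
    unfolding \<tau>'_def n_def using mem_push[OF mem_marked[OF m] \<rho>(1)] \<rho> W by simp
  have "reach \<delta> ((K, Home b (r - 1)), - int n, \<tau>') n ((if b then kT else kF, Out 0), -1, \<tau>')"
    using mm by (intro go_home[OF r n_def]) (auto simp: mem_def \<tau>'_def marked_neq_Bl)
  from reach_trans[OF re(1) reach_Suc[OF 1 this]]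
  have "reach \<delta> ((K, Out 0), -1, \<tau>) (n + Suc n) ((K', Out 0), -1, \<tau>')" using ex by (simp split: if_splits)
  moreover have "n + Suc n \<le> 4 * W * (length (s \<rho>) + 2)" using W by (simp add: n_def algebra_simps)
  ultimately show ?thesis using mm by blast
qed

lemma pop_track_Nil:
  assumes m: "mem W s \<tau>" and \<rho>: "\<rho> \<noteq> Tp" "idx \<rho> = r" and op: "op = None" and s: "s \<rho> = []"
  shows "\<exists>n \<tau>'. n \<le> 4 * W * (length (s \<rho>) + 2) \<and> mem W s \<tau>'
     \<and> reach \<delta> ((K, Out 0), -1, \<tau>) n ((kE, Out 0), -1, \<tau>')"
proof -
  have r: "r > 0" using \<rho> by (cases "r = 0") (auto simp: idx_0)
  have n: "r = length (s \<rho>) * W + r" using s by simp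
  define \<tau>' where "\<tau>' = marked r \<tau>"
  note re = reach_end[OF m \<rho> n]
  have 1: "mstep \<delta> ((K, Out r), -1 - int r, \<tau>') = ((K, Back (r - 1)), - int r, \<tau>')"
    using re(2) r op by (auto simp: mstep_simp delta \<tau>'_def)
  have mm: "mem W s \<tau>'" unfolding \<tau>'_def by (rule mem_marked[OF m])
  have 2: "reach \<delta> ((K, Back (r - 1)), - int r, \<tau>') (r - 1) ((K, Back 0), -1, \<tau>')"
    using rightE[of "r - 1" "r - 1" "- int r" \<tau>'] r by (simp add: of_nat_diff)
  have 3: "mstep \<delta> ((K, Back 0), -1, \<tau>') = ((kE, Out 0), -1, \<tau>')"
    using mm by (auto simp: mstep_simp delta mem_def)
  have "reach \<delta> ((K, Out 0), -1, \<tau>) (r + Suc (r - 1 + 1)) ((kE, Out 0), -1, \<tau>')"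
    using re(1) by (intro reach_trans[OF _ reach_Suc[OF 1 reach_trans[OF 2 reach_1[OF 3]]]]) (simp add: \<tau>'_def)
  moreover have "r + Suc (r - 1 + 1) \<le> 4 * W * (length (s \<rho>) + 2)" using W by simp
  ultimately show ?thesis using mm by blast
qed

lemma pop_track_Cons:
  assumes m: "mem W s \<tau>" and \<rho>: "\<rho> \<noteq> Tp" "idx \<rho> = r" and op: "op = None" and s: "s \<rho> = b # bs"
  shows "\<exists>n \<tau>'. n \<le> 4 * W * (length (s \<rho>) + 2) \<and> mem W (s(\<rho> := bs)) \<tau>'
     \<and> reach \<delta> ((K, Out 0), -1, \<tau>) n ((if b then kT else kF, Out 0), -1, \<tau>')"
proof -
  have r: "r > 0" using \<rho> by (cases "r = 0") (auto simp: idx_0)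
  define n where "n = length (s \<rho>) * W + r"
  define i where "i = length bs"
  \<comment> \<open>The top bit lies one period W nearer to home than the blank above it.\<close>
  define n' where "n' = i * W + r"
  have nn: "n = n' + W" by (simp add: n_def n'_def i_def s)
  define \<tau>0 where "\<tau>0 = marked n \<tau>"
  define \<tau>' where "\<tau>' = \<tau>0(-1 - int n' := Bl)"
  note re = reach_end[OF m \<rho> n_def]
  have m0: "mem W s \<tau>0" unfolding \<tau>0_def by (rule mem_marked[OF m])
  have 1: "mstep \<delta> ((K, Out r), -1 - int n, \<tau>0) = ((K, Back (r - 1)), - int n, \<tau>0)"
    using re(2) r op by (auto simp: mstep_simp delta \<tau>0_def)
  have 2: "reach \<delta> ((K, Back (r - 1)), - int n, \<tau>0) (r - 1) ((K, Back 0), - int n + int (r - 1), \<tau>0)"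
    using rightE[of "r - 1" "r - 1" "- int n" \<tau>0] r by simp
  have p: "- int n + int (r - 1) = -1 - int (Suc i * W)"
    using r by (simp add: n_def s i_def of_nat_diff algebra_simps)
  have "\<tau>0 (-1 - int (Suc i * W)) \<noteq> Bl" unfolding \<tau>0_def
    using r W by (intro marked_neq_Bl) (auto simp: n_def s i_def)
  then have 3: "mstep \<delta> ((K, Back 0), - int n + int (r - 1), \<tau>0) = ((K, Fetch (W - 1)), - int (Suc i * W), \<tau>0)"
    unfolding p using r by (auto simp: mstep_simp delta)
  have 4: "reach \<delta> ((K, Fetch (W - 1)), - int (Suc i * W), \<tau>0) (W - 1 - r) ((K, Fetch r), -1 - int n', \<tau>0)"
    using rightF[of "W - 1 - r" "W - 1" "- int (Suc i * W)" \<tau>0] W by (simp add: n'_def of_nat_diff algebra_simps)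
  have "\<tau>0 (-1 - int n') = bit_sym b"
    using mem_cell[OF m0 \<rho>(1), of i] \<rho> W s by (simp add: n'_def i_def nth_append)
  then have 5: "mstep \<delta> ((K, Fetch r), -1 - int n', \<tau>0) = ((K, Home b (r - 1)), - int n', \<tau>')"
    by (simp add: mstep_simp delta \<tau>'_def bit_sym_One)
  have mm: "mem W (s(\<rho> := bs)) \<tau>'"
    unfolding \<tau>'_def n'_def i_def using mem_pop[OF m0 \<rho>(1) _ s] \<rho> W by simp
  have "\<tau>' (-1 - int k) \<noteq> Bl" if "0 < k" "k < n'" "W dvd k" for k
    using marked_neq_Bl[of k n \<tau>] that nn by (auto simp: \<tau>'_def \<tau>0_def)
  then have 6: "reach \<delta> ((K, Home b (r - 1)), - int n', \<tau>') n' ((if b then kT else kF, Out 0), -1, \<tau>')"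
    using mm by (intro go_home[OF r n'_def]) (auto simp: mem_def)
  have "reach \<delta> ((K, Out 0), -1, \<tau>) (n + Suc (r - 1 + Suc (W - 1 - r + Suc n'))) ((if b then kT else kF, Out 0), -1, \<tau>')"
    using re(1) unfolding \<tau>0_def[symmetric]
    by (rule reach_trans[OF _ reach_Suc[OF 1 reach_trans[OF 2 reach_Suc[OF 3 reach_trans[OF 4 reach_Suc[OF 5 6]]]]]])
  moreover have "n + Suc (r - 1 + Suc (W - 1 - r + Suc n')) \<le> 4 * W * (length (s \<rho>) + 2)"
    using W r by (simp add: n_def n'_def i_def s algebra_simps)
  ultimately show ?thesis using mm by blast
qed

end

section \<open>Operations on the tape stack, and both kinds of stacks combined\<close>

context microcode begin

lemma tape_out:
  assumes "r = 0" "\<And>i. i < n \<Longrightarrow> \<tau> (int i) \<noteq> Bl"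
  shows "reach \<delta> ((K, Out 0), -1, \<tau>) (Suc n) ((K, Out 1), int n, \<tau>)"
  using assms(2)
proof (induction n)
  case 0
  then show ?case using assms(1) by (intro reach_1[simplified]) (auto simp: mstep_simp delta)
next
  case (Suc n)
  have "mstep \<delta> ((K, Out 1), int n, \<tau>) = ((K, Out 1), int (Suc n), \<tau>)"
    using assms(1) Suc.prems[of n] by (auto simp: mstep_simp delta)
  then show ?case using Suc by (intro reach_snoc[OF Suc.IH]) auto
qed

lemma tape_home:
  assumes "r = 0" "\<And>i. i < n \<Longrightarrow> \<tau> (int i) \<noteq> Bl" "\<tau> (-1) = Bl"
  shows "reach \<delta> ((K, Home b 0), int n - 1, \<tau>) (Suc n) ((if b then kT else kF, Out 0), -1, \<tau>)"
  using assms(2)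
proof (induction n)
  case 0
  then show ?case using assms(1,3) by (intro reach_1[simplified]) (auto simp: mstep_simp delta)
next
  case (Suc n)
  have "mstep \<delta> ((K, Home b 0), int (Suc n) - 1, \<tau>) = ((K, Home b 0), int n - 1, \<tau>)"
    using assms(1) Suc.prems[of n] by (auto simp: mstep_simp delta)
  then show ?case using Suc by (intro reach_Suc[where n = "Suc n"]) auto
qed

lemma mem_tape: "mem W s \<tau> \<Longrightarrow> \<tau> (int i) = (if i < length (s Tp) then bit_sym (rev (s Tp) ! i) else Bl)"
  unfolding mem_def by (auto simp: cell_def)

lemma push_tape:
  assumes m: "mem W s \<tau>" and r: "r = 0" and op: "op = Some b" and ex: "kT = K'" "kF = K'"
  shows "\<exists>n \<tau>'. n \<le> 4 * W * (length (s Tp) + 2) \<and> mem W (s(Tp := b # s Tp)) \<tau>'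
     \<and> reach \<delta> ((K, Out 0), -1, \<tau>) n ((K', Out 0), -1, \<tau>')"
proof -
  define n where "n = length (s Tp)"
  define \<tau>' where "\<tau>' = \<tau>(int n := bit_sym b)"
  have mm: "mem W (s(Tp := b # s Tp)) \<tau>'" unfolding \<tau>'_def n_def by (rule mem_push_Tp[OF m])
  have 1: "reach \<delta> ((K, Out 0), -1, \<tau>) (Suc n) ((K, Out 1), int n, \<tau>)"
    by (rule tape_out[OF r]) (simp add: mem_tape[OF m] n_def bit_sym_neq_Bl)
  have 2: "mstep \<delta> ((K, Out 1), int n, \<tau>) = ((K, Home b 0), int n - 1, \<tau>')"
    using r op mem_tape[OF m, of n] by (simp add: mstep_simp delta \<tau>'_def n_def)
  have 3: "reach \<delta> ((K, Home b 0), int n - 1, \<tau>') (Suc n) ((if b then kT else kF, Out 0), -1, \<tau>')"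
    by (rule tape_home[OF r]) (use mm in \<open>simp_all add: mem_tape[OF m] n_def bit_sym_neq_Bl \<tau>'_def mem_def\<close>)
  have "reach \<delta> ((K, Out 0), -1, \<tau>) (Suc n + Suc (Suc n)) ((K', Out 0), -1, \<tau>')"
    using reach_trans[OF 1 reach_Suc[OF 2 3]] ex by (simp split: if_splits)
  moreover have "1 * (2 * n + 4) \<le> W * (4 * n + 8)" by (rule mult_mono) (use W in auto)
  then have "Suc n + Suc (Suc n) \<le> 4 * W * (length (s Tp) + 2)" using W by (simp add: n_def algebra_simps)
  ultimately show ?thesis using mm by blast
qed

lemma pop_tape:
  assumes m: "mem W s \<tau>" and r: "r = 0" and op: "op = None"
  shows "\<exists>n \<tau>'. n \<le> 4 * W * (length (s Tp) + 2) \<and> mem W (s(Tp := tl (s Tp))) \<tau>'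
     \<and> reach \<delta> ((K, Out 0), -1, \<tau>) n ((case s Tp of [] \<Rightarrow> kE | b # _ \<Rightarrow> if b then kT else kF, Out 0), -1, \<tau>')"
proof -
  define n where "n = length (s Tp)"
  have 1: "reach \<delta> ((K, Out 0), -1, \<tau>) (Suc n) ((K, Out 1), int n, \<tau>)"
    by (rule tape_out[OF r]) (simp add: mem_tape[OF m] n_def bit_sym_neq_Bl)
  have 2: "mstep \<delta> ((K, Out 1), int n, \<tau>) = ((K, Back 0), int n - 1, \<tau>)"
    using r op mem_tape[OF m, of n] by (auto simp: mstep_simp delta n_def)
  have bd: "1 * (2 * n + 4) \<le> W * (4 * n + 8)" by (rule mult_mono) (use W in auto)
  show ?thesis
  proof (cases "s Tp")
    case Nil
    have 3: "mstep \<delta> ((K, Back 0), int n - 1, \<tau>) = ((kE, Out 0), -1, \<tau>)"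
      using m Nil by (auto simp: mstep_simp delta n_def mem_def)
    have "reach \<delta> ((K, Out 0), -1, \<tau>) (Suc n + Suc 1) ((kE, Out 0), -1, \<tau>)"
      using reach_trans[OF 1 reach_Suc[OF 2 reach_1[OF 3]]] .
    moreover have "Suc n + Suc 1 \<le> 4 * W * (length (s Tp) + 2)" using bd by (simp add: n_def algebra_simps)
    moreover have "mem W (s(Tp := tl (s Tp))) \<tau>" using m Nil by (simp add: fun_upd_idem)
    ultimately show ?thesis using Nil by auto
  next
    case (Cons b bs)
    define i where "i = length bs"
    define \<tau>' where "\<tau>' = \<tau>(int i := Bl)"
    have mm: "mem W (s(Tp := bs)) \<tau>'" unfolding \<tau>'_def i_def by (rule mem_pop_Tp[OF m Cons])
    have ni: "n = Suc i" by (simp add: n_def i_def Cons)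
    have "\<tau> (int i) = bit_sym b" using mem_tape[OF m, of i] Cons by (simp add: i_def nth_append)
    then have 3: "mstep \<delta> ((K, Back 0), int n - 1, \<tau>) = ((K, Home b 0), int i - 1, \<tau>')"
      using r by (simp add: mstep_simp delta ni bit_sym_One bit_sym_neq_Bl \<tau>'_def)
    have 4: "reach \<delta> ((K, Home b 0), int i - 1, \<tau>') (Suc i) ((if b then kT else kF, Out 0), -1, \<tau>')"
      by (rule tape_home[OF r]) (use mm in \<open>simp_all add: mem_tape[OF m] i_def Cons bit_sym_neq_Bl \<tau>'_def mem_def\<close>)
    have "reach \<delta> ((K, Out 0), -1, \<tau>) (Suc n + Suc (Suc (Suc i))) ((if b then kT else kF, Out 0), -1, \<tau>')"
      using reach_trans[OF 1 reach_Suc[OF 2 reach_Suc[OF 3 4]]] .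
    moreover have "Suc n + Suc (Suc (Suc i)) \<le> 4 * W * (length (s Tp) + 2)"
      using bd ni by (simp add: n_def algebra_simps)
    ultimately show ?thesis using mm unfolding Cons list.sel list.case by blast
  qed
qed

lemma exec_push:
  assumes m: "mem W s \<tau>" and \<rho>: "idx \<rho> = r" and op: "op = Some b" and ex: "kT = K'" "kF = K'"
  shows "\<exists>n \<tau>'. n \<le> 4 * W * (length (s \<rho>) + 2) \<and> mem W (s(\<rho> := b # s \<rho>)) \<tau>'
     \<and> reach \<delta> ((K, Out 0), -1, \<tau>) n ((K', Out 0), -1, \<tau>')"
  using push_tape[OF m _ op ex] push_track[OF m _ \<rho> op ex] \<rho> by (cases "\<rho> = Tp") auto

lemma exec_pop:
  assumes m: "mem W s \<tau>" and \<rho>: "idx \<rho> = r" and op: "op = None"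
  shows "\<exists>n \<tau>'. n \<le> 4 * W * (length (s \<rho>) + 2) \<and> mem W (s(\<rho> := tl (s \<rho>))) \<tau>'
     \<and> reach \<delta> ((K, Out 0), -1, \<tau>) n ((case s \<rho> of [] \<Rightarrow> kE | b # _ \<Rightarrow> if b then kT else kF, Out 0), -1, \<tau>')"
proof (cases "\<rho> = Tp")
  case True
  then show ?thesis using pop_tape[OF m _ op] \<rho> by auto
next
  case False
  show ?thesis
  proof (cases "s \<rho>")
    case Nil
    then have "s(\<rho> := tl (s \<rho>)) = s" by (simp add: fun_upd_idem)
    then show ?thesis using pop_track_Nil[OF m False \<rho> op Nil] Nil by simp
  next
    case (Cons b bs)
    then show ?thesis using pop_track_Cons[OF m False \<rho> op Cons] by simp
  qed
qed

lemma micro_closed: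
  assumes "micro W r op K kE kF kT l h = ((K', l'), w, m)" "l \<in> locs W" "l \<noteq> Start"
  shows "(K', l') \<in> {K, kE, kF, kT} \<times> locs W"
  using assms W by (cases l) (auto split: if_splits option.splits)

end

section \<open>Finite control and step-by-step simulation\<close>

lemma conts_closed:
  "K' \<in> conts c K \<Longrightarrow> fst (sstep (K', s)) \<in> insert K (conts c K)"
proof (induction c arbitrary: K)
  case (Case r c0 c1 c2)
  then show ?case
    using head_conts[of c0 K] head_conts[of c1 K] head_conts[of c2 K] by (auto split: list.split)
next
  case (Seq c1 c2)
  then consider "K' = (c1 ;; c2) # K" | "K' \<in> conts c1 (c2 # K)" | "K' \<in> conts c2 K" by auto
  then show ?case
    using Seq.IH(1)[of "c2 # K"] Seq.IH(2)[of K] head_conts[of c1 "c2 # K"] head_conts[of c2 K]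
    by cases auto
next
  case (Loop r c1 c2)
  let ?L = "Loop r c1 c2 # K"
  from Loop.prems consider "K' = ?L" | "K' \<in> conts c1 ?L" | "K' \<in> conts c2 ?L" by auto
  then show ?case
    using Loop.IH(1)[of ?L] Loop.IH(2)[of ?L] head_conts[of c1 ?L] head_conts[of c2 ?L]
    by cases (auto split: list.split)
qed auto

lemma width_2: "2 \<le> width c"
  by (induction c) auto

lemma trans_microcode:
  assumes "width c \<le> W"
  shows "c = Push r b \<Longrightarrow> microcode W (idx r) (Some b) (c # K) K K K (trans W)"
    and "c = Case r c0 c1 c2 \<Longrightarrow> microcode W (idx r) None (c # K) (c0 # K) (c1 # K) (c2 # K) (trans W)"
    and "c = Loop r c1 c2 \<Longrightarrow> microcode W (idx r) None (c # K) K (c1 # c # K) (c2 # c # K) (trans W)"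
proof -
  show "c = Push r b \<Longrightarrow> microcode W (idx r) (Some b) (c # K) K K K (trans W)"
    using assms by unfold_locales (auto, rename_tac l h, case_tac l, auto)
  show "c = Case r c0 c1 c2 \<Longrightarrow> microcode W (idx r) None (c # K) (c0 # K) (c1 # K) (c2 # K) (trans W)"
    using assms by unfold_locales (auto, rename_tac l h, case_tac l, auto)
  show "c = Loop r c1 c2 \<Longrightarrow> microcode W (idx r) None (c # K) K (c1 # c # K) (c2 # c # K) (trans W)"
    using assms by unfold_locales (auto, rename_tac l h, case_tac l, auto)
qed

lemma trans_closed:
  assumes tr: "trans W (K, l) h = ((K', l'), w, m)" and l: "l \<in> locs W"
    and wd: "\<forall>c \<in> set K. width c \<le> W"
  shows "(K', l') = ([], Halt) \<or> l' \<in> locs W \<and> (K' = K \<or> (\<exists>s. K' = fst (sstep (K, s))))"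
proof (cases "l = Start \<or> K = []")
  case True
  then show ?thesis using tr l by (cases l; cases K) auto
next
  case False
  then obtain c K0 where Cons: "K = c # K0" and nI: "l \<noteq> Start" by (cases K) auto
  have W: "width c \<le> W" using wd Cons by simp
  have nH: "l \<noteq> Halt" using l by auto
  \<comment> \<open>These constant stores make \<open>sstep\<close> take the empty, the False and
    the True branch, so every exit of \<open>micro\<close> is of the form
    \<open>fst (sstep (K, s))\<close>.\<close>
  define s :: "nat \<Rightarrow> store" where "s = (\<lambda>i _. if i = 0 then [] else if i = 1 then [False] else [True])"
  have s: "s 0 r = []" "s 1 r = [False]" "s 2 r = [True]" for r by (auto simp: s_def)
  show ?thesis
  proof (cases c)
    case Skip
    then show ?thesis using tr l Cons by (cases l) auto
  next
    case (Push r b)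
    interpret microcode W "idx r" "Some b" "c # K0" K0 K0 K0 "trans W"
      by (rule trans_microcode(1)[OF W Push])
    have "micro W (idx r) (Some b) (c # K0) K0 K0 K0 l h = ((K', l'), w, m)"
      using tr delta[OF nH nI, of h] Cons by simp
    then have "(K', l') \<in> {c # K0, K0, K0, K0} \<times> locs W" by (rule micro_closed[OF _ l nI])
    moreover have "fst (sstep (K, s 0)) = K0" using Cons Push by simp
    ultimately show ?thesis using Cons by (auto intro: exI[of _ "s 0"])
  next
    case (Case r c0 c1 c2)
    interpret microcode W "idx r" None "c # K0" "c0 # K0" "c1 # K0" "c2 # K0" "trans W"
      by (rule trans_microcode(2)[OF W Case])
    have "fst (sstep (K, s 0)) = c0 # K0" "fst (sstep (K, s 1)) = c1 # K0" "fst (sstep (K, s 2)) = c2 # K0"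
      using Cons Case s by auto
    moreover have "micro W (idx r) None (c # K0) (c0 # K0) (c1 # K0) (c2 # K0) l h = ((K', l'), w, m)"
      using tr delta[OF nH nI, of h] Cons by simp
    then have "(K', l') \<in> {c # K0, c0 # K0, c1 # K0, c2 # K0} \<times> locs W" by (rule micro_closed[OF _ l nI])
    ultimately show ?thesis using Cons by (auto intro: exI[of _ "s 0"] exI[of _ "s 1"] exI[of _ "s 2"])
  next
    case (Seq c1 c2)
    then show ?thesis using tr l Cons by (cases l) auto
  next
    case (Loop r c1 c2)
    interpret microcode W "idx r" None "c # K0" K0 "c1 # c # K0" "c2 # c # K0" "trans W"
      by (rule trans_microcode(3)[OF W Loop])
    have "fst (sstep (K, s 0)) = K0" "fst (sstep (K, s 1)) = c1 # c # K0" "fst (sstep (K, s 2)) = c2 # c # K0"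
      using Cons Loop s by auto
    moreover have "micro W (idx r) None (c # K0) K0 (c1 # c # K0) (c2 # c # K0) l h = ((K', l'), w, m)"
      using tr delta[OF nH nI, of h] Cons by simp
    then have "(K', l') \<in> {c # K0, K0, c1 # c # K0, c2 # c # K0} \<times> locs W" by (rule micro_closed[OF _ l nI])
    ultimately show ?thesis using Cons by (auto intro: exI[of _ "s 0"] exI[of _ "s 1"] exI[of _ "s 2"])
  qed
qed

text \<open>Guarantees that the number of tracks fixed for the initial command suffices for every
  continuation met later.\<close>

lemma width_conts:
  "K' \<in> conts c K \<Longrightarrow> c' \<in> set K' \<Longrightarrow> width c' \<le> width c \<or> c' \<in> set K"
proof (induction c arbitrary: K)
  case (Case r c0 c1 c2)
  from Case.prems(1) consider "K' = Case r c0 c1 c2 # K" | "K' \<in> conts c0 K" | "K' \<in> conts c1 K" | "K' \<in> conts c2 K"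
    by auto
  then show ?case using Case.IH Case.prems(2) by cases force+
next
  case (Seq c1 c2)
  from Seq.prems(1) consider "K' = (c1 ;; c2) # K" | "K' \<in> conts c1 (c2 # K)" | "K' \<in> conts c2 K" by auto
  then show ?case using Seq.IH(1)[of "c2 # K"] Seq.IH(2)[of K] Seq.prems(2) by cases force+
next
  case (Loop r c1 c2)
  let ?L = "Loop r c1 c2 # K"
  from Loop.prems(1) consider "K' = ?L" | "K' \<in> conts c1 ?L" | "K' \<in> conts c2 ?L" by auto
  then show ?case using Loop.IH(1)[of ?L] Loop.IH(2)[of ?L] Loop.prems(2) by cases force+
qed auto

lemma sstep_simulation:
  assumes m: "mem W s \<tau>" and wd: "\<forall>c \<in> set K. width c \<le> W" and K: "K \<noteq> []"
    and st: "sstep (K, s) = (K', s')" and H: "\<forall>r. length (s r) \<le> H"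
  shows "\<exists>n \<tau>'. n \<le> 4 * W * (H + 2) \<and> mem W s' \<tau>' \<and> reach (trans W) ((K, Out 0), -1, \<tau>) n ((K', Out 0), -1, \<tau>')"
proof (cases K)
  case Nil
  then show ?thesis using K by simp
next
  case (Cons c K0)
  have W: "width c \<le> W" using wd Cons by simp
  have W2: "2 \<le> W" using width_2[of c] W by simp
  have le: "4 * W * (length (s r) + 2) \<le> 4 * W * (H + 2)" for r using H by simp
  have one: "1 \<le> 4 * W * (H + 2)" using W2 by simp
  show ?thesis
  proof (cases c)
    case Skip
    have "mstep (trans W) ((K, Out 0), -1, \<tau>) = ((K', Out 0), -1, \<tau>)" using st Cons Skip by (simp add: mstep_simp)
    moreover have "s' = s" using st Cons Skip by simp
    ultimately show ?thesis using reach_1 one m by metis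
  next
    case (Push r b)
    interpret microcode W "idx r" "Some b" "c # K0" K0 K0 K0 "trans W"
      by (rule trans_microcode(1)[OF W Push])
    have e: "s' = s(r := b # s r)" "K' = K0" "K = c # K0" using st Cons Push by auto
    show ?thesis using exec_push[OF m refl refl refl refl] le[of r] unfolding e by (meson order_trans)
  next
    case (Case r c0 c1 c2)
    interpret microcode W "idx r" None "c # K0" "c0 # K0" "c1 # K0" "c2 # K0" "trans W"
      by (rule trans_microcode(2)[OF W Case])
    obtain n \<tau>' where n: "n \<le> 4 * W * (length (s r) + 2)" and mm: "mem W (s(r := tl (s r))) \<tau>'"
      and re: "reach (trans W) ((c # K0, Out 0), -1, \<tau>) n
        ((case s r of [] \<Rightarrow> c0 # K0 | b # _ \<Rightarrow> if b then c2 # K0 else c1 # K0, Out 0), -1, \<tau>')"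
      using exec_pop[OF m refl refl] by blast
    have "s' = s(r := tl (s r))" "K' = (case s r of [] \<Rightarrow> c0 # K0 | b # _ \<Rightarrow> if b then c2 # K0 else c1 # K0)"
      using st Cons Case by (auto simp: fun_upd_idem split: list.splits)
    then show ?thesis using n le[of r] mm re Cons by (meson order_trans)
  next
    case (Seq c1 c2)
    have "mstep (trans W) ((K, Out 0), -1, \<tau>) = ((K', Out 0), -1, \<tau>)" using st Cons Seq by (simp add: mstep_simp)
    moreover have "s' = s" using st Cons Seq by simp
    ultimately show ?thesis using reach_1 one m by metis
  next
    case (Loop r c1 c2)
    interpret microcode W "idx r" None "c # K0" K0 "c1 # c # K0" "c2 # c # K0" "trans W"
      by (rule trans_microcode(3)[OF W Loop])
    obtain n \<tau>' where n: "n \<le> 4 * W * (length (s r) + 2)" and mm: "mem W (s(r := tl (s r))) \<tau>'"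
      and re: "reach (trans W) ((c # K0, Out 0), -1, \<tau>) n
        ((case s r of [] \<Rightarrow> K0 | b # _ \<Rightarrow> if b then c2 # c # K0 else c1 # c # K0, Out 0), -1, \<tau>')"
      using exec_pop[OF m refl refl] by blast
    have "s' = s(r := tl (s r))" "K' = (case s r of [] \<Rightarrow> K0 | b # _ \<Rightarrow> if b then c2 # c # K0 else c1 # c # K0)"
      using st Cons Loop by (auto simp: fun_upd_idem split: list.splits)
    then show ?thesis using n le[of r] mm re Cons by (meson order_trans)
  qed
qed

lemma sstep_length:
  assumes "sstep (K, s) = (K', s')" "\<forall>r. length (s r) \<le> H"
  shows "\<forall>r. length (s' r) \<le> Suc H"
proof (cases K)
  case Nil
  then show ?thesis using assms by (auto simp: le_Suc_eq)
next
  case (Cons c K0)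
  have "length (s' r) \<le> Suc (length (s r))" for r
    using assms(1) Cons by (cases c) (auto split: list.splits)
  then show ?thesis using assms(2) by (meson Suc_le_mono order_trans)
qed

lemma sstep_width:
  assumes "sstep (K, s) = (K', s')" "\<forall>c \<in> set K. width c \<le> W"
  shows "\<forall>c \<in> set K'. width c \<le> W"
proof (cases K)
  case (Cons c K0)
  then show ?thesis using assms by (cases c) (auto split: list.splits if_splits)
qed (use assms in auto)

text \<open>One step lengthens a stack by at most one bit, so H + t bounds all heights met within t
  steps; t operations of linear cost give the quadratic overhead.\<close>

lemma ssteps_simulation:
  assumes "(sstep ^^ t) (K, s) = ([], s')" "mem W s \<tau>" "\<forall>c \<in> set K. width c \<le> W" "\<forall>r. length (s r) \<le> H"
  shows "\<exists>n \<tau>'. n \<le> t * (4 * W * (H + t + 2)) \<and> mem W s' \<tau>' \<and> reach (trans W) ((K, Out 0), -1, \<tau>) n (([], Out 0), -1, \<tau>')"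
  using assms
proof (induction t arbitrary: K s \<tau> H)
  case 0
  then show ?case using reach_0 by fastforce
next
  case (Suc t)
  show ?case
  proof (cases "K = []")
    case True
    then have "(sstep ^^ n) (K, s) = ([], s)" for n by (induction n) auto
    then have "s' = s" using Suc.prems(1) by (metis prod.inject)
    then show ?thesis using True Suc.prems reach_0 by fastforce
  next
    case False
    obtain K1 s1 where st: "sstep (K, s) = (K1, s1)" by (cases "sstep (K, s)")
    then have r: "(sstep ^^ t) (K1, s1) = ([], s')" using Suc.prems(1) by (simp add: funpow_swap1)
    obtain n1 \<tau>1 where 1: "n1 \<le> 4 * W * (H + 2)" "mem W s1 \<tau>1"
      "reach (trans W) ((K, Out 0), -1, \<tau>) n1 ((K1, Out 0), -1, \<tau>1)"
      using sstep_simulation[OF Suc.prems(2,3) False st Suc.prems(4)] by blast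
    obtain n2 \<tau>2 where 2: "n2 \<le> t * (4 * W * (Suc H + t + 2))" "mem W s' \<tau>2"
      "reach (trans W) ((K1, Out 0), -1, \<tau>1) n2 (([], Out 0), -1, \<tau>2)"
      using Suc.IH[OF r 1(2) sstep_width[OF st Suc.prems(3)] sstep_length[OF st Suc.prems(4)]] by blast
    have "n1 + n2 \<le> 4 * W * (H + Suc t + 2) + t * (4 * W * (Suc H + t + 2))"
      by (intro add_mono order_trans[OF 1(1)] 2(1) mult_le_mono2) simp_all
    also have "\<dots> = Suc t * (4 * W * (H + Suc t + 2))" by simp
    finally show ?thesis using 2(2) reach_trans[OF 1(3) 2(3)] by blast
  qed
qed

section \<open>Timed big-step semantics and the compiled machine\<close>

inductive ex :: "com \<Rightarrow> store \<Rightarrow> nat \<Rightarrow> store \<Rightarrow> bool" where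
  Skip: "ex Skip s 1 s"
| Push: "ex (Push r b) s 1 (s(r := b # s r))"
| CaseE: "s r = [] \<Longrightarrow> ex c0 s t s' \<Longrightarrow> ex (Case r c0 c1 c2) s (Suc t) s'"
| CaseC: "s r = b # bs \<Longrightarrow> ex (if b then c2 else c1) (s(r := bs)) t s' \<Longrightarrow> ex (Case r c0 c1 c2) s (Suc t) s'"
| Seq: "ex c1 s t s' \<Longrightarrow> ex c2 s' t' s'' \<Longrightarrow> ex (c1 ;; c2) s (Suc (t + t')) s''"
| LoopE: "s r = [] \<Longrightarrow> ex (Loop r c1 c2) s 1 s"
| LoopC: "s r = b # bs \<Longrightarrow> ex (if b then c2 else c1) (s(r := bs)) t s' \<Longrightarrow> ex (Loop r c1 c2) s' t' s''
    \<Longrightarrow> ex (Loop r c1 c2) s (Suc (t + t')) s''"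

lemma funpow_trans: "(f ^^ m) x = y \<Longrightarrow> (f ^^ n) y = z \<Longrightarrow> (f ^^ (m + n)) x = z"
  by (auto simp: funpow_add add.commute[of m])

lemma funpow_Suc_first: "f x = y \<Longrightarrow> (f ^^ n) y = z \<Longrightarrow> (f ^^ Suc n) x = z"
  by (simp add: funpow_Suc_right del: funpow.simps)

lemma ex_ssteps: "ex c s t s' \<Longrightarrow> (sstep ^^ t) (c # K, s) = (K, s')"
proof (induction arbitrary: K rule: ex.induct)
  case (CaseE s r c0 t s' c1 c2)
  then show ?case by (intro funpow_Suc_first[OF _ CaseE.IH]) simp
next
  case (CaseC s r b bs c2 c1 t s' c0)
  then show ?case by (intro funpow_Suc_first[OF _ CaseC.IH]) (simp add: fun_upd_def)
next
  case (Seq c1 s t s' c2 t' s'')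
  show ?case by (rule funpow_Suc_first[OF _ funpow_trans[OF Seq.IH(1) Seq.IH(2)]]) simp
next
  case (LoopC s r b bs c2 c1 t s' t' s'')
  show ?case by (rule funpow_Suc_first[OF _ funpow_trans[OF LoopC.IH(1) LoopC.IH(2)]]) (simp add: LoopC.hyps fun_upd_def)
qed auto

definition init_store :: "bool list \<Rightarrow> store" where
  "init_store x = (\<lambda>r. if r = Tp then rev x else [])"

theorem compile:
  "\<exists>M a. wf_tm M \<and> (\<forall>x t s'. ex c (init_store x) t s' \<longrightarrow> (\<exists>n \<le> a * (length x + t + 1)^2.
      halted M ((tm_step M ^^ n) (tm_init x)) \<and> tm_output ((tm_step M ^^ n) (tm_init x)) = rev (s' Tp)))"
proof -
  define W where "W = width c"
  define Q where "Q = insert [] (conts c []) \<times> locs W"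
  have finQ: "finite Q" by (simp add: Q_def finite_conts finite_locs)
  obtain qs0 where qs0: "set qs0 = Q" using finite_list[OF finQ] by blast
  define q0 where "q0 = ([c], Start)"
  \<comment> \<open>The start state is put first because state 0 of a \<open>tm\<close> is initial.
    Its second occurrence in \<open>qs0\<close> is harmless, since \<open>index_of\<close> returns
    the first.\<close>
  define qs where "qs = q0 # qs0"
  define qh :: state where "qh = ([], Halt)"
  have q0: "q0 \<in> Q" using head_conts[of c "[]"] by (auto simp: q0_def Q_def)
  then have qs: "set qs = Q" by (auto simp: qs_def qs0)
  have i0: "index_of qs q0 = 0" by (simp add: qs_def index_of_def)
  define M where "M = tm_of qs (trans W)"
  have wd: "\<forall>c' \<in> set K. width c' \<le> W" if "K \<in> insert [] (conts c [])" for K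
    using that width_conts[of K c "[]"] by (auto simp: W_def)
  have closed: "q' \<in> insert qh (set qs)" if "q \<in> set qs" "trans W q h = (q', w, m)" for q h q' w m
  proof -
    obtain K l K' l' where q: "q = (K, l)" "q' = (K', l')" by (cases q, cases q')
    have K: "K \<in> insert [] (conts c [])" and l: "l \<in> locs W" using that q qs by (auto simp: Q_def)
    have "fst (sstep (K, s)) \<in> insert [] (conts c [])" for s
      using K conts_closed[of K c "[]" s] by auto
    then show ?thesis
      using trans_closed[OF that(2)[unfolded q] l wd[OF K]] K q qs by (auto simp: Q_def qh_def)
  qed
  have halt: "trans W qh h = (qh, h, Nm)" "qh \<notin> set qs" for h by (auto simp: qh_def qs Q_def)
  have "\<exists>n \<le> (8 * W + 2) * (length x + t + 1)^2. halted M ((tm_step M ^^ n) (tm_init x)) \<and>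
      tm_output ((tm_step M ^^ n) (tm_init x)) = rev (s' Tp)" if e: "ex c (init_store x) t s'" for x t s'
  proof -
    obtain l h r where ti: "tm_init x = (0, l, h, r)" using represents_init by (cases "tm_init x") blast
    define \<tau> where "\<tau> = (\<lambda>p::int. if p < 0 then Bl else cell (map bit_sym x) (nat p))"
    have rep: "represents l h r 0 \<tau>" using represents_init[OF ti] by (simp add: \<tau>_def)
    have m0: "mem W (init_store x) \<tau>"
      by (auto simp: mem_def init_store_def \<tau>_def cell_Nil simp del: of_nat_add of_nat_mult)
    have "(sstep ^^ t) ([c], init_store x) = ([], s')" by (rule ex_ssteps[OF e])
    moreover have "\<forall>c' \<in> set [c]. width c' \<le> W" by (simp add: W_def)
    moreover have "\<forall>r. length (init_store x r) \<le> length x" by (simp add: init_store_def)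
    ultimately obtain n \<tau>' where n: "n \<le> t * (4 * W * (length x + t + 2))" and m': "mem W s' \<tau>'"
      and re: "reach (trans W) (([c], Out 0), -1, \<tau>) n (([], Out 0), -1, \<tau>')"
      using ssteps_simulation[OF _ m0] by blast
    let ?\<delta> = "trans W"
    have "mstep ?\<delta> (q0, 0, \<tau>) = (([c], Out 0), -1, \<tau>)" by (simp add: mstep_simp q0_def)
    moreover have "mstep ?\<delta> (([], Out 0), -1, \<tau>') = (qh, 0, \<tau>')" by (simp add: mstep_simp qh_def)
    ultimately have exec: "reach ?\<delta> (q0, 0, \<tau>) (Suc (Suc n)) (qh, 0, \<tau>')"
      using re by (blast intro: reach_Suc reach_snoc)
    have "\<exists>q' p' \<tau>2 l' h' r'. (mstep ?\<delta> ^^ Suc (Suc n)) (q0, 0, \<tau>) = (q', p', \<tau>2) \<and> q' \<in> insert qh (set qs)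
        \<and> (tm_step M ^^ Suc (Suc n)) (index_of qs q0, l, h, r) = (index_of qs q', l', h', r')
        \<and> represents l' h' r' p' \<tau>2"
      unfolding M_def
    proof (rule tm_of_simulates)
      show "q' \<in> insert qh (set qs)" if "q \<in> set qs" "trans W q h = (q', w, m)" for q h q' w m
        using closed that .
      show "trans W qh h = (qh, h, Nm)" "qh \<notin> set qs" for h by (fact halt)+
      show "q0 \<in> insert qh (set qs)" using q0 qs by simp
    qed (rule rep)
    then obtain l' h' r' where
      tm: "(tm_step M ^^ Suc (Suc n)) (0, l, h, r) = (index_of qs qh, l', h', r')" and rep': "represents l' h' r' 0 \<tau>'"
      using exec unfolding reach_def i0 by (auto simp del: funpow.simps)
    have "halted M (index_of qs qh, l', h', r')"
      using halt by (simp add: halted_def M_def tm_of_def index_of_absent)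
    moreover have "tm_output (index_of qs qh, l', h', r') = rev (s' Tp)"
      using m' by (intro output_represents[OF rep']) (simp add: mem_def)
    moreover have "Suc (Suc n) \<le> (8 * W + 2) * (length x + t + 1)^2"
    proof -
      have "t * (length x + t + 2) \<le> 2 * (length x + t + 1)^2"
        by (simp add: power2_eq_square algebra_simps)
      then have "4 * W * (t * (length x + t + 2)) \<le> 4 * W * (2 * (length x + t + 1)^2)" by (rule mult_le_mono2)
      then have "n \<le> 8 * W * (length x + t + 1)^2" using n by (simp add: algebra_simps)
      moreover have "1 \<le> (length x + t + 1)^2" by simp
      ultimately show ?thesis by (simp only: add_mult_distrib)
    qed
    ultimately show ?thesis using tm ti by (metis (no_types))
  qed
  then show ?thesis using wf_tm_of[of qs "trans W"] unfolding M_def by blast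
qed

section \<open>Arithmetic with stack programs\<close>

text \<open>An upper bound instead of the exact time lets costs be rounded up after every
  composition.\<close>

definition run :: "com \<Rightarrow> store \<Rightarrow> nat \<Rightarrow> store \<Rightarrow> bool" where
  "run c s T s' \<longleftrightarrow> (\<exists>t\<le>T. ex c s t s')"

lemma run_Skip: "run Skip s 1 s"
  unfolding run_def by (blast intro: ex.Skip)

lemma run_Push: "run (Push r b) s 1 (s(r := b # s r))"
  unfolding run_def by (blast intro: ex.Push)

lemma run_Seq: "run c1 s T1 s1 \<Longrightarrow> run c2 s1 T2 s2 \<Longrightarrow> run (c1 ;; c2) s (Suc (T1 + T2)) s2"
  unfolding run_def by (meson ex.Seq Suc_le_mono add_mono)

lemma run_CaseE: "s r = [] \<Longrightarrow> run c0 s T s' \<Longrightarrow> run (Case r c0 c1 c2) s (Suc T) s'"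
  unfolding run_def by (meson ex.CaseE Suc_le_mono)

lemma run_CaseC: "s r = b # bs \<Longrightarrow> run (if b then c2 else c1) (s(r := bs)) T s' \<Longrightarrow> run (Case r c0 c1 c2) s (Suc T) s'"
  unfolding run_def by (meson ex.CaseC Suc_le_mono)

lemma run_LoopE: "s r = [] \<Longrightarrow> run (Loop r c1 c2) s 1 s"
  unfolding run_def by (blast intro: ex.LoopE)

lemma run_LoopC:
  assumes "s r = b # bs" "run (if b then c2 else c1) (s(r := bs)) T s'" "run (Loop r c1 c2) s' T' s''"
  shows "run (Loop r c1 c2) s (Suc (T + T')) s''"
  using assms unfolding run_def by (meson ex.LoopC Suc_le_mono add_mono)

lemma run_weaken: "run c s T s' \<Longrightarrow> T \<le> T' \<Longrightarrow> s' = s'' \<Longrightarrow> run c s T' s''"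
  unfolding run_def by (meson order_trans)

definition drain :: "reg \<Rightarrow> com" where
  "drain a = Loop a Skip Skip"

lemma run_drain: "run (drain a) s (2 * length (s a) + 1) (s(a := []))"
proof -
  have "run (drain a) s (2 * length xs + 1) (s(a := []))" if "s a = xs" for xs s
    using that unfolding drain_def
  proof (induction xs arbitrary: s)
    case Nil
    then show ?case by (intro run_weaken[OF run_LoopE]) auto
  next
    case (Cons b bs)
    have 1: "run (if b then Skip else Skip) (s(a := bs)) 1 (s(a := bs))" using run_Skip by simp
    have 2: "run (Loop a Skip Skip) (s(a := bs)) (2 * length bs + 1) (s(a := bs, a := []))"
      by (rule Cons.IH) simp
    show ?case by (rule run_weaken[OF run_LoopC[OF Cons.prems 1 2]]) auto
  qed
  then show ?thesis by simp
qed

definition move_to :: "reg \<Rightarrow> reg \<Rightarrow> com" where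
  "move_to a b = Loop a (Push b False) (Push b True)"

lemma run_move_to:
  assumes ab: "a \<noteq> b"
  shows "run (move_to a b) s (2 * length (s a) + 1) (s(a := [], b := rev (s a) @ s b))"
proof -
  have "run (move_to a b) s (2 * length xs + 1) (s(a := [], b := rev xs @ s b))" if "s a = xs" for xs s
    using that unfolding move_to_def
  proof (induction xs arbitrary: s)
    case Nil
    then show ?case by (intro run_weaken[OF run_LoopE]) auto
  next
    case (Cons x xs)
    let ?s = "s(a := xs, b := x # s b)"
    have 1: "run (if x then Push b True else Push b False) (s(a := xs)) 1 ?s"
      using run_Push[of b x "s(a := xs)"] ab by (cases x) auto
    have 2: "run (Loop a (Push b False) (Push b True)) ?s (2 * length xs + 1) (?s(a := [], b := rev xs @ ?s b))"
      by (rule Cons.IH) (use ab in simp)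
    show ?case by (rule run_weaken[OF run_LoopC[OF Cons.prems 1 2]]) (use ab in auto)
  qed
  then show ?thesis by simp
qed

text \<open>Reading a stack empties it and moving reverses it, so a copy takes a detour through an
  auxiliary stack, from which two stacks are then filled at once.\<close>

definition move_to2 :: "reg \<Rightarrow> reg \<Rightarrow> reg \<Rightarrow> com" where
  "move_to2 a b c = Loop a (Push b False ;; Push c False) (Push b True ;; Push c True)"

lemma run_move_to2:
  assumes ab: "a \<noteq> b" "a \<noteq> c" "b \<noteq> c"
  shows "run (move_to2 a b c) s (4 * length (s a) + 1) (s(a := [], b := rev (s a) @ s b, c := rev (s a) @ s c))"
proof -
  have "run (move_to2 a b c) s (4 * length xs + 1) (s(a := [], b := rev xs @ s b, c := rev xs @ s c))"
    if "s a = xs" for xs s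
    using that unfolding move_to2_def
  proof (induction xs arbitrary: s)
    case Nil
    then show ?case by (intro run_weaken[OF run_LoopE]) auto
  next
    case (Cons x xs)
    let ?s = "s(a := xs, b := x # s b, c := x # s c)"
    have 1: "run (if x then Push b True ;; Push c True else Push b False ;; Push c False) (s(a := xs)) 3 ?s"
      using run_Seq[OF run_Push[of b x "s(a := xs)"] run_Push[of c x]] ab
      by (cases x) (auto simp: numeral_3_eq_3)
    have 2: "run (Loop a (Push b False ;; Push c False) (Push b True ;; Push c True)) ?s (4 * length xs + 1)
        (?s(a := [], b := rev xs @ ?s b, c := rev xs @ ?s c))"
      by (rule Cons.IH) (use ab in simp)
    show ?case by (rule run_weaken[OF run_LoopC[OF Cons.prems 1 2]]) (use ab in auto)
  qed
  then show ?thesis by simp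
qed

section \<open>Binary digits and the self-delimiting encoding\<close>

fun val :: "bool list \<Rightarrow> nat" where
  "val [] = 0"
| "val (b # bs) = of_bool b + 2 * val bs"

declare bits.simps [simp del]

lemma bits_0 [simp]: "bits 0 = []"
  by (simp add: bits.simps)

lemma bits_Cons: "n > 0 \<Longrightarrow> bits n = odd n # bits (n div 2)"
  by (subst bits.simps) simp

lemma val_bits [simp]: "val (bits n) = n"
proof (induction n rule: bits.induct)
  case (1 n)
  then show ?case by (cases "n = 0") (auto simp: bits_Cons)
qed

lemma bits_eq_Nil [simp]: "bits n = [] \<longleftrightarrow> n = 0"
  by (cases "n = 0") (auto simp: bits_Cons)

lemma val_append: "val (xs @ ys) = val xs + 2 ^ length xs * val ys"
  by (induction xs) auto

lemma val_less: "val xs < 2 ^ length xs"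
  by (induction xs) (auto simp: of_bool_def)

lemma val_eq_0: "val xs = 0 \<longleftrightarrow> (\<forall>x \<in> set xs. \<not> x)"
  by (induction xs) auto

lemma bits_val: "bits (val xs) = rev (dropWhile Not (rev xs))"
proof (induction xs)
  case (Cons b xs)
  show ?case
  proof (cases "val xs = 0")
    case True
    then show ?thesis by (cases b) (auto simp: dropWhile_append val_eq_0 bits_Cons)
  next
    case False
    then have "\<exists>x \<in> set (rev xs). x" by (auto simp: val_eq_0)
    then have "dropWhile Not (rev xs @ [b]) = dropWhile Not (rev xs) @ [b]"
      by (auto simp: dropWhile_append)
    then show ?thesis using Cons False by (cases b) (auto simp: bits_Cons)
  qed
qed simp

lemma length_bits_mono: "m \<le> n \<Longrightarrow> length (bits m) \<le> length (bits n)"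
proof (induction n arbitrary: m rule: bits.induct)
  case (1 n)
  show ?case
  proof (cases "m = 0")
    case False
    then have "length (bits (m div 2)) \<le> length (bits (n div 2))" using 1 by (intro 1(1)) auto
    then show ?thesis using 1 False by (simp add: bits_Cons)
  qed simp
qed

lemma length_bits_le: "n < 2 ^ k \<Longrightarrow> length (bits n) \<le> k"
proof (induction k arbitrary: n)
  case (Suc k)
  then have "length (bits (n div 2)) \<le> k" by (intro Suc.IH) auto
  then show ?case by (cases "n = 0") (auto simp: bits_Cons)
qed simp

lemma length_bits_mult: "length (bits (m * n)) \<le> length (bits m) + length (bits n)"
proof (rule length_bits_le)
  have "m < 2 ^ length (bits m)" "n < 2 ^ length (bits n)" using val_less[of "bits m"] val_less[of "bits n"] by auto
  then show "m * n < 2 ^ (length (bits m) + length (bits n))"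
    by (simp add: power_add mult_strict_mono)
qed

definition dbl :: "bool list \<Rightarrow> bool list" where
  "dbl bs = concat (map (\<lambda>b. [b, b]) bs)"

lemma dbl_simps [simp]: "dbl [] = []" "dbl (b # bs) = b # b # dbl bs" "dbl (xs @ ys) = dbl xs @ dbl ys"
  by (auto simp: dbl_def)

lemma enc_nat_dbl: "enc_nat n = dbl (bits n) @ [False, True]"
  by (simp add: enc_nat_def dbl_def)

lemma length_dbl: "length (dbl bs) = 2 * length bs"
  by (induction bs) auto

text \<open>The flag in \<open>X 0\<close> keeps the loop alive: a doubled digit sets it again, the
  terminator 01 does not. Digits arrive least significant first, so the most significant one ends on
  top of \<open>X 1\<close>.\<close>

definition unpack :: "nat \<Rightarrow> com" where
  "unpack a = Push (X 0) True ;; Loop (X 0) Skip (Case (V a) Skip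
     (Case (V a) Skip (Push (X 1) False ;; Push (X 0) True) Skip)
     (Case (V a) Skip Skip (Push (X 1) True ;; Push (X 0) True)))"

lemma run_unpack:
  assumes "s (V a) = enc_nat n @ rest" "s (X 0) = []"
  shows "run (unpack a) s (6 * length (bits n) + 9) (s(V a := rest, X 1 := rev (bits n) @ s (X 1)))"
proof -
  let ?B = "Case (V a) Skip (Case (V a) Skip (Push (X 1) False ;; Push (X 0) True) Skip)
     (Case (V a) Skip Skip (Push (X 1) True ;; Push (X 0) True))"
  have L: "run (Loop (X 0) Skip ?B) s (6 * length ds + 5) (s(V a := rest, X 0 := [], X 1 := rev ds @ s (X 1)))"
    if "s (V a) = dbl ds @ [False, True] @ rest" "s (X 0) = [True]" for ds s
    using that
  proof (induction ds arbitrary: s)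
    case Nil
    let ?s = "s(V a := rest, X 0 := [])"
    have "run (if True then Skip else (Push (X 1) False ;; Push (X 0) True)) ?s 1 ?s"
      using run_Skip by simp
    then have "run ?B (s(X 0 := [])) (Suc (Suc 1)) ?s"
      using Nil by (intro run_CaseC[where b = False and bs = "True # rest"])
        (auto intro!: run_CaseC[where b = True and bs = rest] simp: fun_upd_twist)
    then have 1: "run (if True then ?B else Skip) (s(X 0 := [])) (Suc (Suc 1)) ?s" by simp
    have 2: "run (Loop (X 0) Skip ?B) ?s 1 ?s" by (rule run_LoopE) simp
    have "run (Loop (X 0) Skip ?B) s (Suc (Suc (Suc 1) + 1)) ?s"
      by (rule run_LoopC[OF Nil(2) 1 2])
    then show ?case by (rule run_weaken) auto
  next
    case (Cons d ds)
    let ?s1 = "s(X 0 := [], V a := dbl ds @ [False, True] @ rest)"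
    let ?s = "?s1(X 1 := d # s (X 1), X 0 := [True])"
    have Q: "run (Push (X 1) d ;; Push (X 0) True) ?s1 3 ?s"
      using run_Seq[OF run_Push[of "X 1" d ?s1] run_Push[of "X 0" True]] by (simp add: numeral_3_eq_3)
    have "run (if d then Case (V a) Skip Skip (Push (X 1) True ;; Push (X 0) True)
        else Case (V a) Skip (Push (X 1) False ;; Push (X 0) True) Skip)
        (s(X 0 := [], V a := d # dbl ds @ [False, True] @ rest)) (Suc 3) ?s"
    proof (cases d)
      case True
      then have d: "d = True" by simp
      show ?thesis unfolding d if_True
        by (rule run_CaseC[where b = True and bs = "dbl ds @ [False, True] @ rest"]) (use Q True in simp_all)
    next
      case False
      then have d: "d = False" by simp
      show ?thesis unfolding d if_False
        by (rule run_CaseC[where b = False and bs = "dbl ds @ [False, True] @ rest"]) (use Q False in simp_all)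
    qed
    then have "run ?B (s(X 0 := [])) (Suc (Suc 3)) ?s"
      by (intro run_CaseC[where b = d and bs = "d # dbl ds @ [False, True] @ rest"]) (simp_all add: Cons.prems)
    then have 1: "run (if True then ?B else Skip) (s(X 0 := [])) (Suc (Suc 3)) ?s" by simp
    have 2: "run (Loop (X 0) Skip ?B) ?s (6 * length ds + 5) (?s(V a := rest, X 0 := [], X 1 := rev ds @ ?s (X 1)))"
      by (rule Cons.IH) auto
    show ?case by (rule run_weaken[OF run_LoopC[OF Cons.prems(2) 1 2]]) auto
  qed
  let ?s = "s(X 0 := [True])"
  have 2: "run (Loop (X 0) Skip ?B) ?s (6 * length (bits n) + 5) (?s(V a := rest, X 0 := [], X 1 := rev (bits n) @ ?s (X 1)))"
    using assms by (intro L) (auto simp: enc_nat_dbl)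
  have 1: "run (Push (X 0) True) s 1 ?s" using run_Push[of "X 0" True s] assms by simp
  show ?thesis unfolding unpack_def
    by (rule run_weaken[OF run_Seq[OF 1 2]]) (use assms(2) in auto)
qed

text \<open>The digits in X 1 come most significant first. X 2 is nonempty once a True has been met, which
  drops leading zeros: bits has none.\<close>
definition pack :: "nat \<Rightarrow> com" where
  "pack a = Push (V a) True ;; Push (V a) False ;;
     Loop (X 1) (Case (X 2) Skip Skip (Push (V a) False ;; Push (V a) False ;; Push (X 2) True))
       (Push (V a) True ;; Push (V a) True ;; Push (X 2) True) ;;
     drain (X 2)"

lemma run_pack:
  assumes "s (X 2) = []"
  shows "run (pack a) s (9 * length (s (X 1)) + 15) (s(V a := enc_nat (val (rev (s (X 1)))) @ s (V a), X 1 := []))"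
proof -
  let ?P = "\<lambda>b. Push (V a) b ;; Push (V a) b ;; Push (X 2) True"
  let ?C0 = "Case (X 2) Skip Skip (?P False)"
  let ?C1 = "?P True"
  have P: "run (?P b) s 5 (s(V a := b # b # s (V a), X 2 := True # s (X 2)))" for b s
    using run_Seq[OF run_Push[of "V a" b s] run_Seq[OF run_Push[of "V a" b] run_Push[of "X 2" True]]]
    by (simp add: eval_nat_numeral)
  \<comment> \<open>\<open>st j ds\<close> is what survives of ds when j marks lie on
    \<open>X 2\<close>: leading zeros are dropped only while no mark has been set. The final number
    of marks matters for the cost of draining \<open>X 2\<close>.\<close>
  define st where "st = (\<lambda>j ds. if (j::nat) = 0 then dropWhile Not ds else ds)"
  have L: "\<exists>j'. run (Loop (X 1) ?C0 ?C1) s (7 * length ds + 1)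
      (s(X 1 := [], X 2 := replicate j' True, V a := dbl (rev (st j ds)) @ s (V a)))
      \<and> j' \<le> j + length ds"
    if "s (X 1) = ds" "s (X 2) = replicate j True" for s ds j
    using that
  proof (induction ds arbitrary: s j)
    case Nil
    have "run (Loop (X 1) ?C0 ?C1) s (7 * length [] + 1)
      (s(X 1 := [], X 2 := replicate j True, V a := dbl (rev (st j [])) @ s (V a)))"
      by (rule run_weaken[OF run_LoopE[where s = s, OF Nil(1)]]) (use Nil in \<open>auto simp: st_def\<close>)
    then show ?case by (intro exI[of _ j] conjI) (assumption, simp)
  next
    case (Cons d ds)
    show ?case
    proof (cases "d \<or> j > 0")
      case True
      define j1 where "j1 = (if d then Suc j else j)"
      let ?s = "s(X 1 := ds, V a := d # d # s (V a), X 2 := replicate j1 True)"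
      have 1: "run (if d then ?C1 else ?C0) (s(X 1 := ds)) 6 ?s"
      proof (cases d)
        case True
        then show ?thesis using Cons.prems by (auto intro!: run_weaken[OF P] simp: j1_def)
      next
        case False
        then obtain i where i: "j = Suc i" using \<open>d \<or> j > 0\<close> by (cases j) auto
        have "run ?C0 (s(X 1 := ds)) (Suc 5) ?s"
          by (rule run_CaseC[where b = True and bs = "replicate i True"])
            (use Cons.prems i False in \<open>auto intro!: run_weaken[OF P] simp: j1_def\<close>)
        then show ?thesis using False by simp
      qed
      have a: "?s (X 1) = ds" "?s (X 2) = replicate j1 True" by simp_all
      obtain j' where 2: "run (Loop (X 1) ?C0 ?C1) ?s (7 * length ds + 1)
        (?s(X 1 := [], X 2 := replicate j' True, V a := dbl (rev (st j1 ds)) @ ?s (V a)))"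
        and j': "j' \<le> j1 + length ds"
        using Cons.IH[OF a] by blast
      have j1: "j1 > 0" "j1 \<le> Suc j" using True by (auto simp: j1_def)
      have "run (Loop (X 1) ?C0 ?C1) s (7 * length (d # ds) + 1)
        (s(X 1 := [], X 2 := replicate j' True, V a := dbl (rev (st j (d # ds))) @ s (V a)))"
        by (rule run_weaken[OF run_LoopC[OF Cons.prems(1) 1 2]]) (use j1 True in \<open>auto simp: st_def\<close>)
      moreover have "j' \<le> j + length (d # ds)" using j1 j' by simp
      ultimately show ?thesis by blast
    next
      case False
      then have e: "\<not> d" "j = 0" by auto
      have 1: "run (if d then ?C1 else ?C0) (s(X 1 := ds)) (Suc 1) (s(X 1 := ds))"
        using e Cons.prems(2) run_CaseE[OF _ run_Skip, of "s(X 1 := ds)" "X 2"] by simp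
      let ?s = "s(X 1 := ds)"
      have a: "?s (X 1) = ds" "?s (X 2) = replicate 0 True" using Cons.prems(2) e by simp_all
      obtain j' where 2: "run (Loop (X 1) ?C0 ?C1) ?s (7 * length ds + 1)
        (?s(X 1 := [], X 2 := replicate j' True, V a := dbl (rev (st 0 ds)) @ ?s (V a)))"
        and j': "j' \<le> 0 + length ds"
        using Cons.IH[OF a] by blast
      have "run (Loop (X 1) ?C0 ?C1) s (7 * length (d # ds) + 1)
        (s(X 1 := [], X 2 := replicate j' True, V a := dbl (rev (st j (d # ds))) @ s (V a)))"
        by (rule run_weaken[OF run_LoopC[OF Cons.prems(1) 1 2]]) (use e in \<open>auto simp: st_def\<close>)
      moreover have "j' \<le> j + length (d # ds)" using j' by simp
      ultimately show ?thesis by blast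
    qed
  qed
  let ?s2 = "s(V a := False # True # s (V a))"
  define ds where "ds = s (X 1)"
  obtain j' where 3: "run (Loop (X 1) ?C0 ?C1) ?s2 (7 * length ds + 1)
      (?s2(X 1 := [], X 2 := replicate j' True, V a := dbl (rev (st 0 ds)) @ ?s2 (V a)))"
    and j': "j' \<le> length ds"
    using L[of ?s2 ds 0] assms by (auto simp: ds_def)
  let ?s3 = "?s2(X 1 := [], X 2 := replicate j' True, V a := dbl (rev (st 0 ds)) @ ?s2 (V a))"
  have 4: "run (drain (X 2)) ?s3 (2 * j' + 1) (?s3(X 2 := []))"
    using run_drain[of "X 2" ?s3] by simp
  have 1: "run (Push (V a) True) s 1 (s(V a := True # s (V a)))" by (rule run_Push)
  have 2: "run (Push (V a) False) (s(V a := True # s (V a))) 1 ?s2"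
    using run_Push[of "V a" False "s(V a := True # s (V a))"] by simp
  show ?thesis unfolding pack_def
    by (rule run_weaken[OF run_Seq[OF 1 run_Seq[OF 2 run_Seq[OF 3 4]]]])
      (use assms j' in \<open>auto simp: ds_def enc_nat_dbl bits_val st_def\<close>)
qed

section \<open>Bit-serial addition and subtraction\<close>

fun serial_out :: "(bool \<Rightarrow> bool \<Rightarrow> bool \<Rightarrow> bool) \<Rightarrow> (bool \<Rightarrow> bool \<Rightarrow> bool \<Rightarrow> bool) \<Rightarrow> bool \<Rightarrow> bool list \<Rightarrow> bool list \<Rightarrow> bool list"
where
  "serial_out f g c [] [] = []"
| "serial_out f g c (a # xs) [] = f a False c # serial_out f g (g a False c) xs []"
| "serial_out f g c [] (b # ys) = f False b c # serial_out f g (g False b c) [] ys"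
| "serial_out f g c (a # xs) (b # ys) = f a b c # serial_out f g (g a b c) xs ys"

fun serial_carry :: "(bool \<Rightarrow> bool \<Rightarrow> bool \<Rightarrow> bool) \<Rightarrow> bool \<Rightarrow> bool list \<Rightarrow> bool list \<Rightarrow> bool"
where
  "serial_carry g c [] [] = c"
| "serial_carry g c (a # xs) [] = serial_carry g (g a False c) xs []"
| "serial_carry g c [] (b # ys) = serial_carry g (g False b c) [] ys"
| "serial_carry g c (a # xs) (b # ys) = serial_carry g (g a b c) xs ys"

text \<open>Sum, carry and borrow of a full adder and a full subtractor. The difference bit of a - b
  - c coincides with the sum bit, so \<open>sum3\<close> serves both operations.\<close>

definition sum3 :: "bool \<Rightarrow> bool \<Rightarrow> bool \<Rightarrow> bool" where
  "sum3 a b c \<longleftrightarrow> (a \<noteq> b) \<noteq> c"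
definition maj3 :: "bool \<Rightarrow> bool \<Rightarrow> bool \<Rightarrow> bool" where
  "maj3 a b c \<longleftrightarrow> a \<and> b \<or> a \<and> c \<or> b \<and> c"
definition bor3 :: "bool \<Rightarrow> bool \<Rightarrow> bool \<Rightarrow> bool" where
  "bor3 a b c \<longleftrightarrow> \<not> a \<and> b \<or> \<not> a \<and> c \<or> b \<and> c"

lemma length_serial_out: "length (serial_out f g c xs ys) = max (length xs) (length ys)"
  by (induction f g c xs ys rule: serial_out.induct) auto

lemma bit_tables [simp]:
  "sum3 a b False = (a \<noteq> b)" "sum3 a b True = (a = b)"
  "maj3 a b False = (a \<and> b)" "maj3 a b True = (a \<or> b)"
  "bor3 a b False = (\<not> a \<and> b)" "bor3 a b True = (\<not> a \<or> b)"
  by (auto simp: sum3_def maj3_def bor3_def)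

text \<open>The outgoing carry counts as one further digit, of weight 2 ^ max; this keeps the
  equation valid when the lengths differ and when the sum overflows.\<close>

lemma serial_add:
  "val (serial_out sum3 maj3 c xs ys) + 2 ^ max (length xs) (length ys) * of_bool (serial_carry maj3 c xs ys)
     = val xs + val ys + of_bool c"
proof (induction maj3 c xs ys rule: serial_carry.induct)
  case (2 c a xs)
  then show ?case by (cases a; cases c) auto
next
  case (3 c b ys)
  then show ?case by (cases b; cases c) auto
next
  case (4 c a xs b ys)
  then show ?case by (cases a; cases b; cases c) auto
qed simp

text \<open>Written additively to avoid truncated subtraction. A final borrow means that 2 ^ max has
  been lent; without incoming borrow this happens exactly if \<open>val ys\<close> exceeds
  \<open>val xs\<close>.\<close>

lemma serial_sub:
  "val (serial_out sum3 bor3 c xs ys) + val ys + of_bool c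
     = val xs + 2 ^ max (length xs) (length ys) * of_bool (serial_carry bor3 c xs ys)"
proof (induction bor3 c xs ys rule: serial_carry.induct)
  case (2 c a xs)
  then show ?case by (cases a; cases c) auto
next
  case (3 c b ys)
  then show ?case by (cases b; cases c) auto
next
  case (4 c a xs b ys)
  then show ?case by (cases a; cases b; cases c) auto
qed simp

text \<open>\<open>X 5\<close> holds the carry and \<open>X 0\<close> the flag requesting another
  round; producing a digit always requests one.\<close>

definition emit :: "(bool \<Rightarrow> bool \<Rightarrow> bool \<Rightarrow> bool) \<Rightarrow> (bool \<Rightarrow> bool \<Rightarrow> bool \<Rightarrow> bool) \<Rightarrow> bool \<Rightarrow> bool \<Rightarrow> com" where
  "emit f g a b = Case (X 5) Skip
     (Push (X 1) (f a b False) ;; Push (X 5) (g a b False) ;; Push (X 0) True)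
     (Push (X 1) (f a b True) ;; Push (X 5) (g a b True) ;; Push (X 0) True)"

lemma run_emit:
  assumes "s (X 5) = [c]"
  shows "run (emit f g a b) s 6 (s(X 5 := [g a b c], X 1 := f a b c # s (X 1), X 0 := True # s (X 0)))"
proof -
  let ?s = "s(X 5 := [])"
  have "run (Push (X 1) (f a b c) ;; Push (X 5) (g a b c) ;; Push (X 0) True) ?s (Suc (1 + Suc (1 + 1)))
      (?s(X 1 := f a b c # s (X 1), X 5 := [g a b c], X 0 := True # s (X 0)))"
    by (rule run_weaken[OF run_Seq[OF run_Push run_Seq[OF run_Push run_Push]]]) auto
  then have e: "run (if c then Push (X 1) (f a b True) ;; Push (X 5) (g a b True) ;; Push (X 0) True
     else Push (X 1) (f a b False) ;; Push (X 5) (g a b False) ;; Push (X 0) True) ?s (Suc (1 + Suc (1 + 1)))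
      (?s(X 1 := f a b c # s (X 1), X 5 := [g a b c], X 0 := True # s (X 0)))"
    by (cases c) simp_all
  show ?thesis
    unfolding emit_def by (rule run_weaken[OF run_CaseC[OF assms e]]) auto
qed

definition serial :: "(bool \<Rightarrow> bool \<Rightarrow> bool \<Rightarrow> bool) \<Rightarrow> (bool \<Rightarrow> bool \<Rightarrow> bool \<Rightarrow> bool) \<Rightarrow> com" where
  "serial f g = Push (X 5) False ;; Push (X 0) True ;; Loop (X 0) Skip
     (Case (X 3) (Case (X 4) Skip (emit f g False False) (emit f g False True))
       (Case (X 4) (emit f g False False) (emit f g False False) (emit f g False True))
       (Case (X 4) (emit f g True False) (emit f g True False) (emit f g True True)))"

lemma run_serial:
  assumes "s (X 0) = []" "s (X 5) = []"
  shows "run (serial f g) s (9 * max (length (s (X 3))) (length (s (X 4))) + 9)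
    (s(X 3 := [], X 4 := [], X 5 := [serial_carry g False (s (X 3)) (s (X 4))],
       X 1 := rev (serial_out f g False (s (X 3)) (s (X 4))) @ s (X 1)))"
proof -
  let ?C0 = "Case (X 4) Skip (emit f g False False) (emit f g False True)"
  let ?C1 = "Case (X 4) (emit f g False False) (emit f g False False) (emit f g False True)"
  let ?C2 = "Case (X 4) (emit f g True False) (emit f g True False) (emit f g True True)"
  let ?B = "Case (X 3) ?C0 ?C1 ?C2"
  let ?L = "Loop (X 0) Skip ?B"
  have L: "run ?L s (9 * max (length xs) (length ys) + 5)
    (s(X 0 := [], X 3 := [], X 4 := [], X 5 := [serial_carry g c xs ys], X 1 := rev (serial_out f g c xs ys) @ s (X 1)))"
    if "s (X 0) = [True]" "s (X 3) = xs" "s (X 4) = ys" "s (X 5) = [c]" for s c xs ys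
    using that
  proof (induction g c xs ys arbitrary: s rule: serial_carry.induct)
    case (1 g c)
    let ?C0 = "Case (X 4) Skip (emit f g False False) (emit f g False True)"
    let ?C1 = "Case (X 4) (emit f g False False) (emit f g False False) (emit f g False True)"
    let ?C2 = "Case (X 4) (emit f g True False) (emit f g True False) (emit f g True True)"
    let ?B = "Case (X 3) ?C0 ?C1 ?C2"
    let ?s = "s(X 0 := [])"
    have b: "run (if True then ?B else Skip) ?s (Suc (Suc 1)) ?s"
      unfolding if_True by (intro run_CaseE run_Skip) (use 1 in auto)
    have e: "run (Loop (X 0) Skip ?B) ?s 1 ?s" by (rule run_LoopE) simp
    show ?case by (rule run_weaken[OF run_LoopC[OF 1(1) b e]]) (use 1 in auto)
  next
    case (2 g c a xs)
    let ?C0 = "Case (X 4) Skip (emit f g False False) (emit f g False True)"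
    let ?C1 = "Case (X 4) (emit f g False False) (emit f g False False) (emit f g False True)"
    let ?C2 = "Case (X 4) (emit f g True False) (emit f g True False) (emit f g True True)"
    let ?B = "Case (X 3) ?C0 ?C1 ?C2"
    let ?s = "s(X 0 := [], X 3 := xs)"
    let ?s' = "?s(X 5 := [g a False c], X 1 := f a False c # ?s (X 1), X 0 := True # ?s (X 0))"
    have "run (emit f g a False) ?s 6 ?s'" by (rule run_emit) (use 2 in simp)
    then have "run (Case (X 4) (emit f g a False) (emit f g a False) (emit f g a True)) ?s (Suc 6) ?s'"
      by (rule run_CaseE[rotated]) (use 2 in simp)
    then have "run (if a then ?C2 else ?C1) ?s (Suc 6) ?s'" by (cases a) auto
    then have b: "run (if True then ?B else Skip) (s(X 0 := [])) (Suc (Suc 6)) ?s'"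
      unfolding if_True by (rule run_CaseC[rotated]) (use 2 in simp)
    show ?case
      by (rule run_weaken[OF run_LoopC[OF 2(2) b 2(1)]]) (use 2 in auto)
  next
    case (3 g c b ys)
    let ?C0 = "Case (X 4) Skip (emit f g False False) (emit f g False True)"
    let ?C1 = "Case (X 4) (emit f g False False) (emit f g False False) (emit f g False True)"
    let ?C2 = "Case (X 4) (emit f g True False) (emit f g True False) (emit f g True True)"
    let ?B = "Case (X 3) ?C0 ?C1 ?C2"
    let ?s = "s(X 0 := [], X 4 := ys)"
    let ?s' = "?s(X 5 := [g False b c], X 1 := f False b c # ?s (X 1), X 0 := True # ?s (X 0))"
    have "run (emit f g False b) ?s 6 ?s'" by (rule run_emit) (use 3 in simp)
    then have "run (if b then emit f g False True else emit f g False False) ?s 6 ?s'" by (cases b) auto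
    then have "run ?C0 (s(X 0 := [])) (Suc 6) ?s'"
      by (rule run_CaseC[rotated]) (use 3 in simp)
    then have b: "run (if True then ?B else Skip) (s(X 0 := [])) (Suc (Suc 6)) ?s'"
      unfolding if_True by (rule run_CaseE[rotated]) (use 3 in simp)
    show ?case
      by (rule run_weaken[OF run_LoopC[OF 3(2) b 3(1)]]) (use 3 in auto)
  next
    case (4 g c a xs b ys)
    let ?C0 = "Case (X 4) Skip (emit f g False False) (emit f g False True)"
    let ?C1 = "Case (X 4) (emit f g False False) (emit f g False False) (emit f g False True)"
    let ?C2 = "Case (X 4) (emit f g True False) (emit f g True False) (emit f g True True)"
    let ?B = "Case (X 3) ?C0 ?C1 ?C2"
    let ?s = "s(X 0 := [], X 3 := xs, X 4 := ys)"
    let ?s' = "?s(X 5 := [g a b c], X 1 := f a b c # ?s (X 1), X 0 := True # ?s (X 0))"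
    have e: "run (emit f g a b) ?s 6 ?s'" by (rule run_emit) (use 4 in simp)
    have "run (if a then ?C2 else ?C1) (s(X 0 := [], X 3 := xs)) (Suc 6) ?s'"
    proof -
      have "run (Case (X 4) (emit f g a False) (emit f g a False) (emit f g a True)) (s(X 0 := [], X 3 := xs)) (Suc 6) ?s'"
        by (rule run_CaseC[where b = b and bs = ys]) (use 4 e in \<open>cases b; simp\<close>)+
      then show ?thesis by (cases a) auto
    qed
    then have b: "run (if True then ?B else Skip) (s(X 0 := [])) (Suc (Suc 6)) ?s'"
      unfolding if_True by (rule run_CaseC[rotated]) (use 4 in simp)
    show ?case
      by (rule run_weaken[OF run_LoopC[OF 4(2) b 4(1)]]) (use 4 in auto)
  qed
  let ?s = "s(X 5 := [False], X 0 := [True])"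
  have 1: "run (Push (X 5) False) s 1 (s(X 5 := [False]))" using run_Push[of "X 5" False s] assms by simp
  have 2: "run (Push (X 0) True) (s(X 5 := [False])) 1 ?s"
    using run_Push[of "X 0" True "s(X 5 := [False])"] assms by simp
  have 3: "run ?L ?s (9 * max (length (s (X 3))) (length (s (X 4))) + 5)
    (?s(X 0 := [], X 3 := [], X 4 := [], X 5 := [serial_carry g False (s (X 3)) (s (X 4))],
        X 1 := rev (serial_out f g False (s (X 3)) (s (X 4))) @ ?s (X 1)))"
    by (rule L) auto
  show ?thesis unfolding serial_def
    by (rule run_weaken[OF run_Seq[OF 1 run_Seq[OF 2 3]]]) (use assms in auto)
qed

section \<open>Lists of numbers on stacks and arithmetic on the operand stack\<close>

definition encs :: "nat list \<Rightarrow> bool list" where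
  "encs xs = concat (map enc_nat xs)"

lemma encs_simps [simp]: "encs [] = []" "encs (x # xs) = enc_nat x @ encs xs" "encs (xs @ ys) = encs xs @ encs ys"
  by (auto simp: encs_def)

lemma enc_nat_neq_Nil [simp]: "enc_nat n \<noteq> []"
  by (simp add: enc_nat_def)

lemma encs_eq_Nil [simp]: "encs xs = [] \<longleftrightarrow> xs = []"
  by (cases xs) auto

definition embed :: "(nat \<Rightarrow> nat list) \<Rightarrow> store" where
  "embed s = (\<lambda>r. case r of V a \<Rightarrow> encs (s a) | _ \<Rightarrow> [])"

lemma embed_simps [simp]: "embed s (V a) = encs (s a)" "embed s (X i) = []" "embed s Tp = []"
  by (auto simp: embed_def)

lemma embed_upd: "embed (s(a := xs)) = (embed s)(V a := encs xs)"
  by (rule ext) (auto simp: embed_def split: reg.split)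

abbreviation lb :: "nat \<Rightarrow> nat" where
  "lb n \<equiv> length (bits n)"

text \<open>The stack V 0 is the operand stack of expressions.\<close>
definition operands :: com where
  "operands = unpack 0 ;; move_to (X 1) (X 4) ;; unpack 0 ;; move_to (X 1) (X 3)"

lemma run_operands:
  assumes "s 0 = y # x # rest"
  shows "run operands (embed s) (8 * (lb x + lb y) + 23) ((embed s)(V 0 := encs rest, X 3 := bits x, X 4 := bits y))"
proof -
  let ?s1 = "(embed s)(V 0 := enc_nat x @ encs rest, X 1 := rev (bits y) @ embed s (X 1))"
  let ?s2 = "?s1(X 1 := [], X 4 := rev (?s1 (X 1)) @ ?s1 (X 4))"
  let ?s3 = "?s2(V 0 := encs rest, X 1 := rev (bits x) @ ?s2 (X 1))"
  have 1: "run (unpack 0) (embed s) (6 * lb y + 9) ?s1" by (rule run_unpack) (use assms in auto)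
  have 2: "run (move_to (X 1) (X 4)) ?s1 (2 * length (?s1 (X 1)) + 1) ?s2" by (rule run_move_to) simp
  have 3: "run (unpack 0) ?s2 (6 * lb x + 9) ?s3" by (rule run_unpack) auto
  have 4: "run (move_to (X 1) (X 3)) ?s3 (2 * length (?s3 (X 1)) + 1) (?s3(X 1 := [], X 3 := rev (?s3 (X 1)) @ ?s3 (X 3)))"
    by (rule run_move_to) simp
  show ?thesis unfolding operands_def
    by (rule run_weaken[OF run_Seq[OF 1 run_Seq[OF 2 run_Seq[OF 3 4]]]]) auto
qed

definition add_bits :: "bool list \<Rightarrow> bool list \<Rightarrow> bool list" where
  "add_bits xs ys = serial_out sum3 maj3 False xs ys @ (if serial_carry maj3 False xs ys then [True] else [])"

lemma val_add_bits: "val (add_bits xs ys) = val xs + val ys"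
  using serial_add[of False xs ys]
  by (cases "serial_carry maj3 False xs ys") (auto simp: add_bits_def val_append length_serial_out)

lemma length_add_bits: "length (add_bits xs ys) \<le> Suc (max (length xs) (length ys))"
  by (simp add: add_bits_def length_serial_out)

definition add_X :: com where
  "add_X = serial sum3 maj3 ;; Case (X 5) Skip Skip (Push (X 1) True)"

lemma run_add_X:
  assumes "s (X 0) = []" "s (X 5) = []" "s (X 1) = []"
  shows "run add_X s (9 * max (length (s (X 3))) (length (s (X 4))) + 12)
    (s(X 3 := [], X 4 := [], X 1 := rev (add_bits (s (X 3)) (s (X 4)))))"
proof -
  let ?c = "serial_carry maj3 False (s (X 3)) (s (X 4))"
  let ?o = "serial_out sum3 maj3 False (s (X 3)) (s (X 4))"
  let ?s1 = "s(X 3 := [], X 4 := [], X 5 := [?c], X 1 := rev ?o @ s (X 1))"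
  note 1 = run_serial[OF assms(1,2), of sum3 maj3]
  have "run (if ?c then Push (X 1) True else Skip) (?s1(X 5 := [])) 1 (?s1(X 5 := [], X 1 := rev (add_bits (s (X 3)) (s (X 4)))))"
  proof (cases ?c)
    case True
    have "run (Push (X 1) True) (?s1(X 5 := [])) 1 (?s1(X 5 := [], X 1 := rev (add_bits (s (X 3)) (s (X 4)))))"
      by (rule run_weaken[OF run_Push]) (use True assms(3) in \<open>auto simp: add_bits_def\<close>)
    then show ?thesis using True by simp
  next
    case False
    have "run Skip (?s1(X 5 := [])) 1 (?s1(X 5 := [], X 1 := rev (add_bits (s (X 3)) (s (X 4)))))"
      by (rule run_weaken[OF run_Skip]) (use False assms(3) in \<open>auto simp: add_bits_def\<close>)
    then show ?thesis using False by simp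
  qed
  then have 2: "run (Case (X 5) Skip Skip (Push (X 1) True)) ?s1 (Suc 1) (?s1(X 5 := [], X 1 := rev (add_bits (s (X 3)) (s (X 4)))))"
    by (rule run_CaseC[rotated]) simp
  show ?thesis unfolding add_X_def
    by (rule run_weaken[OF run_Seq[OF 1 2]]) (use assms in auto)
qed

definition add_com :: com where
  "add_com = operands ;; add_X ;; pack 0"

lemma run_add_com:
  assumes "s 0 = y # x # rest"
  shows "run add_com (embed s) (30 * (lb x + lb y) + 70) (embed (s(0 := (x + y) # rest)))"
proof -
  let ?s1 = "(embed s)(V 0 := encs rest, X 3 := bits x, X 4 := bits y)"
  note 1 = run_operands[where s = s, OF assms]
  let ?r = "rev (add_bits (bits x) (bits y))"
  let ?s2 = "?s1(X 3 := [], X 4 := [], X 1 := ?r)"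
  have 2: "run add_X ?s1 (9 * max (lb x) (lb y) + 12) ?s2"
    using run_add_X[of ?s1] by simp
  have 3: "run (pack 0) ?s2 (9 * length (?s2 (X 1)) + 15) (?s2(V 0 := enc_nat (val (rev (?s2 (X 1)))) @ ?s2 (V 0), X 1 := []))"
    by (rule run_pack) simp
  show ?thesis unfolding add_com_def
    by (rule run_weaken[OF run_Seq[OF 1 run_Seq[OF 2 3]]])
      (use length_add_bits[of "bits x" "bits y"] in \<open>auto simp: embed_upd val_add_bits\<close>)
qed

text \<open>A final borrow signals that the subtrahend is larger; clearing \<open>X 1\<close> then
  yields 0, as truncated subtraction demands.\<close>

definition sub_com :: com where
  "sub_com = operands ;; serial sum3 bor3 ;; Case (X 5) Skip Skip (drain (X 1)) ;; pack 0"

lemma run_sub_com: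
  assumes "s 0 = y # x # rest"
  shows "run sub_com (embed s) (30 * (lb x + lb y) + 70) (embed (s(0 := (x - y) # rest)))"
proof -
  let ?s1 = "(embed s)(V 0 := encs rest, X 3 := bits x, X 4 := bits y)"
  note 1 = run_operands[where s = s, OF assms]
  let ?c = "serial_carry bor3 False (bits x) (bits y)"
  let ?o = "serial_out sum3 bor3 False (bits x) (bits y)"
  let ?s2 = "?s1(X 3 := [], X 4 := [], X 5 := [?c], X 1 := rev ?o @ ?s1 (X 1))"
  have 2: "run (serial sum3 bor3) ?s1 (9 * max (lb x) (lb y) + 9) ?s2"
    using run_serial[of ?s1 sum3 bor3] by simp
  define r where "r = (if ?c then [] else rev ?o)"
  have "run (if ?c then drain (X 1) else Skip) (?s2(X 5 := [])) (2 * max (lb x) (lb y) + 1) (?s2(X 5 := [], X 1 := r))"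
  proof (cases ?c)
    case True
    have "run (drain (X 1)) (?s2(X 5 := [])) (2 * max (lb x) (lb y) + 1) (?s2(X 5 := [], X 1 := r))"
      by (rule run_weaken[OF run_drain]) (use True in \<open>auto simp: r_def length_serial_out\<close>)
    then show ?thesis using True by simp
  next
    case False
    have "run Skip (?s2(X 5 := [])) (2 * max (lb x) (lb y) + 1) (?s2(X 5 := [], X 1 := r))"
      by (rule run_weaken[OF run_Skip]) (use False in \<open>auto simp: r_def\<close>)
    then show ?thesis using False by simp
  qed
  then have 3: "run (Case (X 5) Skip Skip (drain (X 1))) ?s2 (Suc (2 * max (lb x) (lb y) + 1)) (?s2(X 5 := [], X 1 := r))"
    by (rule run_CaseC[rotated]) simp
  let ?s3 = "?s2(X 5 := [], X 1 := r)"
  have 4: "run (pack 0) ?s3 (9 * length (?s3 (X 1)) + 15) (?s3(V 0 := enc_nat (val (rev (?s3 (X 1)))) @ ?s3 (V 0), X 1 := []))"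
    by (rule run_pack) simp
  have l: "length r \<le> max (lb x) (lb y)" by (simp add: r_def length_serial_out)
  have v: "val (rev r) = x - y"
    using serial_sub[of False "bits x" "bits y"] val_less[of ?o] by (auto simp: r_def length_serial_out)
  show ?thesis unfolding sub_com_def
    by (rule run_weaken[OF run_Seq[OF 1 run_Seq[OF 2 run_Seq[OF 3 4]]]])
      (use l in \<open>auto simp: embed_upd v\<close>)
qed

text \<open>The multiplicand in \<open>X 7\<close> is needed again in later rounds of a
  multiplication, so it is copied by way of \<open>X 8\<close> before the addition consumes
  it.\<close>

definition add_to :: com where
  "add_to = move_to (X 7) (X 8) ;; move_to2 (X 8) (X 7) (X 4) ;; add_X ;; move_to (X 1) (X 3)"

lemma run_add_to:
  assumes "s (X 0) = []" "s (X 1) = []" "s (X 4) = []" "s (X 5) = []" "s (X 8) = []"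
  shows "run add_to s (17 * max (length (s (X 3))) (length (s (X 7))) + 23) (s(X 3 := add_bits (s (X 3)) (s (X 7))))"
proof -
  let ?s1 = "s(X 7 := [], X 8 := rev (s (X 7)) @ s (X 8))"
  have 1: "run (move_to (X 7) (X 8)) s (2 * length (s (X 7)) + 1) ?s1" by (rule run_move_to) simp
  let ?s2 = "?s1(X 8 := [], X 7 := rev (?s1 (X 8)) @ ?s1 (X 7), X 4 := rev (?s1 (X 8)) @ ?s1 (X 4))"
  have 2: "run (move_to2 (X 8) (X 7) (X 4)) ?s1 (4 * length (?s1 (X 8)) + 1) ?s2" by (rule run_move_to2) auto
  let ?s3 = "?s2(X 3 := [], X 4 := [], X 1 := rev (add_bits (?s2 (X 3)) (?s2 (X 4))))"
  have 3: "run add_X ?s2 (9 * max (length (?s2 (X 3))) (length (?s2 (X 4))) + 12) ?s3"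
    by (rule run_add_X) (use assms in auto)
  have 4: "run (move_to (X 1) (X 3)) ?s3 (2 * length (?s3 (X 1)) + 1) (?s3(X 1 := [], X 3 := rev (?s3 (X 1)) @ ?s3 (X 3)))"
    by (rule run_move_to) simp
  show ?thesis unfolding add_to_def
    by (rule run_weaken[OF run_Seq[OF 1 run_Seq[OF 2 run_Seq[OF 3 4]]]])
      (use assms length_add_bits[of "s (X 3)" "s (X 7)"] in auto)
qed

fun horner :: "bool list \<Rightarrow> bool list \<Rightarrow> bool list \<Rightarrow> bool list" where
  "horner xs acc [] = acc"
| "horner xs acc (d # ds) = horner xs (if d then add_bits (False # acc) xs else False # acc) ds"

lemma val_horner: "val (horner xs acc ds) = val acc * 2 ^ length ds + val (rev ds) * val xs"
  by (induction ds arbitrary: acc) (auto simp: val_add_bits val_append algebra_simps)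

text \<open>A round lengthens the accumulator by at most one digit for the shift and one for the
  carry; k counts the rounds already done.\<close>

lemma length_horner: "length acc \<le> length xs + 2 * k \<Longrightarrow> length (horner xs acc ds) \<le> length xs + 2 * (k + length ds)"
proof (induction ds arbitrary: acc k)
  case (Cons d ds)
  have "length (if d then add_bits (False # acc) xs else False # acc) \<le> length xs + 2 * Suc k"
    using Cons.prems length_add_bits[of "False # acc" xs] by auto
  from Cons.IH[OF this] show ?case by simp
qed simp

definition mul_loop :: com where
  "mul_loop = Loop (X 6) (Push (X 3) False) (Push (X 3) False ;; add_to)"

lemma run_mul_loop:
  assumes "s (X 0) = []" "s (X 1) = []" "s (X 4) = []" "s (X 5) = []" "s (X 8) = []"
    and "s (X 6) = ds" "length (s (X 3)) \<le> length (s (X 7)) + 2 * k"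
  shows "run mul_loop s (length ds * (17 * (length (s (X 7)) + 2 * (k + length ds)) + 30) + 1)
    (s(X 6 := [], X 3 := horner (s (X 7)) (s (X 3)) ds))"
  using assms
proof (induction ds arbitrary: s k)
  case Nil
  then show ?case unfolding mul_loop_def by (intro run_weaken[OF run_LoopE]) auto
next
  case (Cons d ds)
  define xs where "xs = s (X 7)"
  define acc where "acc = s (X 3)"
  define acc' where "acc' = (if d then add_bits (False # acc) xs else False # acc)"
  let ?u = "s(X 6 := ds)"
  let ?s = "s(X 6 := ds, X 3 := acc')"
  let ?t = "17 * (length xs + 2 * (k + length (d # ds))) + 25"
  have 1: "run (if d then Push (X 3) False ;; add_to else Push (X 3) False) ?u ?t ?s"
  proof (cases d)
    case True
    let ?s1 = "?u(X 3 := False # ?u (X 3))"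
    have a: "run (Push (X 3) False) ?u 1 ?s1" by (rule run_Push)
    have b: "run add_to ?s1 (17 * max (length (?s1 (X 3))) (length (?s1 (X 7))) + 23) (?s1(X 3 := add_bits (?s1 (X 3)) (?s1 (X 7))))"
      by (rule run_add_to) (use Cons.prems in auto)
    have "run (Push (X 3) False ;; add_to) ?u ?t ?s"
      using Cons.prems(7) True by (intro run_weaken[OF run_Seq[OF a b]]) (simp_all add: acc'_def acc_def xs_def max_def)
    then show ?thesis using True by simp
  next
    case False
    have "run (Push (X 3) False) ?u ?t ?s"
      by (rule run_weaken[OF run_Push]) (use False in \<open>auto simp: acc'_def acc_def\<close>)
    then show ?thesis using False by simp
  qed
  have l: "length acc' \<le> length xs + 2 * Suc k"
    using Cons.prems(7) length_add_bits[of "False # acc" xs] by (auto simp: acc'_def acc_def xs_def)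
  have 2: "run mul_loop ?s (length ds * (17 * (length (?s (X 7)) + 2 * (Suc k + length ds)) + 30) + 1)
      (?s(X 6 := [], X 3 := horner (?s (X 7)) (?s (X 3)) ds))"
    by (rule Cons.IH) (use Cons.prems l in \<open>auto simp: xs_def\<close>)
  show ?case
    by (rule run_weaken[OF run_LoopC[OF Cons.prems(6) 1 2[unfolded mul_loop_def], folded mul_loop_def]])
      (auto simp: xs_def acc'_def acc_def)
qed

text \<open>The multiplier is moved twice, so that it stands most significant digit first in
  \<open>X 6\<close>, the order in which Horner's rule consumes it; the multiplicand is moved once
  and stands least significant first in \<open>X 7\<close>.\<close>

definition mul_com :: com where
  "mul_com = unpack 0 ;; move_to (X 1) (X 4) ;; move_to (X 4) (X 6) ;; unpack 0 ;; move_to (X 1) (X 7) ;;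
     mul_loop ;; move_to (X 3) (X 1) ;; drain (X 7) ;; pack 0"

lemma run_mul_com:
  assumes "s 0 = y # x # rest"
  shows "run mul_com (embed s) (200 * (lb x + lb y + 1) ^ 2) (embed (s(0 := (x * y) # rest)))"
proof -
  let ?s1 = "(embed s)(V 0 := enc_nat x @ encs rest, X 1 := rev (bits y) @ embed s (X 1))"
  let ?s2 = "?s1(X 1 := [], X 4 := rev (?s1 (X 1)) @ ?s1 (X 4))"
  let ?s3 = "?s2(X 4 := [], X 6 := rev (?s2 (X 4)) @ ?s2 (X 6))"
  let ?s4 = "?s3(V 0 := encs rest, X 1 := rev (bits x) @ ?s3 (X 1))"
  let ?s5 = "?s4(X 1 := [], X 7 := rev (?s4 (X 1)) @ ?s4 (X 7))"
  have 1: "run (unpack 0) (embed s) (6 * lb y + 9) ?s1" by (rule run_unpack) (use assms in auto)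
  have 2: "run (move_to (X 1) (X 4)) ?s1 (2 * length (?s1 (X 1)) + 1) ?s2" by (rule run_move_to) simp
  have 3: "run (move_to (X 4) (X 6)) ?s2 (2 * length (?s2 (X 4)) + 1) ?s3" by (rule run_move_to) simp
  have 4: "run (unpack 0) ?s3 (6 * lb x + 9) ?s4" by (rule run_unpack) auto
  have 5: "run (move_to (X 1) (X 7)) ?s4 (2 * length (?s4 (X 1)) + 1) ?s5" by (rule run_move_to) simp
  let ?h = "horner (bits x) [] (rev (bits y))"
  let ?s6 = "?s5(X 6 := [], X 3 := ?h)"
  have 6: "run mul_loop ?s5 (lb y * (17 * (lb x + 2 * lb y) + 30) + 1) ?s6"
    using run_mul_loop[of ?s5 "rev (bits y)" 0] by simp
  let ?s7 = "?s6(X 3 := [], X 1 := rev (?s6 (X 3)) @ ?s6 (X 1))"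
  have 7: "run (move_to (X 3) (X 1)) ?s6 (2 * length (?s6 (X 3)) + 1) ?s7" by (rule run_move_to) simp
  let ?s8 = "?s7(X 7 := [])"
  have 8: "run (drain (X 7)) ?s7 (2 * length (?s7 (X 7)) + 1) ?s8" by (rule run_drain)
  have 9: "run (pack 0) ?s8 (9 * length (?s8 (X 1)) + 15) (?s8(V 0 := enc_nat (val (rev (?s8 (X 1)))) @ ?s8 (V 0), X 1 := []))"
    by (rule run_pack) simp
  have l: "length ?h \<le> lb x + 2 * lb y" using length_horner[of "[]" "bits x" 0 "rev (bits y)"] by simp
  have v: "val ?h = x * y" by (simp add: val_horner)
  define n where "n = lb x + lb y + 1"
  have q: "lb y * (17 * (lb x + 2 * lb y) + 30) \<le> n * (34 * n + 30)"
    by (rule mult_le_mono) (auto simp: n_def)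
  have q2: "n * (34 * n + 30) \<le> 64 * n^2" by (simp add: n_def power2_eq_square algebra_simps)
  have q3: "n \<le> n^2" by (simp add: power2_eq_square n_def)
  show ?thesis unfolding mul_com_def n_def[symmetric]
    by (rule run_weaken[OF run_Seq[OF 1 run_Seq[OF 2 run_Seq[OF 3 run_Seq[OF 4 run_Seq[OF 5 run_Seq[OF 6
      run_Seq[OF 7 run_Seq[OF 8 9]]]]]]]]])
      (use l q q2 q3 in \<open>auto simp: embed_upd v n_def[symmetric]\<close>, auto simp: n_def)
qed

section \<open>Copying, moving and testing whole numbers\<close>

definition dup_com :: "nat \<Rightarrow> nat \<Rightarrow> com" where
  "dup_com a b = unpack a ;; move_to (X 1) (X 3) ;; move_to2 (X 3) (X 1) (X 4) ;; pack a ;;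
     move_to (X 4) (X 3) ;; move_to (X 3) (X 1) ;; pack b"

lemma run_dup_com:
  assumes "s a = v # vs" "a \<noteq> b"
  shows "run (dup_com a b) (embed s) (40 * lb v + 60) (embed (s(b := v # s b)))"
proof -
  let ?s1 = "(embed s)(V a := encs vs, X 1 := rev (bits v) @ embed s (X 1))"
  let ?s2 = "?s1(X 1 := [], X 3 := rev (?s1 (X 1)) @ ?s1 (X 3))"
  let ?s3 = "?s2(X 3 := [], X 1 := rev (?s2 (X 3)) @ ?s2 (X 1), X 4 := rev (?s2 (X 3)) @ ?s2 (X 4))"
  let ?s4 = "?s3(V a := enc_nat (val (rev (?s3 (X 1)))) @ ?s3 (V a), X 1 := [])"
  let ?s5 = "?s4(X 4 := [], X 3 := rev (?s4 (X 4)) @ ?s4 (X 3))"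
  let ?s6 = "?s5(X 3 := [], X 1 := rev (?s5 (X 3)) @ ?s5 (X 1))"
  let ?s7 = "?s6(V b := enc_nat (val (rev (?s6 (X 1)))) @ ?s6 (V b), X 1 := [])"
  have 1: "run (unpack a) (embed s) (6 * lb v + 9) ?s1" by (rule run_unpack) (use assms in auto)
  have 2: "run (move_to (X 1) (X 3)) ?s1 (2 * length (?s1 (X 1)) + 1) ?s2" by (rule run_move_to) simp
  have 3: "run (move_to2 (X 3) (X 1) (X 4)) ?s2 (4 * length (?s2 (X 3)) + 1) ?s3" by (rule run_move_to2) auto
  have 4: "run (pack a) ?s3 (9 * length (?s3 (X 1)) + 15) ?s4" by (rule run_pack) simp
  have 5: "run (move_to (X 4) (X 3)) ?s4 (2 * length (?s4 (X 4)) + 1) ?s5" by (rule run_move_to) simp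
  have 6: "run (move_to (X 3) (X 1)) ?s5 (2 * length (?s5 (X 3)) + 1) ?s6" by (rule run_move_to) simp
  have 7: "run (pack b) ?s6 (9 * length (?s6 (X 1)) + 15) ?s7" by (rule run_pack) simp
  have "?s7 = embed (s(b := v # s b))"
    using assms by (intro ext) (auto simp: embed_upd)
  then show ?thesis unfolding dup_com_def
    by (rule_tac run_weaken[OF run_Seq[OF 1 run_Seq[OF 2 run_Seq[OF 3 run_Seq[OF 4 run_Seq[OF 5 run_Seq[OF 6 7]]]]]]]) auto
qed

definition transfer_com :: "nat \<Rightarrow> nat \<Rightarrow> com" where
  "transfer_com a b = unpack a ;; pack b"

lemma run_transfer_com:
  assumes "s a = v # vs" "a \<noteq> b"
  shows "run (transfer_com a b) (embed s) (15 * lb v + 30) (embed (s(a := vs, b := v # s b)))"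
proof -
  let ?s1 = "(embed s)(V a := encs vs, X 1 := rev (bits v) @ embed s (X 1))"
  have 1: "run (unpack a) (embed s) (6 * lb v + 9) ?s1" by (rule run_unpack) (use assms in auto)
  have 2: "run (pack b) ?s1 (9 * length (?s1 (X 1)) + 15) (?s1(V b := enc_nat (val (rev (?s1 (X 1)))) @ ?s1 (V b), X 1 := []))"
    by (rule run_pack) simp
  show ?thesis unfolding transfer_com_def
    by (rule run_weaken[OF run_Seq[OF 1 2]]) (use assms in \<open>auto simp: embed_upd\<close>)
qed

definition drop_com :: "nat \<Rightarrow> com" where
  "drop_com a = unpack a ;; drain (X 1)"

lemma run_drop_com:
  assumes "s a = v # vs"
  shows "run (drop_com a) (embed s) (8 * lb v + 11) (embed (s(a := vs)))"
proof -
  let ?s1 = "(embed s)(V a := encs vs, X 1 := rev (bits v) @ embed s (X 1))"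
  have 1: "run (unpack a) (embed s) (6 * lb v + 9) ?s1" by (rule run_unpack) (use assms in auto)
  have 2: "run (drain (X 1)) ?s1 (2 * length (?s1 (X 1)) + 1) (?s1(X 1 := []))" by (rule run_drain)
  show ?thesis unfolding drop_com_def
    by (rule run_weaken[OF run_Seq[OF 1 2]]) (use assms in \<open>auto simp: embed_upd\<close>)
qed

fun pushes :: "reg \<Rightarrow> bool list \<Rightarrow> com" where
  "pushes r [] = Skip"
| "pushes r (b # bs) = pushes r bs ;; Push r b"

lemma run_pushes: "run (pushes r bs) s (2 * length bs + 1) (s(r := bs @ s r))"
proof (induction bs)
  case Nil
  show ?case using run_Skip[of s] by simp
next
  case (Cons b bs)
  show ?case unfolding pushes.simps by (rule run_weaken[OF run_Seq[OF Cons run_Push]]) auto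
qed

definition const_com :: "nat \<Rightarrow> com" where
  "const_com n = pushes (V 0) (enc_nat n)"

lemma run_const_com: "run (const_com n) (embed s) (4 * lb n + 5) (embed (s(0 := n # s 0)))"
  unfolding const_com_def
  by (rule run_weaken[OF run_pushes]) (auto simp: embed_upd enc_nat_dbl length_dbl)

text \<open>Inspecting a stack pops a bit, which is therefore pushed back. As no number is encoded
  by the empty word, one bit decides whether the list of numbers is empty.\<close>

definition nonempty_com :: "nat \<Rightarrow> com" where
  "nonempty_com a = Case (V a) (const_com 0) (Push (V a) False ;; const_com 1) (Push (V a) True ;; const_com 1)"

lemma run_nonempty_com:
  assumes "a \<noteq> 0"
  shows "run (nonempty_com a) (embed s) 12 (embed (s(0 := (if s a = [] then 0 else 1) # s 0)))"
proof (cases "s a = []")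
  case True
  show ?thesis unfolding nonempty_com_def
    by (rule run_weaken[OF run_CaseE[OF _ run_const_com]]) (use True in auto)
next
  case False
  then obtain b bs where b: "embed s (V a) = b # bs" by (cases "encs (s a)") auto
  have 1: "run (Push (V a) b) ((embed s)(V a := bs)) 1 (embed s)"
    by (rule run_weaken[OF run_Push]) (use b in auto)
  have e: "run (Push (V a) b ;; const_com 1) ((embed s)(V a := bs)) 11 (embed (s(0 := 1 # s 0)))"
    by (rule run_weaken[OF run_Seq[OF 1 run_const_com]]) (auto simp: bits_Cons)
  have "run (if b then Push (V a) True ;; const_com 1 else Push (V a) False ;; const_com 1) ((embed s)(V a := bs)) 11 (embed (s(0 := 1 # s 0)))"
    using e by (cases b) auto
  then show ?thesis unfolding nonempty_com_def
    by (rule_tac run_weaken[OF run_CaseC[where s = "embed s", OF b]]) (use False in auto)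
qed

text \<open>\<open>bits 0\<close> is empty, so emptiness of \<open>X 1\<close> after unpacking is
  the test for zero. The digits are drained before the branch because branches start from clean
  scratch stacks.\<close>

definition test_com :: "com \<Rightarrow> com \<Rightarrow> com" where
  "test_com c1 c2 = unpack 0 ;; Case (X 1) c2 (drain (X 1) ;; c1) (drain (X 1) ;; c1)"

lemma run_test_com:
  assumes s: "s 0 = v # vs" and c: "run (if v = 0 then c2 else c1) (embed (s(0 := vs))) t s'"
  shows "run (test_com c1 c2) (embed s) (8 * lb v + 15 + t) s'"
proof -
  let ?s1 = "(embed s)(V 0 := encs vs, X 1 := rev (bits v) @ embed s (X 1))"
  have 1: "run (unpack 0) (embed s) (6 * lb v + 9) ?s1" by (rule run_unpack) (use s in auto)
  have 2: "run (Case (X 1) c2 (drain (X 1) ;; c1) (drain (X 1) ;; c1)) ?s1 (2 * lb v + 3 + t) s'"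
  proof (cases "v = 0")
    case True
    have "?s1 = embed (s(0 := vs))" using True by (intro ext) (auto simp: embed_upd)
    then have "run c2 ?s1 t s'" using c True by simp
    then show ?thesis by (rule_tac run_weaken[OF run_CaseE]) (use True in auto)
  next
    case False
    then obtain b bs where b: "?s1 (X 1) = b # bs" by (cases "rev (bits v)") auto
    then have l: "length (b # bs) = lb v" by (metis append_Nil2 embed_simps(2) fun_upd_same length_rev)
    have e: "?s1(X 1 := bs, X 1 := []) = embed (s(0 := vs))" by (intro ext) (auto simp: embed_upd)
    have d: "run (drain (X 1)) (?s1(X 1 := bs)) (2 * length ((?s1(X 1 := bs)) (X 1)) + 1) (?s1(X 1 := bs, X 1 := []))"
      by (rule run_drain)
    have "run (drain (X 1) ;; c1) (?s1(X 1 := bs)) (2 * lb v + 2 + t) s'"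
      by (rule run_weaken[OF run_Seq[OF d[unfolded e]]]) (use c False l in auto)
    then have "run (if b then drain (X 1) ;; c1 else drain (X 1) ;; c1) (?s1(X 1 := bs)) (2 * lb v + 2 + t) s'" by simp
    then show ?thesis by (rule_tac run_weaken[OF run_CaseC[where s = ?s1, OF b]]) auto
  qed
  show ?thesis unfolding test_com_def
    by (rule run_weaken[OF run_Seq[OF 1 2]]) auto
qed

section \<open>A while language on stacks of numbers\<close>

datatype exp = Num nat | Var nat | Nonempty nat | Add exp exp | Sub exp exp | Mul exp exp

type_synonym env = "nat \<Rightarrow> nat list"

fun eval :: "exp \<Rightarrow> env \<Rightarrow> nat" where
  "eval (Num n) s = n"
| "eval (Var a) s = hd (s a)"
| "eval (Nonempty a) s = (if s a = [] then 0 else 1)"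
| "eval (Add e1 e2) s = eval e1 s + eval e2 s"
| "eval (Sub e1 e2) s = eval e1 s - eval e2 s"
| "eval (Mul e1 e2) s = eval e1 s * eval e2 s"

text \<open>Z bounds the values of all variables that are read; it enters only the running time. Stack 0 is
  excluded because expressions are evaluated there.\<close>
fun safe :: "nat \<Rightarrow> exp \<Rightarrow> env \<Rightarrow> bool" where
  "safe Z (Num n) s = True"
| "safe Z (Var a) s = (a \<noteq> 0 \<and> s a \<noteq> [] \<and> hd (s a) \<le> Z)"
| "safe Z (Nonempty a) s = (a \<noteq> 0)"
| "safe Z (Add e1 e2) s = (safe Z e1 s \<and> safe Z e2 s)"
| "safe Z (Sub e1 e2) s = (safe Z e1 s \<and> safe Z e2 s)"
| "safe Z (Mul e1 e2) s = (safe Z e1 s \<and> safe Z e2 s)"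

text \<open>The number of blocks of \<open>lb Z + 1\<close> digits that suffice for the value;
  counted this way, the digit bound is additive over all three operations.\<close>

fun esize :: "exp \<Rightarrow> nat" where
  "esize (Num n) = lb n + 1"
| "esize (Add e1 e2) = esize e1 + esize e2"
| "esize (Sub e1 e2) = esize e1 + esize e2"
| "esize (Mul e1 e2) = esize e1 + esize e2"
| "esize _ = 1"

fun cexp :: "exp \<Rightarrow> com" where
  "cexp (Num n) = const_com n"
| "cexp (Var a) = dup_com a 0"
| "cexp (Nonempty a) = nonempty_com a"
| "cexp (Add e1 e2) = cexp e1 ;; cexp e2 ;; add_com"
| "cexp (Sub e1 e2) = cexp e1 ;; cexp e2 ;; sub_com"
| "cexp (Mul e1 e2) = cexp e1 ;; cexp e2 ;; mul_com"

text \<open>The factor in front of (lb Z + 1)^2 in the running time; every operation is charged the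
  quadratic price of a multiplication.\<close>

fun ecost :: "exp \<Rightarrow> nat" where
  "ecost (Num n) = 4 * lb n + 5"
| "ecost (Add e1 e2) = ecost e1 + ecost e2 + 200 * (esize e1 + esize e2 + 1) ^ 2 + 2"
| "ecost (Sub e1 e2) = ecost e1 + ecost e2 + 200 * (esize e1 + esize e2 + 1) ^ 2 + 2"
| "ecost (Mul e1 e2) = ecost e1 + ecost e2 + 200 * (esize e1 + esize e2 + 1) ^ 2 + 2"
| "ecost _ = 100"

text \<open>Safe expressions never read stack 0, so the value of a first operand waiting there does
  not disturb the evaluation of the second.\<close>

lemma eval_operand_stack: "safe Z e s \<Longrightarrow> eval e (s(0 := xs)) = eval e s"
  by (induction e) auto

lemma safe_operand_stack: "safe Z e s \<Longrightarrow> safe Z e (s(0 := xs))"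
  by (induction e) auto

lemma lb_add: "lb (x + y) \<le> Suc (max (lb x) (lb y))"
proof (rule length_bits_le)
  have "x < 2 ^ lb x" "y < 2 ^ lb y" using val_less[of "bits x"] val_less[of "bits y"] by auto
  moreover have "(2::nat) ^ lb x \<le> 2 ^ max (lb x) (lb y)" "(2::nat) ^ lb y \<le> 2 ^ max (lb x) (lb y)"
    by (auto intro: power_increasing)
  ultimately show "x + y < 2 ^ Suc (max (lb x) (lb y))" unfolding power_Suc by linarith
qed

lemma esize_pos: "esize e \<ge> 1"
  by (induction e) auto

lemma lb_eval: "safe Z e s \<Longrightarrow> lb (eval e s) \<le> esize e * (lb Z + 1)"
proof (induction e)
  case (Var a)
  then show ?case using length_bits_mono[of "hd (s a)" Z] by simp
next
  case (Add e1 e2)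
  have "1 * 1 \<le> esize e1 * (lb Z + 1)" "1 * 1 \<le> esize e2 * (lb Z + 1)" by (rule mult_le_mono; use esize_pos in force)+
  then show ?case using Add lb_add[of "eval e1 s" "eval e2 s"] by (simp add: add_mult_distrib)
next
  case (Sub e1 e2)
  then show ?case using length_bits_mono[of "eval e1 s - eval e2 s" "eval e1 s"] by (simp add: add_mult_distrib)
next
  case (Mul e1 e2)
  then show ?case using length_bits_mult[of "eval e1 s" "eval e2 s"] by (simp add: add_mult_distrib)
qed (auto simp: bits_Cons)

lemma op_cost:
  fixes n1 n2 k1 k2 L :: nat
  assumes "n1 \<le> k1 * (L + 1)" "n2 \<le> k2 * (L + 1)"
  shows "200 * (n1 + n2 + 1) ^ 2 \<le> 200 * (k1 + k2 + 1) ^ 2 * (L + 1) ^ (2::nat)" 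
proof -
  have "n1 + n2 + 1 \<le> k1 * (L + 1) + k2 * (L + 1) + (L + 1)" using assms by (intro add_mono) auto
  also have "\<dots> = (k1 + k2 + 1) * (L + 1)" by (simp only: add_mult_distrib mult_1)
  finally have "n1 + n2 + 1 \<le> (k1 + k2 + 1) * (L + 1)" .
  then have "(n1 + n2 + 1) ^ 2 \<le> ((k1 + k2 + 1) * (L + 1)) ^ 2" by (rule power_mono) simp
  then show ?thesis by (simp only: power_mult_distrib mult.assoc)
qed

lemma op_cost_total: "(m::nat) \<le> d * q ^ 2 \<Longrightarrow> 0 < q \<Longrightarrow> Suc (c1 * q ^ 2 + Suc (c2 * q ^ 2 + m)) \<le> (c1 + c2 + d + 2) * q ^ 2"
  using one_le_power[of q 2] unfolding add_mult_distrib by linarith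

lemma linear_le_square: "30 * (m::nat) + 70 \<le> 200 * (m + 1) ^ 2"
  by (simp add: power2_eq_square algebra_simps)

lemma run_cexp:
  "safe Z e s \<Longrightarrow> run (cexp e) (embed s) (ecost e * (lb Z + 1) ^ 2) (embed (s(0 := eval e s # s 0)))"
proof (induction e arbitrary: s)
  case (Num n)
  show ?case unfolding cexp.simps by (rule run_weaken[OF run_const_com]) (auto simp: fun_upd_def)
next
  case (Var a)
  then obtain v vs where v: "s a = v # vs" by (cases "s a") auto
  have "lb v \<le> lb Z" using Var v by (auto intro: length_bits_mono)
  then have "40 * lb v + 60 \<le> 100 * (lb Z + 1) ^ 2" by (simp add: power2_eq_square)
  then show ?case unfolding cexp.simps
    by (rule_tac run_weaken[OF run_dup_com[where s = s, OF v]]) (use Var v in \<open>auto simp: fun_upd_def\<close>)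
next
  case (Nonempty a)
  have "(1::nat) \<le> (lb Z + 1) ^ 2" by simp
  then have "12 \<le> 100 * (lb Z + 1) ^ 2" by linarith
  show ?case unfolding cexp.simps ecost.simps
    by (rule run_weaken[OF run_nonempty_com]) (use Nonempty \<open>12 \<le> 100 * (lb Z + 1) ^ 2\<close> in \<open>auto simp: fun_upd_def\<close>)
next
  case (Add e1 e2)
  let ?s1 = "s(0 := eval e1 s # s 0)"
  have 1: "run (cexp e1) (embed s) (ecost e1 * (lb Z + 1) ^ 2) (embed ?s1)"
    by (rule Add.IH(1)) (use Add.prems in simp)
  have 2: "run (cexp e2) (embed ?s1) (ecost e2 * (lb Z + 1) ^ 2) (embed (?s1(0 := eval e2 ?s1 # ?s1 0)))"
    by (rule Add.IH(2)[OF safe_operand_stack]) (use Add.prems in simp)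
  have e: "eval e2 ?s1 = eval e2 s" by (rule eval_operand_stack[of Z]) (use Add.prems in simp)
  let ?s2 = "?s1(0 := eval e2 ?s1 # ?s1 0)"
  have "?s2 0 = eval e2 s # eval e1 s # s 0" using e by simp
  note 3 = run_add_com[where s = ?s2, OF this]
  have c: "200 * (lb (eval e1 s) + lb (eval e2 s) + 1) ^ 2 \<le> 200 * (esize e1 + esize e2 + 1) ^ 2 * (lb Z + 1) ^ (2::nat)"
    using Add.prems by (intro op_cost lb_eval) auto
  show ?case unfolding cexp.simps ecost.simps
    by (rule run_weaken[OF run_Seq[OF 1 run_Seq[OF 2 3]]], rule op_cost_total[OF order_trans[OF linear_le_square c]], simp,
        rule arg_cong[where f = embed], rule ext, simp)
next
  case (Sub e1 e2)
  let ?s1 = "s(0 := eval e1 s # s 0)"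
  have 1: "run (cexp e1) (embed s) (ecost e1 * (lb Z + 1) ^ 2) (embed ?s1)"
    by (rule Sub.IH(1)) (use Sub.prems in simp)
  have 2: "run (cexp e2) (embed ?s1) (ecost e2 * (lb Z + 1) ^ 2) (embed (?s1(0 := eval e2 ?s1 # ?s1 0)))"
    by (rule Sub.IH(2)[OF safe_operand_stack]) (use Sub.prems in simp)
  have e: "eval e2 ?s1 = eval e2 s" by (rule eval_operand_stack[of Z]) (use Sub.prems in simp)
  let ?s2 = "?s1(0 := eval e2 ?s1 # ?s1 0)"
  have "?s2 0 = eval e2 s # eval e1 s # s 0" using e by simp
  note 3 = run_sub_com[where s = ?s2, OF this]
  have c: "200 * (lb (eval e1 s) + lb (eval e2 s) + 1) ^ 2 \<le> 200 * (esize e1 + esize e2 + 1) ^ 2 * (lb Z + 1) ^ (2::nat)"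
    using Sub.prems by (intro op_cost lb_eval) auto
  show ?case unfolding cexp.simps ecost.simps
    by (rule run_weaken[OF run_Seq[OF 1 run_Seq[OF 2 3]]], rule op_cost_total[OF order_trans[OF linear_le_square c]], simp,
        rule arg_cong[where f = embed], rule ext, simp)
next
  case (Mul e1 e2)
  let ?s1 = "s(0 := eval e1 s # s 0)"
  have 1: "run (cexp e1) (embed s) (ecost e1 * (lb Z + 1) ^ 2) (embed ?s1)"
    by (rule Mul.IH(1)) (use Mul.prems in simp)
  have 2: "run (cexp e2) (embed ?s1) (ecost e2 * (lb Z + 1) ^ 2) (embed (?s1(0 := eval e2 ?s1 # ?s1 0)))"
    by (rule Mul.IH(2)[OF safe_operand_stack]) (use Mul.prems in simp)
  have e: "eval e2 ?s1 = eval e2 s" by (rule eval_operand_stack[of Z]) (use Mul.prems in simp)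
  let ?s2 = "?s1(0 := eval e2 ?s1 # ?s1 0)"
  have "?s2 0 = eval e2 s # eval e1 s # s 0" using e by simp
  note 3 = run_mul_com[where s = ?s2, OF this]
  have c: "200 * (lb (eval e1 s) + lb (eval e2 s) + 1) ^ 2 \<le> 200 * (esize e1 + esize e2 + 1) ^ 2 * (lb Z + 1) ^ (2::nat)"
    using Mul.prems by (intro op_cost lb_eval) auto
  show ?case unfolding cexp.simps ecost.simps
    by (rule run_weaken[OF run_Seq[OF 1 run_Seq[OF 2 3]]], rule op_cost_total[OF c], simp,
        rule arg_cong[where f = embed], rule ext, simp)
qed

section \<open>Statements, their timed semantics and their compilation\<close>

datatype prog = Nop | Assign nat exp | PushE nat exp | Drop nat | Sq prog prog (infixr ";" 60)
  | If exp prog prog | While exp prog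

inductive bs :: "nat \<Rightarrow> prog \<Rightarrow> env \<Rightarrow> nat \<Rightarrow> env \<Rightarrow> bool" for Z where
  Nop: "bs Z Nop s 1 s"
| Assign: "a \<noteq> 0 \<Longrightarrow> safe Z e s \<Longrightarrow> s a \<noteq> [] \<Longrightarrow> hd (s a) \<le> Z \<Longrightarrow> bs Z (Assign a e) s 1 (s(a := eval e s # tl (s a)))"
| PushE: "a \<noteq> 0 \<Longrightarrow> safe Z e s \<Longrightarrow> bs Z (PushE a e) s 1 (s(a := eval e s # s a))"
| Drop: "a \<noteq> 0 \<Longrightarrow> s a \<noteq> [] \<Longrightarrow> hd (s a) \<le> Z \<Longrightarrow> bs Z (Drop a) s 1 (s(a := tl (s a)))"
| Sq: "bs Z c1 s t s' \<Longrightarrow> bs Z c2 s' t' s'' \<Longrightarrow> bs Z (c1 ; c2) s (t + t') s''"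
| If: "safe Z e s \<Longrightarrow> bs Z (if eval e s \<noteq> 0 then c1 else c2) s t s' \<Longrightarrow> bs Z (If e c1 c2) s (Suc t) s'"
| WhileE: "safe Z e s \<Longrightarrow> eval e s = 0 \<Longrightarrow> bs Z (While e c) s 1 s"
| WhileC: "safe Z e s \<Longrightarrow> eval e s \<noteq> 0 \<Longrightarrow> bs Z c s t s' \<Longrightarrow> bs Z (While e c) s' t' s'' \<Longrightarrow> bs Z (While e c) s (Suc (t + t')) s''"

text \<open>The flag in \<open>X 9\<close> is popped before a loop body starts and set again only
  after it has finished. It is absent during the body, so nested loops can share
  \<open>X 9\<close>.\<close>

fun cprog :: "prog \<Rightarrow> com" where
  "cprog Nop = Skip"
| "cprog (Assign a e) = cexp e ;; drop_com a ;; transfer_com 0 a"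
| "cprog (PushE a e) = cexp e ;; transfer_com 0 a"
| "cprog (Drop a) = drop_com a"
| "cprog (c1 ; c2) = cprog c1 ;; cprog c2"
| "cprog (If e c1 c2) = cexp e ;; test_com (cprog c1) (cprog c2)"
| "cprog (While e c) = Push (X 9) True ;;
     Loop (X 9) Skip (cexp e ;; test_com (cprog c ;; Push (X 9) True) Skip)"

fun pcost :: "prog \<Rightarrow> nat" where
  "pcost Nop = 1"
| "pcost (Assign a e) = ecost e + 15 * esize e + 60"
| "pcost (PushE a e) = ecost e + 15 * esize e + 40"
| "pcost (Drop a) = 20"
| "pcost (c1 ; c2) = pcost c1 + pcost c2 + 1"
| "pcost (If e c1 c2) = ecost e + 8 * esize e + 20 + pcost c1 + pcost c2"
| "pcost (While e c) = ecost e + 8 * esize e + 22 + pcost c"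

lemma bs_time_pos: "bs Z c s t s' \<Longrightarrow> t \<ge> 1"
  by (induction rule: bs.induct) auto

text \<open>After a round of a \<open>While\<close>, execution re-enters the compiled
  \<open>Loop\<close> with the flag already set, not the whole command; the induction therefore
  carries a second claim about the bare loop. The difference of 2 in its cost pays for the initial
  \<open>Push\<close> and its sequencing.\<close>

lemma run_cprog_loop:
  assumes "bs Z c s t s'"
  defines "Q \<equiv> (lb Z + 1) ^ 2"
  shows "run (cprog c) (embed s) (pcost c * t * Q) (embed s') \<and>
    (\<forall>e c'. c = While e c' \<longrightarrow> run (Loop (X 9) Skip (cexp e ;; test_com (cprog c' ;; Push (X 9) True) Skip))
      ((embed s)(X 9 := [True])) ((pcost c - 2) * t * Q) (embed s'))"
  using assms(1)
proof (induction rule: bs.induct)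
  case (Nop s)
  have "1 \<le> Q" by (simp add: Q_def)
  then show ?case by (auto intro!: run_weaken[OF run_Skip])
next
  case (Assign a e s)
  then obtain v vs where v: "s a = v # vs" by (cases "s a") auto
  let ?s1 = "s(0 := eval e s # s 0)"
  have 1: "run (cexp e) (embed s) (ecost e * Q) (embed ?s1)" unfolding Q_def using Assign by (intro run_cexp)
  have 2: "run (drop_com a) (embed ?s1) (8 * lb v + 11) (embed (?s1(a := vs)))" by (rule run_drop_com) (use Assign v in simp)
  have 3: "run (transfer_com 0 a) (embed (?s1(a := vs))) (15 * lb (eval e s) + 30)
    (embed (?s1(a := vs, 0 := s 0, a := eval e s # (?s1(a := vs)) a)))"
    by (rule run_transfer_com) (use Assign in auto)
  have q: "1 \<le> Q" "lb Z + 1 \<le> Q" by (auto simp: Q_def power2_eq_square)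
  have "lb v \<le> lb Z" using Assign v by (auto intro: length_bits_mono)
  then have c1: "8 * lb v + 8 \<le> 8 * Q" using q by simp
  have "lb (eval e s) \<le> esize e * Q"
    by (rule order_trans[OF lb_eval[OF Assign(2)] mult_le_mono2[OF q(2)]])
  then have c2: "15 * lb (eval e s) + 35 \<le> 15 * esize e * Q + 35 * Q" using q by linarith
  have "run (cprog (Assign a e)) (embed s) (pcost (Assign a e) * 1 * Q) (embed (s(a := eval e s # tl (s a))))"
    unfolding cprog.simps pcost.simps
    by (rule run_weaken[OF run_Seq[OF 1 run_Seq[OF 2 3]]])
      (use c1 c2 q v Assign(1) in \<open>auto simp: algebra_simps intro!: arg_cong[of _ _ embed]\<close>)
  then show ?case by (simp add: fun_upd_def)
next
  case (PushE a e s)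
  let ?s1 = "s(0 := eval e s # s 0)"
  have 1: "run (cexp e) (embed s) (ecost e * Q) (embed ?s1)" unfolding Q_def using PushE by (intro run_cexp)
  have 3: "run (transfer_com 0 a) (embed ?s1) (15 * lb (eval e s) + 30)
    (embed (?s1(0 := s 0, a := eval e s # ?s1 a)))"
    by (rule run_transfer_com) (use PushE in auto)
  have q: "1 \<le> Q" "lb Z + 1 \<le> Q" by (auto simp: Q_def power2_eq_square)
  have "lb (eval e s) \<le> esize e * Q"
    by (rule order_trans[OF lb_eval[OF PushE(2)] mult_le_mono2[OF q(2)]])
  then have c2: "15 * lb (eval e s) + 35 \<le> 15 * esize e * Q + 35 * Q" using q by linarith
  have "run (cprog (PushE a e)) (embed s) (pcost (PushE a e) * 1 * Q) (embed (s(a := eval e s # s a)))"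
    unfolding cprog.simps pcost.simps
    by (rule run_weaken[OF run_Seq[OF 1 3]])
      (use c2 q PushE(1) in \<open>auto simp: algebra_simps intro!: arg_cong[of _ _ embed]\<close>)
  then show ?case by (simp add: fun_upd_def)
next
  case (Drop a s)
  then obtain v vs where v: "s a = v # vs" by (cases "s a") auto
  have q: "1 \<le> Q" "lb Z + 1 \<le> Q" by (auto simp: Q_def power2_eq_square)
  have "lb v \<le> lb Z" using Drop v by (auto intro: length_bits_mono)
  then have c1: "8 * lb v + 11 \<le> 20 * Q" using q by linarith
  show ?case by (auto intro!: run_weaken[OF run_drop_com[where s = s, OF v]] simp: c1 v fun_upd_def)
next
  case (Sq c1 s t s' c2 t' s'')
  have "1 \<le> t" "1 \<le> Q" using bs_time_pos[OF Sq(1)] by (auto simp: Q_def)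
  then have "1 \<le> t * Q" by simp
  then have "Suc (pcost c1 * t * Q + pcost c2 * t' * Q) \<le> (pcost c1 + pcost c2 + 1) * (t + t') * Q"
    unfolding add_mult_distrib add_mult_distrib2 mult_1 by linarith
  then have "run (cprog (c1 ; c2)) (embed s) (pcost (c1 ; c2) * (t + t') * Q) (embed s'')"
    unfolding cprog.simps pcost.simps
    by (rule_tac run_weaken[OF run_Seq[OF conjunct1[OF Sq(3)] conjunct1[OF Sq(4)]]]) auto
  then show ?case by (simp add: fun_upd_def)
next
  case (If e s c1 c2 t s')
  let ?v = "eval e s"
  have 1: "run (cexp e) (embed s) (ecost e * Q) (embed (s(0 := ?v # s 0)))" unfolding Q_def using If by (intro run_cexp)
  have b: "run (if ?v = 0 then cprog c2 else cprog c1) (embed s) ((pcost c1 + pcost c2) * t * Q) (embed s')"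
  proof (cases "?v = 0")
    case True
    show ?thesis using conjunct1[OF If.IH] True
      by (auto elim!: run_weaken simp: add_mult_distrib)
  next
    case False
    show ?thesis using conjunct1[OF If.IH] False
      by (auto elim!: run_weaken simp: add_mult_distrib)
  qed
  have 2: "run (test_com (cprog c1) (cprog c2)) (embed (s(0 := ?v # s 0))) (8 * lb ?v + 15 + (pcost c1 + pcost c2) * t * Q) (embed s')"
    by (rule run_test_com) (use b in auto)
  have q: "1 \<le> Q" "lb Z + 1 \<le> Q" by (auto simp: Q_def power2_eq_square)
  have "lb ?v \<le> esize e * Q"
    by (rule order_trans[OF lb_eval[OF If(1)] mult_le_mono2[OF q(2)]])
  then have "8 * lb ?v + 20 \<le> (8 * esize e + 20) * Q" using q by (simp add: algebra_simps)
  then have "run (cprog (If e c1 c2)) (embed s) (pcost (If e c1 c2) * Suc t * Q) (embed s')"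
    unfolding cprog.simps pcost.simps
    by (rule_tac run_weaken[OF run_Seq[OF 1 2]]) (auto simp: algebra_simps)
  then show ?case by (simp add: fun_upd_def)
next
  case (WhileE e s c)
  let ?v = "eval e s" and ?T = "test_com (cprog c ;; Push (X 9) True) Skip"
  have q: "1 \<le> Q" "lb Z + 1 \<le> Q" by (auto simp: Q_def power2_eq_square)
  have 1: "run (cexp e) (embed s) (ecost e * Q) (embed (s(0 := ?v # s 0)))" unfolding Q_def using WhileE by (intro run_cexp)
  have 2: "run ?T (embed (s(0 := ?v # s 0))) (8 * lb ?v + 15 + 1) (embed s)"
    by (rule run_test_com) (use WhileE run_Skip in auto)
  have "run (if True then cexp e ;; ?T else Skip) (((embed s)(X 9 := [True]))(X 9 := [])) (Suc (ecost e * Q + (8 * lb ?v + 15 + 1))) (embed s)"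
    using run_Seq[OF 1 2] by (simp add: fun_upd_idem)
  moreover have "run (Loop (X 9) Skip (cexp e ;; ?T)) (embed s) 1 (embed s)" by (rule run_LoopE) simp
  ultimately have L0: "run (Loop (X 9) Skip (cexp e ;; ?T)) ((embed s)(X 9 := [True])) (Suc (Suc (ecost e * Q + (8 * lb ?v + 15 + 1)) + 1)) (embed s)"
    by (rule_tac run_LoopC) auto
  have v: "lb ?v = 0" using WhileE by simp
  have L: "run (Loop (X 9) Skip (cexp e ;; ?T)) ((embed s)(X 9 := [True])) ((pcost (While e c) - 2) * 1 * Q) (embed s)"
    by (rule run_weaken[OF L0]) (use q v in \<open>auto simp: algebra_simps\<close>)
  have p: "run (Push (X 9) True) (embed s) 1 ((embed s)(X 9 := [True]))"
    by (rule run_weaken[OF run_Push]) auto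
  have "run (cprog (While e c)) (embed s) (pcost (While e c) * 1 * Q) (embed s)"
    unfolding cprog.simps by (rule run_weaken[OF run_Seq[OF p L]]) (use q in \<open>auto simp: algebra_simps\<close>)
  then show ?case using L by (auto simp: fun_upd_def)
next
  case (WhileC e s c t s' t' s'')
  let ?v = "eval e s" and ?T = "test_com (cprog c ;; Push (X 9) True) Skip"
  have q: "1 \<le> Q" "lb Z + 1 \<le> Q" by (auto simp: Q_def power2_eq_square)
  have 1: "run (cexp e) (embed s) (ecost e * Q) (embed (s(0 := ?v # s 0)))" unfolding Q_def using WhileC by (intro run_cexp)
  have p: "run (Push (X 9) True) (embed s) 1 ((embed s)(X 9 := [True]))" for s
    by (rule run_weaken[OF run_Push]) auto
  have b: "run (cprog c ;; Push (X 9) True) (embed s) (Suc (pcost c * t * Q + 1)) ((embed s')(X 9 := [True]))"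
    by (rule run_Seq[OF conjunct1[OF WhileC.IH(1)] p])
  have 2: "run ?T (embed (s(0 := ?v # s 0))) (8 * lb ?v + 15 + Suc (pcost c * t * Q + 1)) ((embed s')(X 9 := [True]))"
    by (rule run_test_com) (use WhileC b in auto)
  have 3: "run (if True then cexp e ;; ?T else Skip) (((embed s)(X 9 := [True]))(X 9 := []))
      (Suc (ecost e * Q + (8 * lb ?v + 15 + Suc (pcost c * t * Q + 1)))) ((embed s')(X 9 := [True]))"
    using run_Seq[OF 1 2] by (simp add: fun_upd_idem)
  have 4: "run (Loop (X 9) Skip (cexp e ;; ?T)) ((embed s')(X 9 := [True])) ((pcost (While e c) - 2) * t' * Q) (embed s'')"
    using WhileC.IH(2) by blast
  have L0: "run (Loop (X 9) Skip (cexp e ;; ?T)) ((embed s)(X 9 := [True]))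
      (Suc (Suc (ecost e * Q + (8 * lb ?v + 15 + Suc (pcost c * t * Q + 1))) + (pcost (While e c) - 2) * t' * Q)) (embed s'')"
    by (rule run_LoopC[OF _ 3 4]) simp
  have "lb ?v \<le> esize e * Q"
    by (rule order_trans[OF lb_eval[OF WhileC(1)] mult_le_mono2[OF q(2)]])
  then have v: "8 * lb ?v + 20 \<le> (8 * esize e + 20) * Q" using q by (simp add: algebra_simps)
  have L: "run (Loop (X 9) Skip (cexp e ;; ?T)) ((embed s)(X 9 := [True])) ((pcost (While e c) - 2) * Suc (t + t') * Q) (embed s'')"
    by (rule run_weaken[OF L0]) (use v in \<open>auto simp: algebra_simps\<close>)
  have "run (cprog (While e c)) (embed s) (pcost (While e c) * Suc (t + t') * Q) (embed s'')"
    unfolding cprog.simps by (rule run_weaken[OF run_Seq[OF p L]]) (use q in \<open>auto simp: algebra_simps\<close>)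
  then show ?case using L by (auto simp: fun_upd_def)
qed

lemma run_cprog:
  assumes "bs Z c s t s'"
  shows "run (cprog c) (embed s) (pcost c * t * (lb Z + 1) ^ 2) (embed s')"
  using run_cprog_loop[OF assms] by blast

section \<open>Simulation of a Turing machine by a stack program\<close>

text \<open>An instruction pushes at most one bit. This converts time bounds into length bounds,
  which are needed whenever one computation is fed into another.\<close>

lemma ex_length: "ex c s t s' \<Longrightarrow> length (s' r) \<le> length (s r) + t"
proof (induction arbitrary: r rule: ex.induct)
  case (CaseC s r' b bs c2 c1 t s' c0)
  then show ?case using CaseC.IH[of r] by (cases "r = r'") auto
next
  case (Seq c1 s t s' c2 t' s'')
  then show ?case using Seq.IH(1)[of r] Seq.IH(2)[of r] by linarith
next
  case (LoopC s r' b bs c2 c1 t s' t' s'')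
  have "length (s' r) \<le> length (s r) + t" using LoopC.IH(1)[of r] LoopC.hyps(1) by (cases "r = r'") auto
  then show ?case using LoopC.IH(2)[of r] by linarith
qed (auto simp: le_Suc_eq)

lemma run_length: "run c s T s' \<Longrightarrow> length (s' r) \<le> length (s r) + T"
  unfolding run_def using ex_length[of c s _ s' r] by fastforce

fun scode :: "sym \<Rightarrow> bool list" where
  "scode Bl = [True]" | "scode Zero = [False, False]" | "scode One = [False, True]"

definition scodes :: "sym list \<Rightarrow> bool list" where
  "scodes l = concat (map scode l)"

lemma scodes_simps [simp]: "scodes [] = []" "scodes (a # l) = scode a @ scodes l"
  by (auto simp: scodes_def)

lemma length_scodes: "length (scodes l) \<le> 2 * length l"
proof (induction l)
  case (Cons a l)
  then show ?case by (cases a) auto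
qed simp

text \<open>An exhausted stack and a stored blank lead to the same continuation, so the infinitely
  many outer blanks need no storage.\<close>

definition pop_sym :: "reg \<Rightarrow> (sym \<Rightarrow> com) \<Rightarrow> com" where
  "pop_sym r k = Case r (k Bl) (Case r Skip (k Zero) (k One)) (k Bl)"

definition head :: "sym list \<Rightarrow> sym" where
  "head l = (case l of [] \<Rightarrow> Bl | h # _ \<Rightarrow> h)"

lemma run_pop_sym:
  assumes r: "s r = scodes l" and k: "run (k (head l)) (s(r := scodes (tl l))) t s'"
  shows "run (pop_sym r k) s (t + 2) s'"
proof (cases l)
  case Nil
  have "run (k Bl) s t s'" using k r Nil by (simp add: head_def fun_upd_idem)
  then show ?thesis unfolding pop_sym_def
    by (rule_tac run_weaken[OF run_CaseE]) (use r Nil in auto)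
next
  case (Cons h l')
  show ?thesis
  proof (cases "h = Bl")
    case True
    have "run (if True then k Bl else Case r Skip (k Zero) (k One)) (s(r := scodes l')) t s'"
      using k Cons True by (simp add: head_def)
    then show ?thesis unfolding pop_sym_def
      by (rule_tac run_weaken[OF run_CaseC[where b = True]]) (use r Cons True in auto)
  next
    case False
    then obtain b where b: "scode h = [False, b]" and kb: "k h = (if b then k One else k Zero)" by (cases h) auto
    have "run (if b then k One else k Zero) (s(r := b # scodes l', r := scodes l')) t s'"
      using k Cons kb by (simp add: head_def)
    then have "run (Case r Skip (k Zero) (k One)) (s(r := b # scodes l')) (Suc t) s'"
      by (rule_tac run_CaseC[where b = b]) auto
    then have "run (if False then k Bl else Case r Skip (k Zero) (k One)) (s(r := b # scodes l')) (Suc t) s'" by simp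
    then show ?thesis unfolding pop_sym_def
      by (rule_tac run_weaken[OF run_CaseC[where b = False]]) (use r Cons b in auto)
  qed
qed

definition push_sym :: "reg \<Rightarrow> sym \<Rightarrow> com" where
  "push_sym r w = pushes r (scode w)"

lemma run_push_sym: "s r = scodes l \<Longrightarrow> run (push_sym r w) s 5 (s(r := scodes (w # l)))"
  unfolding push_sym_def by (rule run_weaken[OF run_pushes]) (cases w; auto)+

text \<open>The simulated state is in unary on \<open>X 3\<close>, the left half of the tape on
  \<open>X 2\<close>, and the scanned cell together with the right half on \<open>X 1\<close>;
  \<open>X 0\<close> is the loop flag.\<close>

definition sim_store :: "nat \<Rightarrow> sym list \<Rightarrow> sym list \<Rightarrow> bool list \<Rightarrow> store" where
  "sim_store q l R f = (\<lambda>_. [])(X 1 := scodes R, X 2 := scodes l, X 3 := replicate q True, X 0 := f)"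

fun act :: "nat \<times> sym \<times> move \<Rightarrow> com" where
  "act (q, w, m) = pushes (X 3) (replicate q True) ;;
     (case m of Nm \<Rightarrow> push_sym (X 1) w | Rm \<Rightarrow> push_sym (X 2) w
      | Lm \<Rightarrow> push_sym (X 1) w ;; pop_sym (X 2) (push_sym (X 1))) ;; Push (X 0) True"

definition view :: "sym list \<Rightarrow> sym list" where
  "view R = (if R = [] then [Bl] else R)"

text \<open>Applied after the scanned symbol has been popped, so R is the right half proper. After a
  right move R itself begins with the scanned cell, and \<open>view\<close> supplies the blank if R
  is empty.\<close>

fun moved :: "sym \<Rightarrow> move \<Rightarrow> sym list \<times> sym list \<Rightarrow> sym list \<times> sym list" where
  "moved w Nm (l, R) = (l, w # R)"
| "moved w Rm (l, R) = (w # l, R)"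
| "moved w Lm (l, R) = (tl l, head l # w # R)"

lemma moved_mv:
  assumes "view R = h # r" "moved w m (l, tl R) = (l', R')"
  shows "mv m l w r = (l', hd (view R'), tl (view R'))"
  using assms by (cases m; cases l; cases R; cases "tl R") (auto simp: view_def head_def)

lemma run_act:
  assumes "moved w m (l, R) = (l', R')"
  shows "run (act (q, w, m)) (sim_store 0 l R []) (2 * q + 20) (sim_store q l' R' [True])"
proof -
  let ?s = "sim_store q l R []"
  have 1: "run (pushes (X 3) (replicate q True)) (sim_store 0 l R []) (2 * q + 1) ?s"
    by (rule run_weaken[OF run_pushes]) (auto simp: sim_store_def)
  have 2: "run (case m of Nm \<Rightarrow> push_sym (X 1) w | Rm \<Rightarrow> push_sym (X 2) w
      | Lm \<Rightarrow> push_sym (X 1) w ;; pop_sym (X 2) (push_sym (X 1))) ?s 13 (sim_store q l' R' [])"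
  proof (cases m)
    case Nm
    have "run (push_sym (X 1) w) ?s 13 (sim_store q l' R' [])"
      by (rule run_weaken[OF run_push_sym[of _ _ R]]) (use assms Nm in \<open>auto simp: sim_store_def\<close>)
    then show ?thesis using Nm by simp
  next
    case Rm
    have "run (push_sym (X 2) w) ?s 13 (sim_store q l' R' [])"
      by (rule run_weaken[OF run_push_sym[of _ _ l]]) (use assms Rm in \<open>auto simp: sim_store_def\<close>)
    then show ?thesis using Rm by simp
  next
    case Lm
    have a: "run (push_sym (X 1) w) ?s 5 (sim_store q l (w # R) [])"
      by (rule run_weaken[OF run_push_sym[of _ _ R]]) (auto simp: sim_store_def)
    have b: "run (push_sym (X 1) (head l)) ((sim_store q l (w # R) [])(X 2 := scodes (tl l))) 5 (sim_store q l' R' [])"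
      by (rule run_weaken[OF run_push_sym[of _ _ "w # R"]]) (use assms Lm in \<open>auto simp: sim_store_def\<close>)
    have c: "run (pop_sym (X 2) (push_sym (X 1))) (sim_store q l (w # R) []) (5 + 2) (sim_store q l' R' [])"
      by (rule run_pop_sym[where l = l and k = "push_sym (X 1)", OF _ b]) (simp add: sim_store_def)
    have "run (push_sym (X 1) w ;; pop_sym (X 2) (push_sym (X 1))) ?s 13 (sim_store q l' R' [])"
      by (rule run_weaken[OF run_Seq[OF a c]]) auto
    then show ?thesis using Lm by simp
  qed
  have 3: "run (Push (X 0) True) (sim_store q l' R' []) 1 (sim_store q l' R' [True])"
    by (rule run_weaken[OF run_Push]) (auto simp: sim_store_def)
  show ?thesis unfolding act.simps by (rule run_weaken[OF run_Seq[OF 1 run_Seq[OF 2 3]]]) auto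
qed

text \<open>Counts the unary state down to its row. If the state outlasts the rows, the machine has
  halted; no action is performed, the flag is not set again, and the simulating loop ends.\<close>

fun dispatch :: "tm \<Rightarrow> com" where
  "dispatch [] = Skip"
| "dispatch (row # rows) = Case (X 3) (pop_sym (X 1) (\<lambda>h. act (row ! sym_idx h))) Skip (dispatch rows)"

lemma run_dispatch:
  assumes "q < length M" "M ! q ! sym_idx (head R) = (q', w, m)" "moved w m (l, tl R) = (l', R')"
  shows "run (dispatch M) (sim_store q l R []) (2 * q' + 23 + q) (sim_store q' l' R' [True])"
  using assms(1,2)
proof (induction M arbitrary: q)
  case (Cons row rows)
  show ?case
  proof (cases q)
    case 0
    have "run (act (row ! sym_idx (head R))) ((sim_store 0 l R [])(X 1 := scodes (tl R))) (2 * q' + 20) (sim_store q' l' R' [True])"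
      using run_act[OF assms(3), of q'] Cons.prems 0 by (simp add: sim_store_def fun_upd_twist)
    then have d: "run (pop_sym (X 1) (\<lambda>h. act (row ! sym_idx h))) (sim_store 0 l R []) (2 * q' + 20 + 2) (sim_store q' l' R' [True])"
      by (rule run_pop_sym[where l = R, rotated]) (simp add: sim_store_def)
    have z: "sim_store 0 l R [] (X 3) = []" by (simp add: sim_store_def)
    show ?thesis unfolding dispatch.simps 0 by (rule run_weaken[OF run_CaseE[OF z d]]) auto
  next
    case (Suc p)
    have "run (dispatch rows) (sim_store p l R []) (2 * q' + 23 + p) (sim_store q' l' R' [True])"
      using Cons.prems Suc by (intro Cons.IH) auto
    then have d: "run (if True then dispatch rows else Skip) ((sim_store q l R [])(X 3 := replicate p True)) (2 * q' + 23 + p) (sim_store q' l' R' [True])"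
      by (simp add: sim_store_def fun_upd_twist)
    have z: "sim_store q l R [] (X 3) = True # replicate p True" using Suc by (simp add: sim_store_def)
    show ?thesis unfolding dispatch.simps by (rule run_weaken[OF run_CaseC[OF z d]]) (use Suc in auto)
  qed
qed simp

lemma run_dispatch_halted:
  assumes "length M \<le> q"
  shows "run (dispatch M) (sim_store q l R []) (length M + 1) (sim_store (q - length M) l R [])"
  using assms
proof (induction M arbitrary: q)
  case Nil
  then show ?case using run_Skip by simp
next
  case (Cons row rows)
  then obtain p where p: "q = Suc p" by (cases q) auto
  have "run (dispatch rows) (sim_store p l R []) (length rows + 1) (sim_store (p - length rows) l R [])"
    using Cons p by auto
  then have d: "run (if True then dispatch rows else Skip) ((sim_store q l R [])(X 3 := replicate p True)) (length rows + 1) (sim_store (p - length rows) l R [])"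
    by (simp add: sim_store_def fun_upd_twist)
  have z: "sim_store q l R [] (X 3) = True # replicate p True" using p by (simp add: sim_store_def)
  show ?case unfolding dispatch.simps by (rule run_weaken[OF run_CaseC[OF z d]]) (use p in auto)
qed

text \<open>A crude bound by the sum of all successor states. It limits the unary counter and
  thereby the cost of one simulated step.\<close>

definition state_bound :: "tm \<Rightarrow> nat" where
  "state_bound M = sum_list (map (\<lambda>row. sum_list (map fst row)) M)"

lemma state_bound:
  assumes "wf_tm M" "q < length M" "M ! q ! sym_idx h = (q', w, m)"
  shows "q' \<le> state_bound M"
proof -
  have row: "M ! q \<in> set M" using assms(2) by simp
  then have "length (M ! q) = 3" using assms(1) by (simp add: wf_tm_def)
  then have "sym_idx h < length (M ! q)" by (cases h) (auto simp: sym_idx_def)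
  then have "(q', w, m) \<in> set (M ! q)" using assms(3) nth_mem by fastforce
  then have "q' \<in> set (map fst (M ! q))" by force
  then have "q' \<le> sum_list (map fst (M ! q))" by (intro member_le_sum_list) auto
  also have "\<dots> \<le> state_bound M" unfolding state_bound_def using row by (intro member_le_sum_list) auto
  finally show ?thesis .
qed

text \<open>The time t may lie after the moment of halting. What remains of the unary state is u,
  which has to be cleared afterwards and is bounded for that reason.\<close>

lemma run_sim_loop:
  assumes wf: "wf_tm M" and v: "view R = h # r" and hl: "halted M ((tm_step M ^^ t) (q, l, h, r))"
    and q: "q \<le> state_bound M"
  shows "\<exists>q' l' R' u. run (Loop (X 0) Skip (dispatch M)) (sim_store q l R [True])
        ((t + 1) * (2 * state_bound M + length M + 30)) (sim_store u l' R' [])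
     \<and> (tm_step M ^^ t) (q, l, h, r) = (q', l', hd (view R'), tl (view R')) \<and> u \<le> state_bound M
     \<and> length l' \<le> length l + t \<and> length R' \<le> max 1 (length R) + t"
  using v hl q
proof (induction t arbitrary: q l R h r)
  case 0
  let ?B = "state_bound M"
  have "length M \<le> q" using 0 by (simp add: halted_def)
  then have "run (dispatch M) ((sim_store q l R [True])(X 0 := [])) (length M + 1) (sim_store (q - length M) l R [])"
    using run_dispatch_halted[of M q l R] by (simp add: sim_store_def)
  then have 1: "run (if True then dispatch M else Skip) ((sim_store q l R [True])(X 0 := [])) (length M + 1) (sim_store (q - length M) l R [])" by simp
  have 2: "run (Loop (X 0) Skip (dispatch M)) (sim_store (q - length M) l R []) 1 (sim_store (q - length M) l R [])"
    by (rule run_LoopE) (simp add: sim_store_def)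
  have 3: "sim_store q l R [True] (X 0) = True # []" by (simp add: sim_store_def)
  have "run (Loop (X 0) Skip (dispatch M)) (sim_store q l R [True]) ((0 + 1) * (2 * ?B + length M + 30)) (sim_store (q - length M) l R [])"
    by (rule run_weaken[OF run_LoopC[OF 3 1 2]]) auto
  moreover have "q - length M \<le> ?B" using 0 by simp
  moreover have "(tm_step M ^^ 0) (q, l, h, r) = (q, l, hd (view R), tl (view R))" using 0 by simp
  ultimately show ?case by (intro exI[of _ q] exI[of _ l] exI[of _ R] exI[of _ "q - length M"]) auto
next
  case (Suc t)
  let ?B = "state_bound M"
  show ?case
  proof (cases "q < length M")
    case False
    \<comment> \<open>The machine has already halted: the configuration no longer changes, and the
      induction hypothesis applies to it unchanged.\<close>
    then have "tm_step M (q, l, h, r) = (q, l, h, r)" by (simp add: tm_step_def)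
    then have stay: "(tm_step M ^^ n) (q, l, h, r) = (q, l, h, r)" for n by (induction n) auto
    have "halted M ((tm_step M ^^ t) (q, l, h, r))" using Suc.prems(2) stay by metis
    from Suc.IH[OF Suc.prems(1) this Suc.prems(3)] obtain q' l' R' u where
      r: "run (Loop (X 0) Skip (dispatch M)) (sim_store q l R [True]) ((t + 1) * (2 * ?B + length M + 30)) (sim_store u l' R' [])"
      and e: "(tm_step M ^^ t) (q, l, h, r) = (q', l', hd (view R'), tl (view R'))" "u \<le> ?B"
        "length l' \<le> length l + t" "length R' \<le> max 1 (length R) + t" by blast
    have "run (Loop (X 0) Skip (dispatch M)) (sim_store q l R [True]) ((Suc t + 1) * (2 * ?B + length M + 30)) (sim_store u l' R' [])"
      by (rule run_weaken[OF r]) auto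
    moreover have "(tm_step M ^^ Suc t) (q, l, h, r) = (q', l', hd (view R'), tl (view R'))" using e(1) stay by metis
    moreover have "length l' \<le> length l + Suc t" "length R' \<le> max 1 (length R) + Suc t" using e by auto
    ultimately show ?thesis using e(2) by blast
  next
    case True
    have hd: "head R = h" using Suc.prems(1) by (auto simp: view_def head_def split: if_splits list.splits)
    obtain q1 w m where tr: "M ! q ! sym_idx h = (q1, w, m)" by (cases "M ! q ! sym_idx h")
    obtain l1 R1 where mo: "moved w m (l, tl R) = (l1, R1)" by (cases "moved w m (l, tl R)")
    have st: "tm_step M (q, l, h, r) = (q1, l1, hd (view R1), tl (view R1))"
      using True tr moved_mv[OF Suc.prems(1) mo] by (simp add: tm_step_def)
    have q1: "q1 \<le> ?B" by (rule state_bound[OF wf True tr])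
    have v1: "view R1 = hd (view R1) # tl (view R1)" by (simp add: view_def)
    have len: "length l1 \<le> Suc (length l)" "length R1 \<le> Suc (max 1 (length R))"
      using mo by (cases m; auto)+
    have "halted M ((tm_step M ^^ t) (q1, l1, hd (view R1), tl (view R1)))"
      using Suc.prems(2) st by (simp add: funpow_Suc_right del: funpow.simps)
    from Suc.IH[OF v1 this q1] obtain q' l' R' u where
      r: "run (Loop (X 0) Skip (dispatch M)) (sim_store q1 l1 R1 [True]) ((t + 1) * (2 * ?B + length M + 30)) (sim_store u l' R' [])"
      and e: "(tm_step M ^^ t) (q1, l1, hd (view R1), tl (view R1)) = (q', l', hd (view R'), tl (view R'))" "u \<le> ?B"
        "length l' \<le> length l1 + t" "length R' \<le> max 1 (length R1) + t" by blast
    have "run (dispatch M) ((sim_store q l R [True])(X 0 := [])) (2 * q1 + 23 + q) (sim_store q1 l1 R1 [True])"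
      using run_dispatch[OF True _ mo] tr hd by (simp add: sim_store_def)
    then have 1: "run (if True then dispatch M else Skip) ((sim_store q l R [True])(X 0 := [])) (2 * q1 + 23 + q) (sim_store q1 l1 R1 [True])" by simp
    have 3: "sim_store q l R [True] (X 0) = True # []" by (simp add: sim_store_def)
    have "run (Loop (X 0) Skip (dispatch M)) (sim_store q l R [True]) ((Suc t + 1) * (2 * ?B + length M + 30)) (sim_store u l' R' [])"
      by (rule run_weaken[OF run_LoopC[OF 3 1 r]]) (use q1 True in auto)
    moreover have "(tm_step M ^^ Suc t) (q, l, h, r) = (q', l', hd (view R'), tl (view R'))"
      using e(1) st by (simp add: funpow_Suc_right del: funpow.simps)
    moreover have "length l' \<le> length l + Suc t" "length R' \<le> max 1 (length R) + Suc t" using e len by auto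
    ultimately show ?thesis using e(2) by blast
  qed
qed

section \<open>Loading the input and reading off the output\<close>

definition load :: com where
  "load = Loop Tp (push_sym (X 1) Zero) (push_sym (X 1) One)"

lemma run_load: "run load (init_store x) (6 * length x + 1) (sim_store 0 [] (map bit_sym x) [])"
proof -
  have "run load ((\<lambda>_. [])(Tp := xs, X 1 := scodes l)) (6 * length xs + 1) ((\<lambda>_. [])(X 1 := scodes (rev (map bit_sym xs) @ l)))" for xs l
  proof (induction xs arbitrary: l)
    case Nil
    show ?case unfolding load_def by (rule run_weaken[OF run_LoopE]) auto
  next
    case (Cons b xs)
    let ?s = "(\<lambda>_. [])(Tp := b # xs, X 1 := scodes l)"
    have "run (push_sym (X 1) (bit_sym b)) (?s(Tp := xs)) 5 ((\<lambda>_. [])(Tp := xs, X 1 := scodes (bit_sym b # l)))"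
      by (rule run_weaken[OF run_push_sym[of _ _ l]]) auto
    then have 1: "run (if b then push_sym (X 1) One else push_sym (X 1) Zero) (?s(Tp := xs)) 5 ((\<lambda>_. [])(Tp := xs, X 1 := scodes (bit_sym b # l)))"
      by (cases b) (auto simp: bit_sym_One)
    have 0: "?s Tp = b # xs" by simp
    show ?case unfolding load_def
      by (rule run_weaken[OF run_LoopC[OF 0 1 Cons[of "bit_sym b # l", unfolded load_def]]]) auto
  qed
  note r = this[of "rev x" "[]"]
  have "(\<lambda>_. [])(Tp := rev x, X 1 := scodes []) = init_store x" by (auto simp: init_store_def)
  then have "run load (init_store x) (6 * length (rev x) + 1) ((\<lambda>_. [])(X 1 := scodes (rev (map bit_sym (rev x)) @ [])))"
    using r by simp
  then show ?thesis
    by (rule run_weaken, simp, intro ext) (simp add: sim_store_def rev_map)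
qed

definition read_off :: com where
  "read_off = Loop (X 0) Skip (pop_sym (X 1) (\<lambda>h. if h = Bl then Skip
     else (Push (X 4) (h = One) ;; Push (X 0) True)))"

definition readout :: "sym list \<Rightarrow> bool list" where
  "readout R = map (\<lambda>s. s = One) (takeWhile (\<lambda>s. s \<noteq> Bl) R)"

lemma run_read_off:
  assumes "s (X 0) = [True]" "s (X 1) = scodes R"
  shows "\<exists>R'. run read_off s (8 * length R + 8) (s(X 0 := [], X 1 := scodes R', X 4 := rev (readout R) @ s (X 4))) \<and> length R' \<le> length R"
  using assms
proof (induction R arbitrary: s)
  case Nil
  let ?K = "\<lambda>h. if h = Bl then Skip else (Push (X 4) (h = One) ;; Push (X 0) True)"
  have "run (?K (head [])) ((s(X 0 := []))(X 1 := scodes (tl []))) 1 (s(X 0 := [], X 1 := []))"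
    using run_Skip by (simp add: head_def)
  then have "run (pop_sym (X 1) ?K) (s(X 0 := [])) (1 + 2) (s(X 0 := [], X 1 := []))"
    by (rule run_pop_sym[rotated]) (use Nil in simp)
  then have 1: "run (if True then pop_sym (X 1) ?K else Skip) (s(X 0 := [])) (1 + 2) (s(X 0 := [], X 1 := []))" by simp
  have 2: "run read_off (s(X 0 := [], X 1 := [])) 1 (s(X 0 := [], X 1 := []))"
    unfolding read_off_def by (rule run_LoopE) simp
  have "run read_off s (8 * length [] + 8) (s(X 0 := [], X 1 := scodes [], X 4 := rev (readout []) @ s (X 4)))"
    unfolding read_off_def
    by (rule run_weaken[OF run_LoopC[OF Nil(1) 1 2[unfolded read_off_def]]]) (auto simp: readout_def)
  then show ?case by blast
next
  case (Cons h R)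
  let ?K = "\<lambda>h. if h = Bl then Skip else (Push (X 4) (h = One) ;; Push (X 0) True)"
  show ?case
  proof (cases "h = Bl")
    case True
    let ?s = "s(X 0 := [], X 1 := scodes R)"
    have "run (?K (head (h # R))) ((s(X 0 := []))(X 1 := scodes (tl (h # R)))) 1 ?s"
      using run_Skip True by (simp add: head_def)
    then have "run (pop_sym (X 1) ?K) (s(X 0 := [])) (1 + 2) ?s"
      by (rule run_pop_sym[rotated]) (use Cons.prems in simp)
    then have 1: "run (if True then pop_sym (X 1) ?K else Skip) (s(X 0 := [])) (1 + 2) ?s" by simp
    have 2: "run read_off ?s 1 ?s" unfolding read_off_def by (rule run_LoopE) simp
    have "run read_off s (8 * length (h # R) + 8) (s(X 0 := [], X 1 := scodes R, X 4 := rev (readout (h # R)) @ s (X 4)))"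
      unfolding read_off_def
      by (rule run_weaken[OF run_LoopC[OF Cons.prems(1) 1 2[unfolded read_off_def]]]) (auto simp: readout_def True)
    then show ?thesis by (intro exI[of _ R] conjI) (assumption, simp)
  next
    case False
    let ?s = "s(X 1 := scodes R, X 4 := (h = One) # s (X 4), X 0 := [True])"
    have "run (Push (X 4) (h = One) ;; Push (X 0) True) ((s(X 0 := []))(X 1 := scodes R)) 3 ?s"
      by (rule run_weaken[OF run_Seq[OF run_Push run_Push]]) auto
    then have "run (?K (head (h # R))) ((s(X 0 := []))(X 1 := scodes (tl (h # R)))) 3 ?s"
      using False by (simp add: head_def)
    then have "run (pop_sym (X 1) ?K) (s(X 0 := [])) (3 + 2) ?s"
      by (rule run_pop_sym[rotated]) (use Cons.prems in simp)
    then have 1: "run (if True then pop_sym (X 1) ?K else Skip) (s(X 0 := [])) (3 + 2) ?s" by simp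
    have a: "?s (X 0) = [True]" "?s (X 1) = scodes R" by simp_all
    obtain R' where 2: "run read_off ?s (8 * length R + 8) (?s(X 0 := [], X 1 := scodes R', X 4 := rev (readout R) @ ?s (X 4)))"
      and R': "length R' \<le> length R"
      using Cons.IH[OF a] by blast
    have "run read_off s (8 * length (h # R) + 8) (s(X 0 := [], X 1 := scodes R', X 4 := rev (readout (h # R)) @ s (X 4)))"
      unfolding read_off_def
      by (rule run_weaken[OF run_LoopC[OF Cons.prems(1) 1 2[unfolded read_off_def]]]) (use False in \<open>auto simp: readout_def\<close>)
    moreover have "length R' \<le> length (h # R)" using R' by simp
    ultimately show ?thesis by blast
  qed
qed

definition input_store :: "bool list \<Rightarrow> store" where
  "input_store y = (\<lambda>_. [])(V 1 := y)"

definition simulate :: "tm \<Rightarrow> com" where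
  "simulate M = load ;; Push (X 0) True ;; Loop (X 0) Skip (dispatch M) ;; Push (X 0) True ;; read_off ;;
     drain (X 1) ;; drain (X 2) ;; drain (X 3) ;; move_to (X 4) (V 1)"

lemma run_simulate:
  assumes wf: "wf_tm M"
  shows "\<exists>C. \<forall>x t. halted M ((tm_step M ^^ t) (tm_init x)) \<longrightarrow>
    run (simulate M) (init_store x) (C * (length x + t + 1)) (input_store (tm_output ((tm_step M ^^ t) (tm_init x))))"
proof (intro exI allI impI)
  fix x t
  assume h: "halted M ((tm_step M ^^ t) (tm_init x))"
  let ?B = "state_bound M"
  let ?R = "map bit_sym x"
  obtain q l h r where ti: "tm_init x = (q, l, h, r)" by (cases "tm_init x")
  then have i: "q = 0" "l = []" "view ?R = h # r"
    by (auto simp: tm_init_def view_def split: list.splits)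
  obtain q' l' R' u where
    3: "run (Loop (X 0) Skip (dispatch M)) (sim_store 0 [] ?R [True]) ((t + 1) * (2 * ?B + length M + 30)) (sim_store u l' R' [])"
    and e: "(tm_step M ^^ t) (0, [], h, r) = (q', l', hd (view R'), tl (view R'))"
    and u: "u \<le> ?B" and l': "length l' \<le> t" and R': "length R' \<le> max 1 (length x) + t"
    using run_sim_loop[OF wf i(3), of t 0 "[]"] \<open>halted M _\<close> ti i by auto
  define y where "y = tm_output ((tm_step M ^^ t) (tm_init x))"
  have y: "y = readout R'"
    using e ti i by (cases R') (auto simp: y_def tm_output_def readout_def view_def)
  have yl: "length y \<le> length R'"
    unfolding y readout_def using length_takeWhile_le[of "\<lambda>s. s \<noteq> Bl" R'] by simp
  let ?s4 = "sim_store u l' R' [True]"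
  have 2: "run (Push (X 0) True) (sim_store 0 [] ?R []) 1 (sim_store 0 [] ?R [True])"
    by (rule run_weaken[OF run_Push]) (auto simp: sim_store_def)
  have 4: "run (Push (X 0) True) (sim_store u l' R' []) 1 ?s4"
    by (rule run_weaken[OF run_Push]) (auto simp: sim_store_def)
  have "?s4 (X 0) = [True]" "?s4 (X 1) = scodes R'" by (auto simp: sim_store_def)
  from run_read_off[OF this] obtain R2 where
    5: "run read_off ?s4 (8 * length R' + 8) (?s4(X 0 := [], X 1 := scodes R2, X 4 := rev (readout R') @ ?s4 (X 4)))"
    and R2: "length R2 \<le> length R'" by blast
  let ?s5 = "?s4(X 0 := [], X 1 := scodes R2, X 4 := rev (readout R') @ ?s4 (X 4))"
  let ?s6 = "?s5(X 1 := [])"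
  let ?s7 = "?s6(X 2 := [])"
  let ?s8 = "?s7(X 3 := [])"
  have 6: "run (drain (X 1)) ?s5 (2 * length (?s5 (X 1)) + 1) ?s6" by (rule run_drain)
  have 7: "run (drain (X 2)) ?s6 (2 * length (?s6 (X 2)) + 1) ?s7" by (rule run_drain)
  have 8: "run (drain (X 3)) ?s7 (2 * length (?s7 (X 3)) + 1) ?s8" by (rule run_drain)
  have 9: "run (move_to (X 4) (V 1)) ?s8 (2 * length (?s8 (X 4)) + 1) (?s8(X 4 := [], V 1 := rev (?s8 (X 4)) @ ?s8 (V 1)))"
    by (rule run_move_to) simp
  have R2l: "length (scodes R2) \<le> 2 * length R'" using length_scodes[of R2] R2 by linarith
  have l'l: "length (scodes l') \<le> 2 * t" using length_scodes[of l'] l' by linarith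
  have "Suc (6 * length x + 1 + Suc (1 + Suc ((t + 1) * (2 * ?B + length M + 30) + Suc (1 + Suc (8 * length R' + 8 +
     Suc (2 * length (?s5 (X 1)) + 1 + Suc (2 * length (?s6 (X 2)) + 1 + Suc (2 * length (?s7 (X 3)) + 1 + (2 * length (?s8 (X 4)) + 1)))))))))
     \<le> 6 * length x + (t + 1) * (2 * ?B + length M + 30) + 14 * length R' + 4 * t + 2 * ?B + 50"
    using R2l l'l u yl by (simp add: sim_store_def y)
  also have "\<dots> \<le> (4 * ?B + length M + 150) * (length x + t + 1)"
    using R' by (simp add: algebra_simps max_def split: if_splits)
  finally have c: "Suc (6 * length x + 1 + Suc (1 + Suc ((t + 1) * (2 * ?B + length M + 30) + Suc (1 + Suc (8 * length R' + 8 +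
     Suc (2 * length (?s5 (X 1)) + 1 + Suc (2 * length (?s6 (X 2)) + 1 + Suc (2 * length (?s7 (X 3)) + 1 + (2 * length (?s8 (X 4)) + 1)))))))))
     \<le> (4 * ?B + length M + 150) * (length x + t + 1)" .
  show "run (simulate M) (init_store x) ((4 * ?B + length M + 150) * (length x + t + 1)) (input_store (tm_output ((tm_step M ^^ t) (tm_init x))))"
    unfolding simulate_def y_def[symmetric]
    by (rule run_weaken[OF run_Seq[OF run_load run_Seq[OF 2 run_Seq[OF 3 run_Seq[OF 4 run_Seq[OF 5 run_Seq[OF 6
        run_Seq[OF 7 run_Seq[OF 8 9]]]]]]]] c], rule ext) (simp add: sim_store_def input_store_def y)
qed

section \<open>Recognition of sequences of self-delimiting numbers\<close>

text \<open>Reads the digit pairs of an encoded sequence. The stack st holds the previous digit of the current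
  number, if any. The counter n records the violations: numbers whose last digit is False (not canonical), the
  pair 10, and a dangling bit.\<close>
fun vrun :: "bool list \<Rightarrow> nat \<Rightarrow> bool list \<Rightarrow> bool list \<times> nat" where
  "vrun st n [] = (st, n)"
| "vrun st n [b] = (st, Suc n)"
| "vrun st n (b # c # ys) = (if b = c then vrun [b] n ys
     else if c then vrun [] (if st = [False] then Suc n else n) ys
     else vrun st (Suc n) ys)"

lemma vrun_mono: "n \<le> snd (vrun st n ys)"
  by (induction st n ys rule: vrun.induct) (auto split: if_splits)

lemma vrun_dbl:
  assumes "ds = [] \<longrightarrow> st \<noteq> [False]" "ds \<noteq> [] \<longrightarrow> last ds"
  shows "vrun st n (dbl ds @ False # True # rest) = vrun [] n rest"
  using assms by (induction ds arbitrary: st) (auto split: if_splits)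

lemma last_bits: "n \<noteq> 0 \<Longrightarrow> last (bits n)"
proof (induction n rule: bits.induct)
  case (1 n)
  show ?case
  proof (cases "n div 2 = 0")
    case True
    then have "n = 1" using 1(2) by auto
    then show ?thesis by (simp add: bits_Cons)
  next
    case False
    then show ?thesis using 1 by (simp add: bits_Cons)
  qed
qed

lemma vrun_encs: "vrun [] n (encs xs) = ([], n)"
proof (induction xs)
  case (Cons x xs)
  show ?case using Cons vrun_dbl[of "bits x" "[]" n "encs xs"] last_bits[of x] by (simp add: enc_nat_dbl)
qed simp

lemma bits_val_canonical: "ds = [] \<or> last ds \<Longrightarrow> bits (val ds) = ds"
  by (cases ds rule: rev_cases) (auto simp: bits_val)

text \<open>Generalised over st: a nonempty st means that a number has been begun, whose end the
  remaining word must supply. The condition on \<open>[False]\<close> excludes a zero as most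
  significant digit when no further digit follows.\<close>

lemma vrun_sound:
  "vrun st n ys = ([], 0) \<Longrightarrow> st = [] \<and> ys = [] \<or>
    (\<exists>ds xs. ys = dbl ds @ False # True # encs xs \<and> (ds = [] \<longrightarrow> st \<noteq> [False]) \<and> (ds \<noteq> [] \<longrightarrow> last ds))"
proof (induction st n ys rule: vrun.induct)
  case (3 st n b c ys)
  show ?case
  proof (cases "b = c")
    case True
    then obtain ds xs where d: "ys = dbl ds @ False # True # encs xs" "ds = [] \<longrightarrow> [b] \<noteq> [False]" "ds \<noteq> [] \<longrightarrow> last ds"
      using 3 by auto
    then have "b # c # ys = dbl (b # ds) @ False # True # encs xs" "last (b # ds)" using True by auto
    then show ?thesis by blast
  next
    case False
    show ?thesis
    proof (cases c)
      case c: True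
      then have e: "vrun [] (if st = [False] then Suc n else n) ys = ([], 0)" using 3(4) False by simp
      \<comment> \<open>A violation would make the counter positive, and it never decreases.\<close>
      then have st: "st \<noteq> [False]" using vrun_mono[of "Suc n" "[]" ys] by (auto split: if_splits)
      have "ys = [] \<or> (\<exists>ds xs. ys = dbl ds @ False # True # encs xs \<and> (ds \<noteq> [] \<longrightarrow> last ds))"
        using 3(2)[OF False c e] by blast
      then obtain xs where "ys = encs xs"
      proof
        assume "\<exists>ds xs. ys = dbl ds @ False # True # encs xs \<and> (ds \<noteq> [] \<longrightarrow> last ds)"
        then obtain ds xs where d: "ys = dbl ds @ False # True # encs xs" "ds \<noteq> [] \<longrightarrow> last ds" by blast
        then have "ys = encs (val ds # xs)" using bits_val_canonical[of ds] by (auto simp: enc_nat_dbl)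
        then show ?thesis using that by blast
      qed (use that[of "[]"] in simp)
      then have "b # c # ys = dbl [] @ False # True # encs xs" using False c by simp
      then show ?thesis using st by blast
    next
      case c: False
      then have "vrun st (Suc n) ys = ([], 0)" using 3(4) False by simp
      then show ?thesis using vrun_mono[of "Suc n" st ys] by simp
    qed
  qed
qed auto

lemma vrun_iff: "vrun [] 0 ys = ([], 0) \<longleftrightarrow> ys \<in> range encs"
proof
  assume "vrun [] 0 ys = ([], 0)"
  from vrun_sound[OF this] show "ys \<in> range encs"
  proof
    assume "\<exists>ds xs. ys = dbl ds @ False # True # encs xs \<and> (ds = [] \<longrightarrow> [] \<noteq> [False]) \<and> (ds \<noteq> [] \<longrightarrow> last ds)"
    then obtain ds xs where "ys = dbl ds @ False # True # encs xs" "ds \<noteq> [] \<longrightarrow> last ds" by blast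
    then have "ys = encs (val ds # xs)" using bits_val_canonical[of ds] by (auto simp: enc_nat_dbl)
    then show ?thesis by blast
  qed (metis encs_simps(1) rangeI)
qed (auto simp: vrun_encs)

definition vact :: "bool \<Rightarrow> bool \<Rightarrow> com" where
  "vact b c = (if b = c then Case (X 2) Skip Skip Skip ;; Push (X 2) b
     else if c then Case (X 2) Skip (Push (X 3) True) Skip else Push (X 3) True)"

text \<open>Each bit read is also saved on \<open>X 1\<close>, from which the word is restored after
  the check.\<close>

definition vbody :: "bool \<Rightarrow> com" where
  "vbody b = Push (X 1) b ;; Case (V 1) (Push (X 3) True) (Push (X 1) False ;; vact b False) (Push (X 1) True ;; vact b True)"

definition vstore :: "bool list \<Rightarrow> bool list \<Rightarrow> bool list \<Rightarrow> nat \<Rightarrow> store" where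
  "vstore ys zs st n = (\<lambda>_. [])(V 1 := ys, X 1 := zs, X 2 := st, X 3 := replicate n True)"

lemma run_clear2:
  assumes "length st \<le> 1"
  shows "run (Case (X 2) Skip Skip Skip) (vstore ys zs st n) 2 (vstore ys zs [] n)"
proof (cases st)
  case Nil
  show ?thesis by (rule run_weaken[OF run_CaseE[OF _ run_Skip]]) (auto simp: Nil vstore_def)
next
  case (Cons b bs)
  have "run (if b then Skip else Skip) ((vstore ys zs st n)(X 2 := [])) 1 (vstore ys zs [] n)"
    using run_Skip by (simp add: vstore_def fun_upd_twist)
  then show ?thesis
    by (rule run_weaken[OF run_CaseC[rotated]]) (use Cons assms in \<open>auto simp: vstore_def\<close>)
qed

lemma run_validate_loop:
  assumes "length st \<le> 1"
  shows "run (Loop (V 1) (vbody False) (vbody True)) (vstore ys zs st n) (8 * length ys + 1)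
    (vstore [] (rev ys @ zs) (fst (vrun st n ys)) (snd (vrun st n ys)))"
  using assms
proof (induction st n ys arbitrary: zs rule: vrun.induct)
  case (1 st n)
  show ?case by (rule run_weaken[OF run_LoopE]) (auto simp: vstore_def)
next
  case (2 st n b)
  have p: "run (Push (X 1) b) (vstore [] zs st n) 1 (vstore [] (b # zs) st n)"
    by (rule run_weaken[OF run_Push]) (auto simp: vstore_def)
  have q: "run (Push (X 3) True) (vstore [] (b # zs) st n) 1 (vstore [] (b # zs) st (Suc n))"
    by (rule run_weaken[OF run_Push]) (auto simp: vstore_def)
  have z: "vstore [] (b # zs) st n (V 1) = []" by (simp add: vstore_def)
  have "run (vbody b) (vstore [] zs st n) (Suc (1 + Suc 1)) (vstore [] (b # zs) st (Suc n))"
    unfolding vbody_def by (rule run_Seq[OF p run_CaseE[OF z q]])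
  then have 1: "run (if b then vbody True else vbody False) ((vstore [b] zs st n)(V 1 := [])) (Suc (1 + Suc 1)) (vstore [] (b # zs) st (Suc n))"
    by (cases b) (simp_all add: vstore_def fun_upd_twist)
  have 2: "run (Loop (V 1) (vbody False) (vbody True)) (vstore [] (b # zs) st (Suc n)) 1 (vstore [] (b # zs) st (Suc n))"
    by (rule run_LoopE) (simp add: vstore_def)
  have 3: "vstore [b] zs st n (V 1) = b # []" by (simp add: vstore_def)
  show ?case by (rule run_weaken[OF run_LoopC[OF 3 1 2]]) auto
next
  case (3 st n b c ys)
  define st' where "st' = (if b = c then [b] else if c then [] else st)"
  define n' where "n' = (if b = c then n else if c then (if st = [False] then Suc n else n) else Suc n)"
  have vr: "vrun st n (b # c # ys) = vrun st' n' ys" by (simp add: st'_def n'_def)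
  have l': "length st' \<le> 1" using 3(4) by (simp add: st'_def)
  have "run (vact b c) (vstore ys (c # b # zs) st n) 4 (vstore ys (c # b # zs) st' n')"
  proof (cases "b = c")
    case True
    have a: "run (Push (X 2) b) (vstore ys (c # b # zs) [] n) 1 (vstore ys (c # b # zs) [b] n)"
      by (rule run_weaken[OF run_Push]) (auto simp: vstore_def)
    show ?thesis unfolding vact_def using True
      by (auto simp: st'_def n'_def intro!: run_weaken[OF run_Seq[OF run_clear2[OF 3(4)] a[unfolded True]]])
  next
    case False
    show ?thesis
    proof (cases c)
      case c: True
      have w: "run (Push (X 3) True) (vstore ys (c # b # zs) [] n) 1 (vstore ys (c # b # zs) [] (Suc n))"
        by (rule run_weaken[OF run_Push]) (auto simp: vstore_def)
      have "run (Case (X 2) Skip (Push (X 3) True) Skip) (vstore ys (c # b # zs) st n) 4 (vstore ys (c # b # zs) [] n')"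
      proof (cases st)
        case Nil
        show ?thesis by (rule run_weaken[OF run_CaseE[OF _ run_Skip]]) (use Nil False c in \<open>auto simp: vstore_def n'_def\<close>)
      next
        case (Cons d ds)
        then have d: "st = [d]" using 3(4) by simp
        have "run (if d then Skip else Push (X 3) True) ((vstore ys (c # b # zs) st n)(X 2 := [])) 1 (vstore ys (c # b # zs) [] n')"
          using w run_Skip False c d by (cases d) (auto simp: vstore_def fun_upd_twist n'_def)
        then show ?thesis
          by (rule run_weaken[OF run_CaseC[rotated]]) (use d in \<open>auto simp: vstore_def\<close>)
      qed
      then show ?thesis using False c by (simp add: vact_def st'_def)
    next
      case c: False
      have "run (Push (X 3) True) (vstore ys (c # b # zs) st n) 4 (vstore ys (c # b # zs) st' n')"
        by (rule run_weaken[OF run_Push]) (use False c in \<open>auto simp: vstore_def n'_def st'_def\<close>)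
      then show ?thesis using False c by (simp add: vact_def)
    qed
  qed
  moreover have "run (Push (X 1) c) (vstore ys (b # zs) st n) 1 (vstore ys (c # b # zs) st n)"
    by (rule run_weaken[OF run_Push]) (auto simp: vstore_def)
  ultimately have "run (Push (X 1) c ;; vact b c) (vstore ys (b # zs) st n) (Suc (1 + 4)) (vstore ys (c # b # zs) st' n')"
    by (rule_tac run_Seq)
  then have w: "run (if c then Push (X 1) True ;; vact b True else Push (X 1) False ;; vact b False)
      ((vstore (c # ys) (b # zs) st n)(V 1 := ys)) 6 (vstore ys (c # b # zs) st' n')"
    by (cases c) (simp_all add: vstore_def fun_upd_twist)
  have z: "vstore (c # ys) (b # zs) st n (V 1) = c # ys" by (simp add: vstore_def)
  have p: "run (Push (X 1) b) (vstore (c # ys) zs st n) 1 (vstore (c # ys) (b # zs) st n)"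
    by (rule run_weaken[OF run_Push]) (auto simp: vstore_def)
  have "run (vbody b) (vstore (c # ys) zs st n) (Suc (1 + Suc 6)) (vstore ys (c # b # zs) st' n')"
    unfolding vbody_def by (rule run_Seq[OF p run_CaseC[OF z w]])
  then have 1: "run (if b then vbody True else vbody False) ((vstore (b # c # ys) zs st n)(V 1 := c # ys)) (Suc (1 + Suc 6)) (vstore ys (c # b # zs) st' n')"
    by (cases b) (simp_all add: vstore_def fun_upd_twist)
  have 2: "run (Loop (V 1) (vbody False) (vbody True)) (vstore ys (c # b # zs) st' n') (8 * length ys + 1)
    (vstore [] (rev ys @ c # b # zs) (fst (vrun st' n' ys)) (snd (vrun st' n' ys)))"
    using 3(1-3)[of "c # b # zs"] l' by (auto simp: st'_def n'_def split: if_splits)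
  have 0: "vstore (b # c # ys) zs st n (V 1) = b # c # ys" by (simp add: vstore_def)
  show ?case unfolding vr by (rule run_weaken[OF run_LoopC[OF 0 1 2]]) simp_all
qed

definition validate :: com where
  "validate = Loop (V 1) (vbody False) (vbody True) ;;
     Case (X 2) Skip (Push (X 3) True) (Push (X 3) True) ;; move_to (X 1) (V 1) ;;
     Case (X 3) Skip Skip (drain (X 3) ;; drain (V 1))"

text \<open>Words that are no sequence of encoded numbers decode to the empty list, which the reduction
  rejects like any other malformed instance.\<close>
definition decode :: "bool list \<Rightarrow> nat list" where
  "decode y = (if \<exists>xs. y = encs xs then SOME xs. y = encs xs else [])"

lemma snd_vrun_le: "snd (vrun st n ys) \<le> n + length ys"
  by (induction st n ys rule: vrun.induct) auto

lemma length_fst_vrun: "length st \<le> 1 \<Longrightarrow> length (fst (vrun st n ys)) \<le> 1"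
  by (induction st n ys rule: vrun.induct) (auto split: if_splits)

lemma encs_decode: "encs (decode y) = (if y \<in> range encs then y else [])"
proof (cases "\<exists>xs. y = encs xs")
  case True
  then have "y = encs (SOME xs. y = encs xs)" by (rule someI_ex)
  then show ?thesis using True by (auto simp: decode_def)
qed (auto simp: decode_def)

lemma run_validate:
  "run validate (input_store y) (20 * length y + 20) (input_store (encs (decode y)))"
proof -
  obtain st n where vr: "vrun [] 0 y = (st, n)" by (cases "vrun [] 0 y")
  have st: "length st \<le> 1" and n: "n \<le> length y"
    using length_fst_vrun[of "[]" 0 y] snd_vrun_le[of "[]" 0 y] vr by auto
  have "vstore y [] [] 0 = input_store y" by (auto simp: vstore_def input_store_def)
  then have 1: "run (Loop (V 1) (vbody False) (vbody True)) (input_store y) (8 * length y + 1) (vstore [] (rev y) st n)"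
    using run_validate_loop[of "[]" y "[]" 0] vr by simp
  define n' where "n' = (if st = [] then n else Suc n)"
  have 2: "run (Case (X 2) Skip (Push (X 3) True) (Push (X 3) True)) (vstore [] (rev y) st n) 2 (vstore [] (rev y) [] n')"
  proof (cases st)
    case Nil
    show ?thesis by (rule run_weaken[OF run_CaseE[OF _ run_Skip]]) (use Nil in \<open>auto simp: vstore_def n'_def\<close>)
  next
    case (Cons b bs)
    then have b: "st = [b]" using st by simp
    have "run (Push (X 3) True) ((vstore [] (rev y) st n)(X 2 := [])) 1 (vstore [] (rev y) [] n')"
      by (rule run_weaken[OF run_Push]) (use Cons in \<open>auto simp: vstore_def n'_def\<close>)
    then have "run (if b then Push (X 3) True else Push (X 3) True) ((vstore [] (rev y) st n)(X 2 := [])) 1 (vstore [] (rev y) [] n')"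
      by simp
    then show ?thesis by (rule run_weaken[OF run_CaseC[rotated]]) (use b in \<open>auto simp: vstore_def\<close>)
  qed
  have 3: "run (move_to (X 1) (V 1)) (vstore [] (rev y) [] n') (2 * length y + 1) (vstore y [] [] n')"
    by (rule run_weaken[OF run_move_to]) (auto simp: vstore_def)
  have valid: "n' = 0 \<longleftrightarrow> y \<in> range encs" using vrun_iff[of y] vr by (auto simp: n'_def)
  have 4: "run (Case (X 3) Skip Skip (drain (X 3) ;; drain (V 1))) (vstore y [] [] n') (4 * length y + 10) (input_store (encs (decode y)))"
  proof (cases n')
    case 0
    then show ?thesis
      by (intro run_weaken[OF run_CaseE[OF _ run_Skip]]) (use valid in \<open>auto simp: encs_decode vstore_def input_store_def\<close>)
  next
    case (Suc i)
    let ?s1 = "(vstore y [] [] n')(X 3 := replicate i True)"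
    let ?s2 = "?s1(X 3 := [])"
    have a: "run (drain (X 3)) ?s1 (2 * length (?s1 (X 3)) + 1) ?s2" by (rule run_drain)
    have b: "run (drain (V 1)) ?s2 (2 * length (?s2 (V 1)) + 1) (?s2(V 1 := []))" by (rule run_drain)
    have "i \<le> length y" using Suc n by (simp add: n'_def split: if_splits)
    then have "run (drain (X 3) ;; drain (V 1)) ?s1 (4 * length y + 5) (?s2(V 1 := []))"
      by (intro run_weaken[OF run_Seq[OF a b]]) (auto simp: vstore_def)
    then have c: "run (if True then drain (X 3) ;; drain (V 1) else Skip) ?s1 (4 * length y + 5) (?s2(V 1 := []))" by simp
    have z: "vstore y [] [] n' (X 3) = True # replicate i True" using Suc by (simp add: vstore_def)
    show ?thesis
      by (rule run_weaken[OF run_CaseC[OF z c]]) (use valid Suc in \<open>auto simp: encs_decode vstore_def input_store_def\<close>)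
  qed
  show ?thesis unfolding validate_def
    by (rule run_weaken[OF run_Seq[OF 1 run_Seq[OF 2 run_Seq[OF 3 4]]]]) auto
qed

definition input_env :: "nat list \<Rightarrow> env" where
  "input_env xs = (\<lambda>_. [])(1 := xs)"

lemma embed_input_env: "embed (input_env xs) = input_store (encs xs)"
  by (rule ext) (auto simp: input_env_def input_store_def embed_def split: reg.split)

text \<open>Number programs have a meaning only on encoded lists, while M may write any word; hence
  validation stands between the two. M' and the factor are fixed before x, the running times and Z,
  so they are uniform over all inputs.\<close>

theorem pipeline:
  assumes wf: "wf_tm M"
  shows "\<exists>M' a. wf_tm M' \<and> (\<forall>x t u Z s'. halted M ((tm_step M ^^ t) (tm_init x)) \<longrightarrow>
    bs Z p (input_env (decode (tm_output ((tm_step M ^^ t) (tm_init x))))) u s' \<longrightarrow>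
    (\<exists>n \<le> a * (length x + t + u * (lb Z + 1) ^ 2 + 1) ^ 2. halted M' ((tm_step M' ^^ n) (tm_init x))
       \<and> tm_output ((tm_step M' ^^ n) (tm_init x)) = encs (s' 2)))"
proof -
  let ?c = "simulate M ;; validate ;; cprog p ;; move_to (V 2) Tp"
  obtain C where C: "\<And>x t. halted M ((tm_step M ^^ t) (tm_init x)) \<Longrightarrow>
    run (simulate M) (init_store x) (C * (length x + t + 1)) (input_store (tm_output ((tm_step M ^^ t) (tm_init x))))"
    using run_simulate[OF wf] by blast
  obtain M' a where wf': "wf_tm M'" and M': "\<And>x t s'. ex ?c (init_store x) t s' \<Longrightarrow> \<exists>n \<le> a * (length x + t + 1)^2.
      halted M' ((tm_step M' ^^ n) (tm_init x)) \<and> tm_output ((tm_step M' ^^ n) (tm_init x)) = rev (s' Tp)"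
    using compile[of ?c] by blast
  define D where "D = 100 * (C + pcost p + 2)"
  have "\<exists>n \<le> a * (D + 1) ^ 2 * (length x + t + u * (lb Z + 1) ^ 2 + 1) ^ 2. halted M' ((tm_step M' ^^ n) (tm_init x))
       \<and> tm_output ((tm_step M' ^^ n) (tm_init x)) = encs (s' 2)"
    if h: "halted M ((tm_step M ^^ t) (tm_init x))"
      and b: "bs Z p (input_env (decode (tm_output ((tm_step M ^^ t) (tm_init x))))) u s'" for x t u Z s'
  proof -
    define y where "y = tm_output ((tm_step M ^^ t) (tm_init x))"
    define m where "m = length x + t + 1"
    define w where "w = u * (lb Z + 1) ^ 2"
    have 1: "run (simulate M) (init_store x) (C * m) (input_store y)" using C[OF h] by (simp add: y_def m_def)
    have ly: "length y \<le> C * m" using run_length[OF 1, of "V 1"] by (simp add: input_store_def init_store_def)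
    have 2: "run validate (input_store y) (20 * (C * m) + 20) (input_store (encs (decode y)))"
      by (rule run_weaken[OF run_validate]) (use ly in auto)
    have 3: "run (cprog p) (input_store (encs (decode y))) (pcost p * w) (embed s')"
      using run_cprog[OF b] by (simp add: embed_input_env y_def w_def mult.assoc)
    have "length (encs (decode y)) \<le> C * m" using ly by (simp add: encs_decode)
    then have "length (encs (s' 2)) \<le> C * m + pcost p * w"
      using run_length[OF 3, of "V 2"] by (simp add: input_store_def)
    then have 4: "run (move_to (V 2) Tp) (embed s') (2 * (C * m + pcost p * w) + 1) ((embed s')(V 2 := [], Tp := rev (encs (s' 2))))"
      by (intro run_weaken[OF run_move_to]) auto
    have "run ?c (init_store x) (23 * (C * m) + 3 * (pcost p * w) + 24) ((embed s')(V 2 := [], Tp := rev (encs (s' 2))))"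
      by (rule run_weaken[OF run_Seq[OF 1 run_Seq[OF 2 run_Seq[OF 3 4]]]]) auto
    then obtain t' where t': "t' \<le> 23 * (C * m) + 3 * (pcost p * w) + 24"
      and e: "ex ?c (init_store x) t' ((embed s')(V 2 := [], Tp := rev (encs (s' 2))))" unfolding run_def by blast
    from M'[OF e] obtain n where n: "n \<le> a * (length x + t' + 1)^2" "halted M' ((tm_step M' ^^ n) (tm_init x))"
       "tm_output ((tm_step M' ^^ n) (tm_init x)) = encs (s' 2)" by auto
    have "24 \<le> 24 * m" by (simp add: m_def)
    then have "t' \<le> D * (m + w)" using t' by (simp add: D_def algebra_simps)
    then have "length x + t' + 1 \<le> (D + 1) * (m + w)" by (simp add: m_def algebra_simps)
    then have "(length x + t' + 1) ^ 2 \<le> ((D + 1) * (m + w)) ^ 2" by (rule power_mono) simp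
    then have "a * (length x + t' + 1) ^ 2 \<le> a * ((D + 1) * (m + w)) ^ 2" by (rule mult_le_mono2)
    also have "\<dots> = a * (D + 1) ^ 2 * (length x + t + u * (lb Z + 1) ^ 2 + 1) ^ 2"
    proof -
      have "m + w = length x + t + u * (lb Z + 1) ^ 2 + 1" by (simp add: m_def w_def)
      then show ?thesis by (simp only: power_mult_distrib mult.assoc)
    qed
    finally show ?thesis using n order_trans by blast
  qed
  then show ?thesis using wf' by blast
qed

section \<open>From subset sum to scheduling with rejection\<close>

text \<open>Induction by removing the job j that finishes last: all others end by its start, so its
  completion time is at least the sum of all sizes, and its term completes the square. The bound on
  the makespan is proved alongside because it is what the induction needs about the remaining
  jobs.\<close>

lemma makespan:
  fixes x S :: "nat \<Rightarrow> nat"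
  assumes "finite A" "\<And>i. i \<in> A \<Longrightarrow> 0 < x i"
    "\<And>i j. i \<in> A \<Longrightarrow> j \<in> A \<Longrightarrow> i \<noteq> j \<Longrightarrow> S i + x i \<le> S j \<or> S j + x j \<le> S i"
    "\<And>i. i \<in> A \<Longrightarrow> S i + x i \<le> b"
  shows "sum x A \<le> b \<and> (sum x A)\<^sup>2 + (\<Sum>i\<in>A. (x i)\<^sup>2) \<le> (\<Sum>i\<in>A. 2 * x i * (S i + x i))"
  using assms
proof (induction "card A" arbitrary: A b)
  case 0
  then show ?case by simp
next
  case (Suc c)
  have ne: "A \<noteq> {}" using Suc(2) by auto
  let ?f = "\<lambda>i. S i + x i"
  have "Max (?f ` A) \<in> ?f ` A" using Suc(3) ne by (intro Max_in) auto
  then obtain j where jA: "j \<in> A" and jm: "Max (?f ` A) = ?f j" by blast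
  have j: "j \<in> A" "\<And>i. i \<in> A \<Longrightarrow> S i + x i \<le> S j + x j"
    using jA Suc(3) Max_ge[of "?f ` A"] unfolding jm by auto
  let ?A = "A - {j}"
  \<comment> \<open>A job starting after the end of j would finish later than j, since its size is
    positive.\<close>
  have e: "S i + x i \<le> S j" if "i \<in> ?A" for i
    using Suc(5)[of i j] Suc(4)[of i] j that by fastforce
  have ih: "sum x ?A \<le> S j \<and> (sum x ?A)\<^sup>2 + (\<Sum>i\<in>?A. (x i)\<^sup>2) \<le> (\<Sum>i\<in>?A. 2 * x i * (S i + x i))"
    using Suc(2) j Suc.prems e by (intro Suc.hyps(1)) auto
  have s: "sum f A = f j + sum f ?A" for f :: "nat \<Rightarrow> nat"
    using Suc.prems(1) j(1) by (simp add: sum.remove)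
  have "sum x A \<le> b" using s[of x] ih Suc.prems(4)[OF j(1)] by simp
  moreover have "(sum x A)\<^sup>2 + (\<Sum>i\<in>A. (x i)\<^sup>2)
     = ((sum x ?A)\<^sup>2 + (\<Sum>i\<in>?A. (x i)\<^sup>2)) + 2 * x j * (sum x ?A + x j)"
    unfolding s by (simp add: power2_eq_square algebra_simps)
  moreover have "2 * x j * (sum x ?A + x j) \<le> 2 * x j * (S j + x j)" using ih by simp
  ultimately show ?case using ih unfolding s[of "\<lambda>i. 2 * x i * (S i + x i)"] by linarith
qed

text \<open>Processing in index order without idle time attains the bound of
  \<open>makespan\<close>; in the induction the largest index is the last job.\<close>

lemma sequential_cost:
  fixes x :: "nat \<Rightarrow> nat"
  assumes "finite A"
  shows "(\<Sum>j\<in>A. 2 * x j * (sum x {i \<in> A. i < j} + x j)) = (sum x A)\<^sup>2 + (\<Sum>i\<in>A. (x i)\<^sup>2)"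
  using assms
proof (induction rule: finite_linorder_max_induct)
  case (insert b A)
  have "{i \<in> insert b A. i < b} = A" using insert.hyps by auto
  moreover have "{i \<in> insert b A. i < j} = {i \<in> A. i < j}" if "j \<in> A" for j using insert.hyps that by auto
  moreover have "b \<notin> A" using insert.hyps by auto
  ultimately have "(\<Sum>j\<in>insert b A. 2 * x j * (sum x {i \<in> insert b A. i < j} + x j))
     = 2 * x b * (sum x A + x b) + (\<Sum>j\<in>A. 2 * x j * (sum x {i \<in> A. i < j} + x j))"
    using insert.hyps by simp
  then show ?case using insert \<open>b \<notin> A\<close> by (simp add: power2_eq_square algebra_simps)
qed simp

text \<open>Jobs of a constant ratio w/p can be sequenced in any order. With P and Q the sums of all sizes and
  of their squares, and X the size of the rejected set, the minimal cost is (P - X)^2 + Q + 2(P - T)X = (P^2 +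
  Q - T^2) + (X - T)^2 for D = P - T.\<close>
definition job_list :: "nat \<Rightarrow> nat list \<Rightarrow> (nat \<times> nat \<times> nat) list" where
  "job_list D its = map (\<lambda>x. (x, 2 * x, x * (x + 2 * D))) its"

lemma square_gap:
  fixes P T X Q :: nat
  assumes "X \<le> P" "T \<le> P"
  shows "(P - X)\<^sup>2 + Q + 2 * (P - T) * X \<le> P\<^sup>2 + Q - T\<^sup>2 \<longleftrightarrow> X = T"
proof -
  have t: "T\<^sup>2 \<le> P\<^sup>2 + Q" using assms by (simp add: power_mono trans_le_add1)
  have "int ((P - X)\<^sup>2 + Q + 2 * (P - T) * X) = int (P\<^sup>2 + Q - T\<^sup>2) + (int X - int T)\<^sup>2"
    using assms t by (simp add: of_nat_diff) (simp add: power2_eq_square algebra_simps)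
  then have "(P - X)\<^sup>2 + Q + 2 * (P - T) * X \<le> P\<^sup>2 + Q - T\<^sup>2 \<longleftrightarrow> (int X - int T)\<^sup>2 \<le> 0"
    by linarith
  then show ?thesis by auto
qed

text \<open>Distinctness lets sets of jobs correspond to sets of numbers of the same cardinality.
  For a fixed rejected set, \<open>makespan\<close> bounds all schedules from below and
  \<open>sequential_cost\<close> attains the bound; \<open>square_gap\<close> then turns the budget
  into an equation.\<close>

lemma rejection_iff_subset_sum:
  assumes d: "distinct its" and pos: "\<And>x. x \<in> set its \<Longrightarrow> 0 < x" and T: "T \<le> sum_list its"
  defines "P \<equiv> sum_list its" and "Q \<equiv> sum_list (map (\<lambda>x. x\<^sup>2) its)"
  defines "J \<equiv> job_list (P - T) its"
  shows "(\<exists>Rej S. feasible_sched J k Rej S \<and> sched_cost J Rej S \<le> P\<^sup>2 + Q - T\<^sup>2)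
     \<longleftrightarrow> (\<exists>Y \<subseteq> set its. card Y \<le> k \<and> \<Sum>Y = T)"
proof -
  define x where "x = (\<lambda>j. its ! j)"
  let ?I = "{..<length its}"
  have lJ: "length J = length its" by (simp add: J_def job_list_def)
  have J: "ptime J j = x j" "weight J j = 2 * x j" "rejcost J j = x j * (x j + 2 * (P - T))" if "j \<in> ?I" for j
    using that by (auto simp: ptime_def weight_def rejcost_def J_def job_list_def x_def)
  have PQ: "P = sum x ?I" "Q = (\<Sum>j\<in>?I. (x j)\<^sup>2)"
    by (auto simp: P_def Q_def x_def sum_list_sum_nth atLeast0LessThan)
  have xpos: "0 < x j" if "j \<in> ?I" for j using pos that by (simp add: x_def)
  have inj: "inj_on x ?I" using d by (simp add: x_def inj_on_nth)
  have img: "x ` ?I = set its" by (auto simp: x_def set_conv_nth)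
  have cost: "sched_cost J Rej S = (\<Sum>j\<in>?I - Rej. 2 * x j * (S j + x j)) + (\<Sum>j\<in>Rej. (x j)\<^sup>2) + 2 * (P - T) * sum x Rej"
    if "Rej \<subseteq> ?I" for Rej S
  proof -
    have "(\<Sum>j\<in>Rej. rejcost J j) = (\<Sum>j\<in>Rej. (x j)\<^sup>2 + 2 * (P - T) * x j)"
      using that J by (intro sum.cong) (auto simp: power2_eq_square algebra_simps)
    also have "\<dots> = (\<Sum>j\<in>Rej. (x j)\<^sup>2) + 2 * (P - T) * sum x Rej"
      by (simp add: sum.distrib sum_distrib_left)
    finally show ?thesis unfolding sched_cost_def lJ using J
      by (simp add: add.assoc) 
  qed
  have split: "sum x (?I - Rej) = P - sum x Rej" "sum x Rej \<le> P" "(\<Sum>j\<in>?I - Rej. (x j)\<^sup>2) + (\<Sum>j\<in>Rej. (x j)\<^sup>2) = Q"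
    if "Rej \<subseteq> ?I" for Rej
  proof -
    have f: "finite Rej" using that finite_subset by blast
    show "sum x (?I - Rej) = P - sum x Rej" unfolding PQ using that f by (simp add: sum_diff_nat)
    show "sum x Rej \<le> P" unfolding PQ using that by (intro sum_mono2) auto
    show "(\<Sum>j\<in>?I - Rej. (x j)\<^sup>2) + (\<Sum>j\<in>Rej. (x j)\<^sup>2) = Q" unfolding PQ using that
      by (simp add: sum.subset_diff[of Rej ?I] add.commute)
  qed
  show ?thesis
  proof
    assume "\<exists>Rej S. feasible_sched J k Rej S \<and> sched_cost J Rej S \<le> P\<^sup>2 + Q - T\<^sup>2"
    then obtain Rej S where f: "feasible_sched J k Rej S" and c: "sched_cost J Rej S \<le> P\<^sup>2 + Q - T\<^sup>2" by blast
    have R: "Rej \<subseteq> ?I" "card Rej \<le> k" using f by (auto simp: feasible_sched_def lJ)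
    let ?A = "?I - Rej"
    have "(sum x ?A)\<^sup>2 + (\<Sum>i\<in>?A. (x i)\<^sup>2) \<le> (\<Sum>i\<in>?A. 2 * x i * (S i + x i))"
    \<comment> \<open>\<open>makespan\<close> asks for a common bound on all completion times; their
      sum is one.\<close>
    proof (rule conjunct2[OF makespan[where b = "sum (\<lambda>i. S i + x i) ?A"]])
      show "S i + x i \<le> S j \<or> S j + x j \<le> S i" if "i \<in> ?A" "j \<in> ?A" "i \<noteq> j" for i j
        using f that J by (auto simp: feasible_sched_def lJ)
    qed (use xpos in \<open>auto intro: member_le_sum\<close>)
    then have "(P - sum x Rej)\<^sup>2 + Q + 2 * (P - T) * sum x Rej \<le> P\<^sup>2 + Q - T\<^sup>2"
      using c cost[OF R(1), of S] split[OF R(1)] by simp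
    then have "sum x Rej = T" using square_gap[OF split(2)[OF R(1)], of T Q] T by (simp add: P_def)
    moreover have i: "inj_on x Rej" using inj R(1) inj_on_subset by blast
    ultimately have "\<Sum>(x ` Rej) = T" "card (x ` Rej) \<le> k" "x ` Rej \<subseteq> set its"
      using R img by (auto simp: sum.reindex card_image)
    then show "\<exists>Y \<subseteq> set its. card Y \<le> k \<and> \<Sum>Y = T" by blast
  next
    assume "\<exists>Y \<subseteq> set its. card Y \<le> k \<and> \<Sum>Y = T"
    then obtain Y where Y: "Y \<subseteq> x ` ?I" "card Y \<le> k" "\<Sum>Y = T" using img by auto
    obtain Rej where R: "Rej \<subseteq> ?I" "Y = x ` Rej" using Y(1) by (auto simp: subset_image_iff)
    have i: "inj_on x Rej" using inj R(1) inj_on_subset by blast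
    have sR: "sum x Rej = T" "card Rej \<le> k" using Y R i by (auto simp: sum.reindex card_image)
    let ?A = "?I - Rej"
    define S where "S = (\<lambda>j. sum x {i \<in> ?A. i < j})"
    have mono: "S i + x i \<le> S j" if "i \<in> ?A" "j \<in> ?A" "i < j" for i j
    proof -
      have "S i + x i = sum x (insert i {l \<in> ?A. l < i})" by (simp add: S_def)
      also have "\<dots> \<le> S j" unfolding S_def using that by (intro sum_mono2) auto
      finally show ?thesis .
    qed
    have "S i + x i \<le> S j \<or> S j + x j \<le> S i" if "i \<in> ?A" "j \<in> ?A" "i \<noteq> j" for i j
      using mono[of i j] mono[of j i] that by (cases "i < j") auto
    then have "feasible_sched J k Rej S" using R sR J by (auto simp: feasible_sched_def lJ)
    moreover have "sched_cost J Rej S \<le> P\<^sup>2 + Q - T\<^sup>2"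
      using cost[OF R(1), of S] split[OF R(1)] sequential_cost[of ?A x] square_gap[OF split(2)[OF R(1)], of T Q] T sR
      by (simp add: S_def P_def)
    ultimately show "\<exists>Rej S. feasible_sched J k Rej S \<and> sched_cost J Rej S \<le> P\<^sup>2 + Q - T\<^sup>2" by blast
  qed
qed

section \<open>Digit sums without carries\<close>

lemma digit_sum_less:
  fixes a :: "nat \<Rightarrow> nat"
  shows "(\<And>q. q < m \<Longrightarrow> a q < B) \<Longrightarrow> (\<Sum>q<m. a q * B ^ q) < B ^ m"
proof (induction m)
  case (Suc m)
  have "Suc (a m) * B ^ m \<le> B * B ^ m" using Suc.prems[of m] by (intro mult_le_mono1) auto
  moreover have "(\<Sum>q<m. a q * B ^ q) < B ^ m" using Suc by simp
  ultimately show ?case by simp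
qed simp

lemma block_unique:
  fixes a b C r s :: nat
  assumes "a * C + r = b * C + s" "r < C" "s < C"
  shows "a = b \<and> r = s"
proof -
  have "(a * C + r) div C = a" "(b * C + s) div C = b" "(a * C + r) mod C = r" "(b * C + s) mod C = s"
    using assms(2,3) by auto
  then show ?thesis using assms(1) by metis
qed

lemma digit_sum_unique:
  fixes a b :: "nat \<Rightarrow> nat"
  assumes "\<And>q. q < m \<Longrightarrow> a q < B" "\<And>q. q < m \<Longrightarrow> b q < B" "(\<Sum>q<m. a q * B ^ q) = (\<Sum>q<m. b q * B ^ q)" "q < m"
  shows "a q = b q"
  using assms
proof (induction m)
  case (Suc m)
  have "a m * B ^ m + (\<Sum>q<m. a q * B ^ q) = b m * B ^ m + (\<Sum>q<m. b q * B ^ q)" using Suc.prems(3) by simp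
  moreover have "(\<Sum>q<m. a q * B ^ q) < B ^ m" "(\<Sum>q<m. b q * B ^ q) < B ^ m"
    using Suc.prems by (auto intro!: digit_sum_less)
  ultimately have "a m = b m" "(\<Sum>q<m. a q * B ^ q) = (\<Sum>q<m. b q * B ^ q)" using block_unique by blast+
  then show ?case using Suc by (cases "q = m") auto
qed simp

text \<open>The positions of the list are the digits to base B: the code of v has digit 1 where v occurs. As
  every position belongs to exactly one v, combinations of codes with coefficients below B have no carries and
  determine their coefficients.\<close>
definition code :: "nat \<Rightarrow> nat list \<Rightarrow> nat \<Rightarrow> nat" where
  "code B fl v = (\<Sum>q<length fl. of_bool (fl ! q = v) * B ^ q)"

text \<open>By exchanging the sums: position q belongs to the code of a single vertex, so the digit
  there is the coefficient of that vertex.\<close>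

lemma weighted_codes:
  "(\<Sum>v\<in>set fl. c v * code B fl v) = (\<Sum>q<length fl. c (fl ! q) * B ^ q)"
proof -
  have "(\<Sum>v\<in>set fl. c v * code B fl v) = (\<Sum>v\<in>set fl. \<Sum>q<length fl. c v * (of_bool (fl ! q = v) * B ^ q))"
    unfolding code_def sum_distrib_left ..
  also have "\<dots> = (\<Sum>q<length fl. \<Sum>v\<in>set fl. c v * (of_bool (fl ! q = v) * B ^ q))" by (rule sum.swap)
  also have "\<dots> = (\<Sum>q<length fl. c (fl ! q) * B ^ q)"
  proof (rule sum.cong[OF refl])
    fix q assume "q \<in> {..<length fl}"
    then have "fl ! q \<in> set fl" by simp
    have "(\<Sum>v\<in>set fl. c v * (of_bool (fl ! q = v) * B ^ q)) = (\<Sum>v\<in>set fl. if v = fl ! q then c (fl ! q) * B ^ q else 0)"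
      by (intro sum.cong) auto
    then show "(\<Sum>v\<in>set fl. c v * (of_bool (fl ! q = v) * B ^ q)) = c (fl ! q) * B ^ q"
      using \<open>fl ! q \<in> set fl\<close> by simp
  qed
  finally show ?thesis .
qed

lemma weighted_codes_less:
  "(\<And>v. v \<in> set fl \<Longrightarrow> c v < B) \<Longrightarrow> (\<Sum>v\<in>set fl. c v * code B fl v) < B ^ length fl"
  unfolding weighted_codes by (rule digit_sum_less) simp

lemma weighted_codes_unique:
  assumes "\<And>v. v \<in> set fl \<Longrightarrow> c v < B" "\<And>v. v \<in> set fl \<Longrightarrow> d v < B"
    "(\<Sum>v\<in>set fl. c v * code B fl v) = (\<Sum>v\<in>set fl. d v * code B fl v)" "v \<in> set fl"
  shows "c v = d v"
proof -
  obtain q where q: "q < length fl" "v = fl ! q" using assms(4) by (auto simp: in_set_conv_nth)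
  have "c (fl ! q) = d (fl ! q)"
    by (rule digit_sum_unique[where m = "length fl" and B = B and a = "\<lambda>q. c (fl ! q)" and b = "\<lambda>q. d (fl ! q)"])
      (use assms q in \<open>auto simp: weighted_codes\<close>)
  then show ?thesis using q by simp
qed

lemma code_as_weighted: "u \<in> set fl \<Longrightarrow> code B fl u = (\<Sum>v\<in>set fl. of_bool (v = u) * code B fl v)"
proof -
  assume "u \<in> set fl"
  have "(\<Sum>v\<in>set fl. of_bool (v = u) * code B fl v) = (\<Sum>v\<in>set fl. if v = u then code B fl u else 0)"
    by (intro sum.cong) auto
  then show ?thesis using \<open>u \<in> set fl\<close> by simp
qed

section \<open>From clique to subset sum\<close>

definition flat :: "(nat \<times> nat) list \<Rightarrow> nat list" where
  "flat E = concat (map (\<lambda>(u, v). [u, v]) E)"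

lemma flat_simps [simp]: "flat [] = []" "flat ((u, v) # E) = u # v # flat E"
  by (auto simp: flat_def)

lemma set_flat: "set (flat E) = fst ` set E \<union> snd ` set E"
proof (induction E)
  case (Cons e E)
  then show ?case by (cases e) (simp, blast)
qed simp

lemma length_flat: "length (flat E) = 2 * length E"
  by (induction E) auto

text \<open>A vertex item lacks (k - 1) h v to the multiple cap of all codes, and the k - 1 edge items at v
  supply exactly this if v is in the clique. Conversely a selection with sum k cap must contain k vertex
  items, and by comparing digits each selected vertex meets k - 1 selected edges while the others meet none.
  Isolated vertices have no code and are irrelevant since k is at least 2.\<close>
locale clique_instance =
  fixes n k :: nat and E :: "(nat \<times> nat) list"
  assumes k2: "2 \<le> k"
begin

text \<open>Larger than every coefficient to be compared: degrees are at most the number of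
  endpoints, and the combinations with vertex items have coefficients up to k.\<close>

definition base :: nat where "base = length (flat E) + k + 1"
definition cap :: nat where "cap = base ^ length (flat E)"
definition h :: "nat \<Rightarrow> nat" where "h = code base (flat E)"
definition vertex_item :: "nat \<Rightarrow> nat" where "vertex_item v = cap - (k - 1) * h v"
definition edge_item :: "nat \<times> nat \<Rightarrow> nat" where "edge_item e = h (fst e) + h (snd e)"
definition proper :: "nat \<Rightarrow> nat \<Rightarrow> bool" where
  "proper u v \<longleftrightarrow> u < n \<and> v < n \<and> u \<noteq> v \<and> ((u, v) \<in> set E \<or> (v, u) \<in> set E)"
text \<open>Edge lists may contain loops, endpoints beyond n, and repeated or reversed edges. Loops
  and edges beyond n contribute no edge item, and repetitions vanish in the set. Vertex items of
  endpoints beyond n are harmless: as k is at least 2, a selected vertex needs a selected proper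
  edge.\<close>

definition items :: "nat set" where
  "items = vertex_item ` set (flat E) \<union> edge_item ` {(u, v) \<in> set E. u < n \<and> v < n \<and> u \<noteq> v}"

abbreviation verts :: "nat set" where "verts \<equiv> set (flat E)"

lemma base3: "3 \<le> base"
  using k2 by (simp add: base_def)

lemma k_base: "k < base"
  by (simp add: base_def)

lemma card_verts: "card verts < base"
  using card_length[of "flat E"] by (simp add: base_def)

lemma proper_verts: "proper u v \<Longrightarrow> u \<in> verts \<and> v \<in> verts"
  by (force simp: proper_def set_flat)

lemma weighted_h_less: "(\<And>v. v \<in> verts \<Longrightarrow> c v < base) \<Longrightarrow> (\<Sum>v\<in>verts. c v * h v) < cap"
  unfolding h_def cap_def by (rule weighted_codes_less)

lemma weighted_h_unique:
  "(\<And>v. v \<in> verts \<Longrightarrow> c v < base) \<Longrightarrow> (\<And>v. v \<in> verts \<Longrightarrow> d v < base) \<Longrightarrow>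
    (\<Sum>v\<in>verts. c v * h v) = (\<Sum>v\<in>verts. d v * h v) \<Longrightarrow> v \<in> verts \<Longrightarrow> c v = d v"
  unfolding h_def by (rule weighted_codes_unique)

text \<open>Brings a single multiple into the form of a combination over all vertices, so that
  coefficients can be compared.\<close>

lemma multiple_h: "u \<in> verts \<Longrightarrow> a * h u = (\<Sum>v\<in>verts. (a * of_bool (v = u)) * h v)"
  using code_as_weighted[of u "flat E" base] by (simp only: h_def sum_distrib_left mult.assoc)

lemma multiple_h_less: "u \<in> verts \<Longrightarrow> a < base \<Longrightarrow> a * h u < cap"
  unfolding multiple_h by (rule weighted_h_less) (use base3 in auto)

lemma vertex_item_bound: "u \<in> verts \<Longrightarrow> (k - 1) * h u < cap"
  using k_base by (intro multiple_h_less) auto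

lemma vertex_item_eq: "u \<in> verts \<Longrightarrow> vertex_item u + (k - 1) * h u = cap"
  using vertex_item_bound[of u] by (simp add: vertex_item_def)

lemma vertex_item_pos: "u \<in> verts \<Longrightarrow> 0 < vertex_item u"
  using vertex_item_bound[of u] by (simp add: vertex_item_def)

lemma h_pos: "u \<in> verts \<Longrightarrow> 0 < h u"
proof (rule ccontr)
  assume u: "u \<in> verts" "\<not> 0 < h u"
  have "of_bool (u = u) = (0::nat)"
    using multiple_h[OF u(1), of 1] u base3
    by (intro weighted_h_unique[of "\<lambda>v. of_bool (v = u)" "\<lambda>v. 0" u]) auto
  then show False by simp
qed

lemma vertex_item_inj: "inj_on vertex_item verts"
proof (rule inj_onI)
  fix u v assume uv: "u \<in> verts" "v \<in> verts" "vertex_item u = vertex_item v"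
  then have e: "(k - 1) * h u = (k - 1) * h v" using vertex_item_eq[of u] vertex_item_eq[of v] by linarith
  have "(k - 1) * of_bool (u = u) = (k - 1) * of_bool (u = v)"
    using e k_base unfolding multiple_h[OF uv(1)] multiple_h[OF uv(2)]
    by (intro weighted_h_unique[of "\<lambda>w. (k - 1) * of_bool (w = u)" "\<lambda>w. (k - 1) * of_bool (w = v)" u]) (use uv in auto)
  then show "u = v" using k2 by (cases "u = v") auto
qed

lemma edge_weighted: "u \<in> verts \<Longrightarrow> v \<in> verts \<Longrightarrow> h u + h v = (\<Sum>w\<in>verts. (of_bool (w = u) + of_bool (w = v)) * h w)"
  using multiple_h[of u 1] multiple_h[of v 1] by (simp add: add_mult_distrib sum.distrib)

text \<open>The coefficient of a vertex in such a sum tells whether it is one of the two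
  endpoints.\<close>

lemma edge_item_eq:
  assumes "u \<in> verts" "v \<in> verts" "u' \<in> verts" "v' \<in> verts" "u \<noteq> v" "u' \<noteq> v'" "h u + h v = h u' + h v'"
  shows "{u, v} = {u', v'}"
proof -
  have "of_bool (w = u) + of_bool (w = v) = (of_bool (w = u') + of_bool (w = v') :: nat)" if "w \<in> verts" for w
    using assms(7) base3 that unfolding edge_weighted[OF assms(1,2)] edge_weighted[OF assms(3,4)]
    by (intro weighted_h_unique[of "\<lambda>w. of_bool (w = u) + of_bool (w = v)" "\<lambda>w. of_bool (w = u') + of_bool (w = v')"]) auto
  note e = this
  have "u = u' \<or> u = v'" by (rule ccontr) (use e[OF assms(1)] in simp)
  moreover have "v = u' \<or> v = v'" by (rule ccontr) (use e[OF assms(2)] in simp)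
  ultimately show ?thesis using assms(5) by auto
qed

text \<open>Equality would express \<open>cap\<close> as a combination of codes with coefficients at
  most k, but all such combinations are smaller than \<open>cap\<close>.\<close>

lemma vertex_item_neq_edge: 
  assumes "x \<in> verts" "u \<in> verts" "v \<in> verts" "u \<noteq> v"
  shows "vertex_item x \<noteq> h u + h v"
proof
  assume "vertex_item x = h u + h v"
  then have "cap = (h u + h v) + (k - 1) * h x" using vertex_item_eq[OF assms(1)] by simp
  also have "\<dots> = (\<Sum>w\<in>verts. (of_bool (w = u) + of_bool (w = v) + (k - 1) * of_bool (w = x)) * h w)"
    unfolding edge_weighted[OF assms(2,3)] multiple_h[OF assms(1)] by (simp add: add_mult_distrib sum.distrib)
  also have "\<dots> < cap"
    using assms(4) k_base base3 by (intro weighted_h_less) (auto simp: base_def)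
  finally show False by simp
qed

text \<open>D contains every edge in both orientations, and the first components of these two pairs
  are the two endpoints.\<close>

lemma edge_sum_symmetric:
  assumes fin: "finite D" and s: "sym D" and i: "irrefl D"
  shows "(\<Sum>(u, v)\<in>{(u, v) \<in> D. u < v}. h u + h v) = (\<Sum>(u, v)\<in>D. h u)"
proof -
  let ?F = "{(u, v) \<in> D. u < v}" and ?G = "{(u, v) \<in> D. v < u}"
  have f: "finite ?F" "finite ?G" using fin by (auto intro: finite_subset[of _ D])
  have "u < v \<or> v < u" if "(u, v) \<in> D" for u v
    using i that by (cases "u = v") (auto simp: irrefl_def)
  then have "D = ?F \<union> ?G" by auto
  then have "(\<Sum>(u, v)\<in>D. h u) = (\<Sum>(u, v)\<in>?F \<union> ?G. h u)" by simp
  also have "\<dots> = (\<Sum>(u, v)\<in>?F. h u) + (\<Sum>(u, v)\<in>?G. h u)"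
    by (rule sum.union_disjoint[OF f]) auto
  also have "(\<Sum>(u, v)\<in>?G. h u) = (\<Sum>(u, v)\<in>?F. h v)"
    by (rule sum.reindex_bij_witness[of _ prod.swap prod.swap]) (use s in \<open>auto dest: symD\<close>)
  finally show ?thesis by (simp add: sum.distrib case_prod_unfold)
qed

text \<open>A selected vertex falls short of \<open>cap\<close> by k - 1 copies of its code, and a
  selected edge adds one code at each end. The deficit stands on the left to avoid
  subtraction.\<close>

lemma selection_sum:
  assumes S: "S \<subseteq> verts" and D: "D \<subseteq> {(u, v). proper u v}" "sym D"
  shows "\<Sum>(vertex_item ` S \<union> edge_item ` {(u, v) \<in> D. u < v}) + (\<Sum>v\<in>verts. ((k - 1) * of_bool (v \<in> S)) * h v)
     = card S * cap + (\<Sum>u\<in>verts. card (D `` {u}) * h u)"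
proof -
  let ?F = "{(u, v) \<in> D. u < v}"
  have Dv: "D \<subseteq> verts \<times> verts" using D proper_verts by blast
  have fin: "finite D" "finite S" "finite ?F"
    using finite_subset[OF Dv] finite_subset[OF S] by (auto intro: finite_subset[of _ D])
  have F: "fst e \<in> verts \<and> snd e \<in> verts \<and> fst e < snd e" if "e \<in> ?F" for e using that Dv by auto
  have dis: "vertex_item ` S \<inter> edge_item ` ?F = {}"
  proof -
    have "vertex_item x \<noteq> edge_item e" if "x \<in> S" "e \<in> ?F" for x e
      using vertex_item_neq_edge[of x "fst e" "snd e"] F[OF that(2)] S that(1) by (auto simp: edge_item_def)
    then show ?thesis by blast
  qed
  have injF: "inj_on edge_item ?F"
  proof (rule inj_onI)
    fix e e' assume e: "e \<in> ?F" "e' \<in> ?F" "edge_item e = edge_item e'"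
    have "{fst e, snd e} = {fst e', snd e'}"
      using F[OF e(1)] F[OF e(2)] e(3) by (intro edge_item_eq) (auto simp: edge_item_def)
    then show "e = e'" using F[OF e(1)] F[OF e(2)] by (auto simp: doubleton_eq_iff prod_eq_iff)
  qed
  have "\<Sum>(vertex_item ` S \<union> edge_item ` ?F) = sum vertex_item S + sum edge_item ?F"
    using fin dis injF inj_on_subset[OF vertex_item_inj S] by (simp add: sum.union_disjoint sum.reindex)
  moreover have "sum vertex_item S + (\<Sum>v\<in>verts. ((k - 1) * of_bool (v \<in> S)) * h v) = card S * cap"
  proof -
    have "(\<Sum>v\<in>verts. ((k - 1) * of_bool (v \<in> S)) * h v) = (\<Sum>v\<in>S. (k - 1) * h v)"
      using S by (intro sum.mono_neutral_cong_right) auto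
    then have "sum vertex_item S + (\<Sum>v\<in>verts. ((k - 1) * of_bool (v \<in> S)) * h v) = (\<Sum>v\<in>S. vertex_item v + (k - 1) * h v)"
      by (simp add: sum.distrib)
    also have "\<dots> = (\<Sum>v\<in>S. cap)" using S vertex_item_eq by (intro sum.cong) auto
    finally show ?thesis by simp
  qed
  moreover have "sum edge_item ?F = (\<Sum>u\<in>verts. card (D `` {u}) * h u)"
  proof -
    have "irrefl D" using D(1) by (auto simp: irrefl_def proper_def)
    then have "sum edge_item ?F = (\<Sum>(u, v)\<in>D. h u)"
      using edge_sum_symmetric[OF fin(1) D(2)] by (simp add: edge_item_def case_prod_unfold)
    also have "\<dots> = (\<Sum>(u, v)\<in>Sigma verts (\<lambda>u. D `` {u}). h u)"
      by (rule sum.cong) (use Dv in auto)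
    also have "\<dots> = (\<Sum>u\<in>verts. \<Sum>v\<in>D `` {u}. h u)"
      by (rule sum.Sigma[symmetric]) (use fin in \<open>auto intro: finite_Image\<close>)
    finally show ?thesis by simp
  qed
  ultimately show ?thesis by simp
qed

lemma degree_less: "D \<subseteq> {(u, v). proper u v} \<Longrightarrow> card (D `` {u}) < base"
proof -
  assume "D \<subseteq> {(u, v). proper u v}"
  then have "D `` {u} \<subseteq> verts" using proper_verts by blast
  then show ?thesis using card_mono[of verts "D `` {u}"] card_verts by simp
qed

lemma edge_item_swap: "edge_item (v, u) = edge_item (u, v)"
  by (simp add: edge_item_def)

lemma clique_from_selection:
  assumes Y: "Y \<subseteq> items" and sY: "\<Sum>Y = k * cap"
  shows "has_clique n k E"
proof -
  define S where "S = {v \<in> verts. vertex_item v \<in> Y}"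
  \<comment> \<open>D is taken symmetric, so that the number of selected edges at a vertex is the
    size of its image under D.\<close>
  define D where "D = {(u, v). proper u v \<and> edge_item (u, v) \<in> Y}"
  have S: "S \<subseteq> verts" by (auto simp: S_def)
  have D: "D \<subseteq> {(u, v). proper u v}" "sym D"
    by (auto simp: D_def sym_def proper_def edge_item_swap)
  have "Y = vertex_item ` S \<union> edge_item ` {(u, v) \<in> D. u < v}"
  proof
    show "vertex_item ` S \<union> edge_item ` {(u, v) \<in> D. u < v} \<subseteq> Y" by (auto simp: S_def D_def)
    show "Y \<subseteq> vertex_item ` S \<union> edge_item ` {(u, v) \<in> D. u < v}"
    proof
      fix y assume y: "y \<in> Y"
      then consider v where "v \<in> verts" "y = vertex_item v"
        | u v where "(u, v) \<in> set E" "u < n" "v < n" "u \<noteq> v" "y = edge_item (u, v)"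
        using Y unfolding items_def by blast
      then show "y \<in> vertex_item ` S \<union> edge_item ` {(u, v) \<in> D. u < v}"
      proof cases
        case 1
        then show ?thesis using y by (auto simp: S_def)
      next
        case (2 u v)
        then have p: "proper u v" "proper v u" by (auto simp: proper_def)
        show ?thesis
        proof (cases "u < v")
          case True
          then have "(u, v) \<in> {(u, v) \<in> D. u < v}" using p y 2 by (auto simp: D_def)
          then show ?thesis using 2 by blast
        next
          case False
          then have "(v, u) \<in> {(u, v) \<in> D. u < v}" using p y 2 by (auto simp: D_def edge_item_swap)
          then show ?thesis using 2 edge_item_swap by blast
        qed
      qed
    qed
  qed
  then have "card S * cap + (\<Sum>u\<in>verts. card (D `` {u}) * h u) = k * cap + (\<Sum>v\<in>verts. ((k - 1) * of_bool (v \<in> S)) * h v)"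
    using selection_sum[OF S D] sY by simp
  \<comment> \<open>Both remaining sums are below \<open>cap\<close>, so quotients and remainders
    modulo \<open>cap\<close> can be compared separately.\<close>
  moreover have "(\<Sum>u\<in>verts. card (D `` {u}) * h u) < cap" using degree_less[OF D(1)] by (intro weighted_h_less)
  moreover have "(\<Sum>v\<in>verts. ((k - 1) * of_bool (v \<in> S)) * h v) < cap" using k_base by (intro weighted_h_less) auto
  ultimately have cS: "card S = k" and e: "(\<Sum>u\<in>verts. card (D `` {u}) * h u) = (\<Sum>v\<in>verts. ((k - 1) * of_bool (v \<in> S)) * h v)"
    using block_unique by blast+
  \<comment> \<open>Comparing coefficients: a selected vertex has k - 1 neighbours in D, any other
    endpoint has none.\<close>
  have deg: "card (D `` {u}) = (k - 1) * of_bool (u \<in> S)" if "u \<in> verts" for u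
    using degree_less[OF D(1)] k_base e that
    by (intro weighted_h_unique[of "\<lambda>u. card (D `` {u})" "\<lambda>v. (k - 1) * of_bool (v \<in> S)" u]) auto
  have finD: "finite (D `` {u})" for u
    using D proper_verts by (intro finite_subset[of "D `` {u}" verts]) auto
  have inS: "v \<in> S" if "(u, v) \<in> D" for u v
  proof -
    have "u \<in> D `` {v}" using that D(2) by (auto dest: symD)
    then have "card (D `` {v}) \<noteq> 0" using finD by (auto simp: card_eq_0_iff)
    moreover have "v \<in> verts" using that D proper_verts by blast
    ultimately show ?thesis using deg[of v] by (cases "v \<in> S") auto
  qed
  \<comment> \<open>Neighbours are selected, and their number k - 1 equals that of the other
    selected vertices; hence u is adjacent to all of them.\<close>
  have nb: "D `` {u} = S - {u}" if u: "u \<in> S" for u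
  proof (rule card_subset_eq)
    show "finite (S - {u})" using finite_subset[OF S] by simp
    show "D `` {u} \<subseteq> S - {u}" using inS D by (auto simp: proper_def)
    have "card (S - {u}) = k - 1" using u cS finite_subset[OF S] by simp
    then show "card (D `` {u}) = card (S - {u})" using deg[of u] u S by auto
  qed
  have "u < n" if u: "u \<in> S" for u
  proof -
    have "card (S - {u}) \<noteq> 0" using u cS k2 finite_subset[OF S] by simp
    then obtain v where "v \<in> S - {u}" by (metis card.empty equals0I)
    then have "(u, v) \<in> D" using nb[OF u] by blast
    then show ?thesis using D by (auto simp: proper_def)
  qed
  moreover have "(u, v) \<in> set E \<or> (v, u) \<in> set E" if "u \<in> S" "v \<in> S" "u \<noteq> v" for u v
  proof -
    have "(u, v) \<in> D" using nb[OF that(1)] that by blast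
    then show ?thesis using D by (auto simp: proper_def)
  qed
  ultimately show ?thesis unfolding has_clique_def using cS by (intro exI[of _ S]) auto
qed

text \<open>The canonical selection consists of the items of all clique vertices and clique edges.
  By \<open>clique_from_selection\<close> the sum alone forces a clique, so the size bound only has
  to admit this selection and to depend on k alone.\<close>

lemma selection_from_clique:
  assumes "has_clique n k E"
  shows "\<exists>Y \<subseteq> items. card Y \<le> k * k \<and> \<Sum>Y = k * cap"
proof -
  obtain S where Sn: "S \<subseteq> {..<n}" and cS: "card S = k"
    and adj: "\<And>u v. u \<in> S \<Longrightarrow> v \<in> S \<Longrightarrow> u \<noteq> v \<Longrightarrow> (u, v) \<in> set E \<or> (v, u) \<in> set E"
    using assms unfolding has_clique_def by blast
  have finS: "finite S" using cS k2 by (intro card_ge_0_finite) simp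
  define D where "D = {(u, v). u \<in> S \<and> v \<in> S \<and> u \<noteq> v}"
  have D: "D \<subseteq> {(u, v). proper u v}" "sym D"
    using adj Sn by (auto simp: D_def proper_def sym_def)
  have nb: "D `` {u} = (if u \<in> S then S - {u} else {})" for u by (auto simp: D_def)
  have S: "S \<subseteq> verts"
  proof
    fix u assume u: "u \<in> S"
    have "card (S - {u}) \<noteq> 0" using u cS k2 finS by simp
    then obtain v where "v \<in> S - {u}" by (metis card.empty equals0I)
    then have "(u, v) \<in> D" using u by (auto simp: D_def)
    then show "u \<in> verts" using D proper_verts by blast
  qed
  let ?F = "{(u, v) \<in> D. u < v}"
  let ?Y = "vertex_item ` S \<union> edge_item ` ?F"
  have "card (D `` {u}) = (k - 1) * of_bool (u \<in> S)" for u
    using nb cS finS by auto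
  then have "\<Sum>?Y = k * cap" using selection_sum[OF S D] cS by simp
  moreover have "?Y \<subseteq> items"
  proof -
    have "edge_item (u, v) \<in> items" if "proper u v" for u v
    proof (cases "(u, v) \<in> set E")
      case True
      then have "(u, v) \<in> {(u, v) \<in> set E. u < n \<and> v < n \<and> u \<noteq> v}" using that by (auto simp: proper_def)
      then show ?thesis unfolding items_def by blast
    next
      case False
      then have "(v, u) \<in> {(u, v) \<in> set E. u < n \<and> v < n \<and> u \<noteq> v}" using that by (auto simp: proper_def)
      then show ?thesis unfolding items_def edge_item_swap[of v u, symmetric] by blast
    qed
    then have "edge_item e \<in> items" if "e \<in> ?F" for e using that D(1) by auto
    moreover have "vertex_item v \<in> items" if "v \<in> S" for v using that S by (auto simp: items_def)
    ultimately show ?thesis by blast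
  qed
  moreover have "card ?Y \<le> k * k"
  proof -
    have fF: "finite ?F" using finS by (intro finite_subset[of ?F "S \<times> S"]) (auto simp: D_def)
    \<comment> \<open>Vertices are placed on the diagonal of S x S and edges above it, so they do
      not overlap and number at most k * k.\<close>
    let ?I = "(\<lambda>u. (u, u)) ` S"
    have "card ?Y \<le> card (vertex_item ` S) + card (edge_item ` ?F)" by (rule card_Un_le)
    also have "\<dots> \<le> card S + card ?F" using finS fF by (intro add_mono card_image_le)
    also have "\<dots> = card ?I + card ?F" by (simp add: card_image inj_on_def)
    also have "\<dots> = card (?I \<union> ?F)" using finS fF by (intro card_Un_disjoint[symmetric]) auto
    also have "\<dots> \<le> card (S \<times> S)" using finS by (intro card_mono) (auto simp: D_def)
    finally show ?thesis using cS by (simp add: card_cartesian_product)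
  qed
  ultimately show ?thesis by blast
qed

lemma items_pos: "x \<in> items \<Longrightarrow> 0 < x"
proof -
  assume "x \<in> items"
  then consider v where "v \<in> verts" "x = vertex_item v" | u v where "(u, v) \<in> set E" "x = h u + h v"
    unfolding items_def edge_item_def by auto
  then show "0 < x"
  proof cases
    case 1
    then show ?thesis using vertex_item_pos by simp
  next
    case (2 u v)
    then have "u \<in> verts" unfolding set_flat by (metis UnI1 fst_conv imageI)
    then show ?thesis using h_pos[of u] 2 by simp
  qed
qed

end

section \<open>A while program for the reduction\<close>

definition runs :: "nat \<Rightarrow> prog \<Rightarrow> env \<Rightarrow> nat \<Rightarrow> env \<Rightarrow> bool" where
  "runs Z c s T s' \<longleftrightarrow> (\<exists>t\<le>T. bs Z c s t s')"

lemma runs_Nop: "runs Z Nop s 1 s"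
  unfolding runs_def by (blast intro: bs.Nop)

lemma runs_Assign:
  "s a = [w] \<Longrightarrow> a \<noteq> 0 \<Longrightarrow> w \<le> Z \<Longrightarrow> safe Z e s \<Longrightarrow> runs Z (Assign a e) s 1 (s(a := [eval e s]))"
  unfolding runs_def using bs.Assign[of a Z e s] by fastforce

lemma runs_PushE: "a \<noteq> 0 \<Longrightarrow> safe Z e s \<Longrightarrow> runs Z (PushE a e) s 1 (s(a := eval e s # s a))"
  unfolding runs_def by (blast intro: bs.PushE)

lemma runs_Drop: "s a = w # ws \<Longrightarrow> a \<noteq> 0 \<Longrightarrow> w \<le> Z \<Longrightarrow> runs Z (Drop a) s 1 (s(a := ws))"
  unfolding runs_def using bs.Drop[of a s Z] by fastforce

lemma runs_Sq: "runs Z c1 s T1 s1 \<Longrightarrow> runs Z c2 s1 T2 s2 \<Longrightarrow> runs Z (c1 ; c2) s (T1 + T2) s2"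
  unfolding runs_def by (meson bs.Sq add_mono)

lemma runs_If:
  "safe Z e s \<Longrightarrow> runs Z (if eval e s \<noteq> 0 then c1 else c2) s T s' \<Longrightarrow> runs Z (If e c1 c2) s (Suc T) s'"
  unfolding runs_def by (meson bs.If Suc_le_mono)

lemma runs_WhileE: "safe Z e s \<Longrightarrow> eval e s = 0 \<Longrightarrow> runs Z (While e c) s 1 s"
  unfolding runs_def by (blast intro: bs.WhileE)

lemma runs_WhileC:
  "safe Z e s \<Longrightarrow> eval e s \<noteq> 0 \<Longrightarrow> runs Z c s T s1 \<Longrightarrow> runs Z (While e c) s1 T' s2 \<Longrightarrow> runs Z (While e c) s (Suc (T + T')) s2"
  unfolding runs_def by (meson bs.WhileC Suc_le_mono add_mono)

lemma runs_weaken: "runs Z c s T s1 \<Longrightarrow> T \<le> T' \<Longrightarrow> s1 = s2 \<Longrightarrow> runs Z c s T' s2"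
  unfolding runs_def by (meson order_trans)

lemmas runs_basic = runs_Sq runs_Assign runs_PushE runs_Drop runs_Nop

text \<open>Runs the body for every element of the stack g, with this element on top; the second loop restores
  g from g'.\<close>
definition scan :: "nat \<Rightarrow> nat \<Rightarrow> prog \<Rightarrow> prog" where
  "scan g g' body = While (Nonempty g) (body ; PushE g' (Var g) ; Drop g) ;
     While (Nonempty g') (PushE g (Var g') ; Drop g')"

text \<open>\<tau> turns the abstract loop data into an environment, f is the effect of one round on
  these data, and the indexed invariant I provides the growth bounds that keep values below
  Z.\<close>

lemma runs_scan:
  fixes \<tau> :: "'a \<Rightarrow> env"
  assumes g: "g \<noteq> g'" "g \<noteq> 0" "g' \<noteq> 0" and Z: "\<And>x. x \<in> set xs \<Longrightarrow> x \<le> Z"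
    and body: "\<And>i a ws ws'. i < length xs \<Longrightarrow> I i a \<Longrightarrow>
       runs Z body ((\<tau> a)(g := xs ! i # ws, g' := ws')) tb ((\<tau> (f (xs ! i) a))(g := xs ! i # ws, g' := ws'))
       \<and> I (Suc i) (f (xs ! i) a)"
    and I: "I 0 a"
  shows "runs Z (scan g g' body) ((\<tau> a)(g := xs, g' := [])) (length xs * (tb + 6) + 2) ((\<tau> (fold f xs a))(g := xs, g' := []))
     \<and> I (length xs) (fold f xs a)"
proof -
  let ?W = "While (Nonempty g) (body ; PushE g' (Var g) ; Drop g)"
  let ?V = "While (Nonempty g') (PushE g (Var g') ; Drop g')"
  have 1: "runs Z ?W ((\<tau> a)(g := ys, g' := rev (take i xs))) (length ys * (tb + 3) + 1) ((\<tau> (fold f ys a))(g := [], g' := rev xs))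
      \<and> I (length xs) (fold f ys a)"
    if "ys = drop i xs" "i \<le> length xs" "I i a" for ys i a
    using that
  proof (induction ys arbitrary: i a)
    case Nil
    then have "i = length xs" by simp
    then show ?case using Nil g by (auto intro!: runs_weaken[OF runs_WhileE])
  next
    case (Cons y ys)
    have i: "i < length xs" using Cons.prems(1) by (metis drop_all list.distinct(1) not_le)
    have y: "y = xs ! i" and ys: "ys = drop (Suc i) xs"
      using Cons.prems(1) i by (simp_all add: Cons_nth_drop_Suc[symmetric])
    let ?s = "(\<tau> a)(g := y # ys, g' := rev (take i xs))"
    let ?t = "(\<tau> (f y a))(g := y # ys, g' := rev (take i xs))"
    have b: "runs Z body ?s tb ?t" and I': "I (Suc i) (f y a)" using body[OF i Cons.prems(3)] y by auto
    have yZ: "y \<le> Z" using Z y i by simp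
    let ?u = "(\<tau> (f y a))(g := ys, g' := rev (take (Suc i) xs))"
    have p: "runs Z (PushE g' (Var g)) ?t 1 (?t(g' := y # ?t g'))"
      using runs_PushE[of g' Z "Var g" ?t] g yZ by simp
    have d: "runs Z (Drop g) (?t(g' := y # ?t g')) 1 ((?t(g' := y # ?t g'))(g := ys))"
      using g yZ by (intro runs_Drop) auto
    have c: "runs Z (body ; PushE g' (Var g) ; Drop g) ?s (tb + 2) ?u"
      by (rule runs_weaken[OF runs_Sq[OF b runs_Sq[OF p d]]]) (use g i y in \<open>auto simp: take_Suc_conv_app_nth\<close>)
    have r: "runs Z ?W ?u (length ys * (tb + 3) + 1) ((\<tau> (fold f ys (f y a)))(g := [], g' := rev xs))"
      and I'': "I (length xs) (fold f ys (f y a))"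
      using Cons.IH[OF ys _ I'] i by (auto simp: fun_upd_def)
    have e: "eval (Nonempty g) ?s \<noteq> 0" "safe Z (Nonempty g) ?s" using g by auto
    have "runs Z ?W ?s (length (y # ys) * (tb + 3) + 1) ((\<tau> (fold f (y # ys) a))(g := [], g' := rev xs))"
      by (rule runs_weaken[OF runs_WhileC[OF e(2,1) c r]]) auto
    then show ?case using I'' by (auto simp: fun_upd_def)
  qed
  have 2: "runs Z ?V (s(g := ys, g' := zs)) (length zs * 3 + 1) (s(g := rev zs @ ys, g' := []))"
    if "set zs \<subseteq> set xs" for s ys zs
    using that
  proof (induction zs arbitrary: ys)
    case Nil
    then show ?case using g by (auto intro!: runs_weaken[OF runs_WhileE])
  next
    case (Cons z zs)
    let ?s = "s(g := ys, g' := z # zs)"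
    have z: "z \<le> Z" using Cons Z by auto
    have p: "runs Z (PushE g (Var g')) ?s 1 (?s(g := z # ?s g))"
      using runs_PushE[of g Z "Var g'" ?s] g z by simp
    have d: "runs Z (Drop g') (?s(g := z # ?s g)) 1 ((?s(g := z # ?s g))(g' := zs))"
      using g z by (intro runs_Drop) auto
    have c: "runs Z (PushE g (Var g') ; Drop g') ?s 2 (s(g := z # ys, g' := zs))"
      by (rule runs_weaken[OF runs_Sq[OF p d]]) (use g in auto)
    have e: "eval (Nonempty g') ?s \<noteq> 0" "safe Z (Nonempty g') ?s" using g by auto
    have r: "runs Z ?V (s(g := z # ys, g' := zs)) (length zs * 3 + 1) (s(g := rev zs @ z # ys, g' := []))"
      by (rule Cons.IH) (use Cons.prems in simp)
    show ?case by (rule runs_weaken[OF runs_WhileC[OF e(2,1) c r]]) auto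
  qed
  have a: "runs Z ?W ((\<tau> a)(g := xs, g' := [])) (length xs * (tb + 3) + 1) ((\<tau> (fold f xs a))(g := [], g' := rev xs))"
    and i: "I (length xs) (fold f xs a)" using 1[of xs 0 a] I by auto
  have b: "runs Z ?V ((\<tau> (fold f xs a))(g := [], g' := rev xs)) (length xs * 3 + 1) ((\<tau> (fold f xs a))(g := xs, g' := []))"
    using 2[of "rev xs" "\<tau> (fold f xs a)" "[]"] by simp
  show ?thesis using i unfolding scan_def
    by (auto intro!: runs_weaken[OF runs_Sq[OF a b]] simp: algebra_simps)
qed

text \<open>One of the two truncated differences is always 0, so their sum is the distance of the
  values; 1 minus it is 1 exactly for equal values.\<close>

definition eqE :: "exp \<Rightarrow> exp \<Rightarrow> exp" where
  "eqE a b = Sub (Num 1) (Add (Sub a b) (Sub b a))"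

lemma eqE_simps [simp]:
  "eval (eqE a b) s = of_bool (eval a s = eval b s)" "safe Z (eqE a b) s \<longleftrightarrow> safe Z a s \<and> safe Z b s"
  by (auto simp: eqE_def)

text \<open>Stack usage of the program: 1 input, 2 output, 3 = n, 4 = k, 5 announced and 6 actual number of
  edge endpoints, 7 the endpoints (with 8 as the companion of scan), 9 the endpoints still to be processed, 10
  base, 11 cap, 12 and 13 the codes of the current endpoints 21 and 22, 14 the items found (companion 15), 16
  membership flag, 17, 18 and 19 the number of items, their sum and their sum of squares, 20 the item to be
  inserted, 23 parity of the number of endpoints.\<close>
definition insert_prog :: prog where
  "insert_prog = Assign 16 (Num 0) ; scan 14 15 (Assign 16 (Add (Var 16) (eqE (Var 14) (Var 20)))) ;
     If (Var 16) Nop (PushE 14 (Var 20) ; Assign 17 (Add (Var 17) (Num 1)) ;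
       Assign 18 (Add (Var 18) (Var 20)) ; Assign 19 (Add (Var 19) (Mul (Var 20) (Var 20))))"

definition ins :: "nat \<Rightarrow> nat list \<Rightarrow> nat list" where
  "ins x L = (if x \<in> set L then L else x # L)"

text \<open>Ties the three running totals to the item list, so that the final budget is available
  without another pass over the items.\<close>

definition with_items :: "env \<Rightarrow> nat list \<Rightarrow> env" where
  "with_items s L = s(14 := L, 15 := [], 17 := [length L], 18 := [sum_list L], 19 := [sum_list (map (\<lambda>x. x\<^sup>2) L)])"

lemma runs_insert:
  assumes s: "s 16 = [w]" "w \<le> Z" "s 20 = [x]" "x \<le> Z" and L: "\<And>y. y \<in> set L \<Longrightarrow> y \<le> Z"
    and Z: "length L \<le> Z" "sum_list L \<le> Z" "sum_list (map (\<lambda>x. x\<^sup>2) L) \<le> Z"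
  shows "\<exists>v \<le> length L. runs Z insert_prog (with_items s L) (length L * 7 + 9) (with_items (s(16 := [v])) (ins x L))"
proof -
  define \<tau> where "\<tau> = (\<lambda>v::nat. with_items (s(16 := [v])) L)"
  \<comment> \<open>The flag counts occurrences of x rather than storing a truth value, which saves
    a branch in the scan; its value is bounded by the number of elements seen.\<close>
  define f where "f = (\<lambda>y v. v + of_bool (y = x) :: nat)"
  let ?B = "Assign 16 (Add (Var 16) (eqE (Var 14) (Var 20)))"
  have e: "(\<tau> v)(14 := L, 15 := []) = \<tau> v" for v by (rule ext) (auto simp: \<tau>_def with_items_def)
  have sc: "runs Z (scan 14 15 ?B) ((\<tau> 0)(14 := L, 15 := [])) (length L * (1 + 6) + 2) ((\<tau> (fold f L 0))(14 := L, 15 := []))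
      \<and> fold f L 0 \<le> length L"
  proof (rule runs_scan[where I = "\<lambda>i v. v \<le> i"])
    fix i v ws ws' assume i: "i < length L" "v \<le> i"
    have "runs Z ?B ((\<tau> v)(14 := L ! i # ws, 15 := ws')) 1 ((\<tau> (f (L ! i) v))(14 := L ! i # ws, 15 := ws'))"
      by (rule runs_weaken[OF runs_Assign[where w = v]])
        (use i s L Z in \<open>auto simp: \<tau>_def with_items_def f_def\<close>)
    then show "runs Z ?B ((\<tau> v)(14 := L ! i # ws, 15 := ws')) 1 ((\<tau> (f (L ! i) v))(14 := L ! i # ws, 15 := ws')) \<and> f (L ! i) v \<le> Suc i"
      using i by (auto simp: f_def)
  qed (use L in auto)
  have cnt: "fold f L v = 0 \<longleftrightarrow> v = 0 \<and> x \<notin> set L" for v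
    by (induction L arbitrary: v) (auto simp: f_def)
  let ?v = "fold f L 0"
  have 1: "runs Z (Assign 16 (Num 0)) (with_items s L) 1 (\<tau> 0)"
    by (rule runs_weaken[OF runs_Assign[where w = w]]) (use s in \<open>auto simp: \<tau>_def with_items_def\<close>)
  have 2: "runs Z (scan 14 15 ?B) (\<tau> 0) (length L * 7 + 2) (\<tau> ?v)" using sc by (simp add: e)
  let ?c = "PushE 14 (Var 20) ; Assign 17 (Add (Var 17) (Num 1)) ;
       Assign 18 (Add (Var 18) (Var 20)) ; Assign 19 (Add (Var 19) (Mul (Var 20) (Var 20)))"
  have 3: "runs Z (if eval (Var 16) (\<tau> ?v) \<noteq> 0 then Nop else ?c) (\<tau> ?v) 4 (with_items (s(16 := [?v])) (ins x L))"
  proof (cases "x \<in> set L")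
    case True
    then have "eval (Var 16) (\<tau> ?v) \<noteq> 0" using cnt[of 0] by (simp add: \<tau>_def with_items_def)
    moreover have "runs Z Nop (\<tau> ?v) 4 (with_items (s(16 := [?v])) (ins x L))"
      by (rule runs_weaken[OF runs_Nop]) (use True in \<open>auto simp: ins_def \<tau>_def\<close>)
    ultimately show ?thesis by simp
  next
    case False
    then have "eval (Var 16) (\<tau> ?v) = 0" using cnt[of 0] by (simp add: \<tau>_def with_items_def)
    moreover have "runs Z ?c (\<tau> ?v) 4 (with_items (s(16 := [?v])) (ins x L))"
      by (rule runs_weaken, (rule runs_basic | simp add: \<tau>_def with_items_def s Z; fail)+)
        (use False s in \<open>auto simp: ins_def \<tau>_def with_items_def power2_eq_square\<close>)
    ultimately show ?thesis by simp
  qed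
  have "runs Z insert_prog (with_items s L) (length L * 7 + 9) (with_items (s(16 := [?v])) (ins x L))"
    unfolding insert_prog_def
    by (rule runs_weaken[OF runs_Sq[OF 1 runs_Sq[OF 2 runs_If[OF _ 3]]]]) (use sc Z in \<open>auto simp: \<tau>_def with_items_def\<close>)
  then show ?thesis using sc by blast
qed

lemma code_Cons: "code B (w # fl) v = of_bool (w = v) + B * code B fl v"
  unfolding code_def length_Cons sum.lessThan_Suc_shift nth_Cons_0 nth_Cons_Suc power_0 power_Suc sum_distrib_left
  by (simp only: mult_1_right mult.left_commute)

text \<open>Position 0 is the least significant digit, so Horner's rule reads the list from its end;
  this is the order in which stack 7 presents it.\<close>

lemma code_horner: "fold (\<lambda>w acc. acc * B + of_bool (w = v)) (rev fl) 0 = code B fl v"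
  by (induction fl) (auto simp: code_Cons code_def[of B "[]"])

definition code_prog :: prog where
  "code_prog = Assign 12 (Num 0) ; Assign 13 (Num 0) ;
     scan 7 8 (Assign 12 (Add (Mul (Var 12) (Var 10)) (eqE (Var 7) (Var 21))) ;
               Assign 13 (Add (Mul (Var 13) (Var 10)) (eqE (Var 7) (Var 22))))"

text \<open>Keeps every partial code below a power of the base, as the bound Z on all values read
  requires.\<close>

lemma horner_step_less: "(a::nat) < B ^ i \<Longrightarrow> 2 \<le> B \<Longrightarrow> a * B + of_bool c < B ^ Suc i"
proof -
  assume "a < B ^ i" "2 \<le> B"
  then have "(a + 1) * B \<le> B ^ i * B" by (intro mult_le_mono1) simp
  then have "a * B + B \<le> B ^ Suc i" by (simp add: algebra_simps)
  moreover have "of_bool c < B" using \<open>2 \<le> B\<close> by (cases c) auto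
  ultimately show ?thesis by linarith
qed

lemma runs_code:
  assumes s: "s 7 = rev fl" "s 8 = []" "s 10 = [B]" "s 21 = [u]" "s 22 = [v]" "s 12 = [w]" "s 13 = [w']"
    and Z: "B \<le> Z" "u \<le> Z" "v \<le> Z" "w \<le> Z" "w' \<le> Z" "\<And>y. y \<in> set fl \<Longrightarrow> y \<le> Z" "B ^ length fl \<le> Z" "2 \<le> B"
  shows "runs Z code_prog s (length fl * 8 + 4) (s(12 := [code B fl u], 13 := [code B fl v]))"
proof -
  define \<tau> where "\<tau> = (\<lambda>(a, b). s(12 := [a], 13 := [b::nat]))"
  define f where "f = (\<lambda>y (a, b). (a * B + of_bool (y = u), b * B + of_bool (y = v) :: nat))"
  let ?B = "Assign 12 (Add (Mul (Var 12) (Var 10)) (eqE (Var 7) (Var 21))) ;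
     Assign 13 (Add (Mul (Var 13) (Var 10)) (eqE (Var 7) (Var 22)))"
  have e: "(\<tau> a)(7 := rev fl, 8 := []) = \<tau> a" for a by (rule ext) (auto simp: \<tau>_def s split: prod.split)
  have sc: "runs Z (scan 7 8 ?B) ((\<tau> (0, 0))(7 := rev fl, 8 := [])) (length (rev fl) * (2 + 6) + 2) ((\<tau> (fold f (rev fl) (0, 0)))(7 := rev fl, 8 := []))
      \<and> (\<lambda>i (a, b). a < B ^ i \<and> b < B ^ i) (length (rev fl)) (fold f (rev fl) (0, 0))"
  proof (rule runs_scan)
    fix i c ws ws' assume i: "i < length (rev fl)" "(\<lambda>i (a, b). a < B ^ i \<and> b < B ^ i) i c"
    obtain a b where c: "c = (a, b)" by (cases c)
    let ?y = "rev fl ! i"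
    have y: "?y \<le> Z" using Z(6) i nth_mem[OF i(1)] by simp
    have "B ^ i \<le> B ^ length fl" using i Z(8) by (intro power_increasing) auto
    then have ab: "a \<le> Z" "b \<le> Z" using i(2) c Z(7) by auto
    have "runs Z ?B ((\<tau> c)(7 := ?y # ws, 8 := ws')) 2 ((\<tau> (f ?y c))(7 := ?y # ws, 8 := ws'))"
      by (rule runs_weaken, (rule runs_basic | simp add: \<tau>_def c s Z ab y; fail)+)
        (use s in \<open>auto simp: \<tau>_def c f_def\<close>)
    then show "runs Z ?B ((\<tau> c)(7 := ?y # ws, 8 := ws')) 2 ((\<tau> (f ?y c))(7 := ?y # ws, 8 := ws'))
       \<and> (case f ?y c of (a, b) \<Rightarrow> a < B ^ Suc i \<and> b < B ^ Suc i)"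
      using i(2) Z(8) horner_step_less by (auto simp: f_def c simp del: power_Suc)
  qed (use Z in auto)
  have fo: "fold f ys (a, b) = (fold (\<lambda>w acc. acc * B + of_bool (w = u)) ys a, fold (\<lambda>w acc. acc * B + of_bool (w = v)) ys b)" for ys a b
    by (induction ys arbitrary: a b) (auto simp: f_def)
  have 2: "runs Z (scan 7 8 ?B) (\<tau> (0, 0)) (length fl * 8 + 2) (s(12 := [code B fl u], 13 := [code B fl v]))"
    using sc by (simp add: e fo code_horner) (simp add: \<tau>_def)
  have 1: "runs Z (Assign 12 (Num 0)) s 1 (s(12 := [0]))"
    by (rule runs_weaken[OF runs_Assign[where w = w]]) (use s Z in auto)
  have 3: "runs Z (Assign 13 (Num 0)) (s(12 := [0])) 1 (\<tau> (0, 0))"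
    by (rule runs_weaken[OF runs_Assign[where w = w']]) (use s Z in \<open>auto simp: \<tau>_def\<close>)
  show ?thesis unfolding code_prog_def
    by (rule runs_weaken[OF runs_Sq[OF 1 runs_Sq[OF 3 2]]]) auto
qed

definition vertex_prog :: "nat \<Rightarrow> prog" where
  "vertex_prog a = Assign 20 (Sub (Var 11) (Mul (Sub (Var 4) (Num 1)) (Var a))) ; insert_prog"

text \<open>The product of truncated differences encodes a conjunction: it is nonzero exactly if
  both endpoints are below n and they differ.\<close>

definition pair_prog :: prog where
  "pair_prog = Assign 21 (Var 9) ; Drop 9 ; Assign 22 (Var 9) ; Drop 9 ; code_prog ; vertex_prog 12 ; vertex_prog 13 ;
     If (Mul (Mul (Sub (Var 3) (Var 21)) (Sub (Var 3) (Var 22))) (Add (Sub (Var 21) (Var 22)) (Sub (Var 22) (Var 21))))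
       (Assign 20 (Add (Var 12) (Var 13)) ; insert_prog) Nop"

text \<open>Everything is written back to front, because the top of the stack becomes the beginning
  of the encoded list.\<close>

definition emit_prog :: prog where
  "emit_prog = While (Nonempty 14)
     (PushE 2 (Mul (Var 14) (Add (Var 14) (Mul (Num 2) (Sub (Var 18) (Mul (Var 4) (Var 11)))))) ;
      PushE 2 (Mul (Num 2) (Var 14)) ; PushE 2 (Var 14) ; Drop 14) ;
     PushE 2 (Mul (Num 3) (Var 17)) ;
     PushE 2 (Sub (Add (Mul (Var 18) (Var 18)) (Var 19)) (Mul (Mul (Var 4) (Var 11)) (Mul (Var 4) (Var 11)))) ;
     PushE 2 (Mul (Var 4) (Var 4))"

text \<open>A single scan computes the cap as a power, one factor per endpoint, and copies the
  endpoints to stack 9, which undoes the reversal of stack 7.\<close>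

definition general_prog :: prog where
  "general_prog = PushE 10 (Add (Add (Var 6) (Var 4)) (Num 1)) ; PushE 11 (Num 1) ;
     scan 7 8 (PushE 9 (Var 7) ; Assign 11 (Mul (Var 11) (Var 10))) ;
     PushE 12 (Num 0) ; PushE 13 (Num 0) ; PushE 16 (Num 0) ; PushE 17 (Num 0) ; PushE 18 (Num 0) ;
     PushE 19 (Num 0) ; PushE 20 (Num 0) ; PushE 21 (Num 0) ; PushE 22 (Num 0) ;
     While (Nonempty 9) pair_prog ;
     If (Sub (Mul (Var 4) (Var 11)) (Var 18)) Nop emit_prog"

definition triples :: "nat \<Rightarrow> nat list \<Rightarrow> nat list" where
  "triples D its = concat (map (\<lambda>(p, w, e). [p, w, e]) (job_list D its))"

lemma triples_simps [simp]:
  "triples D [] = []" "triples D (xs @ [x]) = triples D xs @ [x, 2 * x, x * (x + 2 * D)]"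
  "triples D (x # xs) = [x, 2 * x, x * (x + 2 * D)] @ triples D xs"
  by (auto simp: triples_def job_list_def)

lemma runs_emit:
  assumes s: "s 14 = L" "s 18 = [P]" "s 4 = [k]" "s 11 = [c]" "s 17 = [l]" "s 19 = [q]"
    and Z: "\<And>x. x \<in> set L \<Longrightarrow> x \<le> Z" "P \<le> Z" "k \<le> Z" "c \<le> Z" "l \<le> Z" "q \<le> Z"
  shows "runs Z emit_prog s (5 * length L + 4)
    (s(14 := [], 2 := k * k # (P\<^sup>2 + q - (k * c)\<^sup>2) # 3 * l # triples (P - k * c) (rev L) @ s 2))"
proof -
  let ?B = "PushE 2 (Mul (Var 14) (Add (Var 14) (Mul (Num 2) (Sub (Var 18) (Mul (Var 4) (Var 11)))))) ;
      PushE 2 (Mul (Num 2) (Var 14)) ; PushE 2 (Var 14) ; Drop 14"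
  have 1: "runs Z (While (Nonempty 14) ?B) (s(14 := L, 2 := out)) (5 * length L + 1)
      (s(14 := [], 2 := triples (P - k * c) (rev L) @ out))" for out
    using Z(1)
  proof (induction L arbitrary: out)
    case Nil
    show ?case by (rule runs_weaken[OF runs_WhileE]) auto
  next
    case (Cons x L)
    let ?s = "s(14 := x # L, 2 := out)"
    let ?t = "s(14 := L, 2 := [x, 2 * x, x * (x + 2 * (P - k * c))] @ out)"
    have b: "runs Z ?B ?s 4 ?t"
      by (rule runs_weaken, (rule runs_basic | simp add: s Z Cons.prems; fail)+) (auto simp: s)
    have r: "runs Z (While (Nonempty 14) ?B) ?t (5 * length L + 1)
      (s(14 := [], 2 := triples (P - k * c) (rev L) @ [x, 2 * x, x * (x + 2 * (P - k * c))] @ out))"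
      by (rule Cons.IH) (use Cons.prems in simp)
    have e: "eval (Nonempty 14) ?s \<noteq> 0" "safe Z (Nonempty 14) ?s" by auto
    show ?case by (rule runs_weaken[OF runs_WhileC[OF e(2,1) b r]]) auto
  qed
  have e: "s(14 := L, 2 := s 2) = s" using s by auto
  have 2: "runs Z (While (Nonempty 14) ?B) s (5 * length L + 1) (s(14 := [], 2 := triples (P - k * c) (rev L) @ s 2))"
    using 1[of "s 2"] unfolding e .
  show ?thesis unfolding emit_prog_def
    by (rule runs_weaken, rule runs_Sq, rule 2, (rule runs_basic | simp add: s Z; fail)+)
      (auto simp: s power2_eq_square)
qed

section \<open>Bounds on the values occurring in the program\<close>

context clique_instance begin

lemma cap_pos: "1 \<le> cap"
  using base3 by (simp add: cap_def)

lemma h_le_cap: "h u \<le> cap"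
proof -
  have "h u < cap" unfolding h_def code_def cap_def using base3 by (intro digit_sum_less) (auto simp: of_bool_def)
  then show ?thesis by simp
qed

lemma item_le: "x \<in> items \<Longrightarrow> x \<le> 2 * cap"
proof -
  assume "x \<in> items"
  then consider v where "x = vertex_item v" | u v where "x = h u + h v" unfolding items_def edge_item_def by auto
  then show ?thesis
  proof cases
    case 1
    then show ?thesis by (simp add: vertex_item_def)
  next
    case (2 u v)
    then show ?thesis using h_le_cap[of u] h_le_cap[of v] by simp
  qed
qed

lemma card_items: "card items \<le> 2 * length (flat E)"
proof -
  have "card (vertex_item ` verts) \<le> length (flat E)"
    using card_image_le[of verts vertex_item] card_length[of "flat E"] by simp
  moreover have "card (edge_item ` {(u, v) \<in> set E. u < n \<and> v < n \<and> u \<noteq> v}) \<le> length E"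
  proof -
    let ?P = "{(u, v) \<in> set E. u < n \<and> v < n \<and> u \<noteq> v}"
    have "finite ?P" by (rule finite_subset[of _ "set E"]) auto
    then have "card (edge_item ` ?P) \<le> card ?P" by (rule card_image_le)
    also have "\<dots> \<le> card (set E)" by (rule card_mono) auto
    also have "\<dots> \<le> length E" by (rule card_length)
    finally show ?thesis .
  qed
  ultimately show ?thesis
    using card_Un_le[of "vertex_item ` verts" "edge_item ` {(u, v) \<in> set E. u < n \<and> v < n \<and> u \<noteq> v}"]
    unfolding items_def length_flat by linarith
qed

definition good :: "nat list \<Rightarrow> bool" where
  "good L \<longleftrightarrow> distinct L \<and> set L \<subseteq> items"

lemma finite_items: "finite items"
proof -
  have "finite {(u, v) \<in> set E. u < n \<and> v < n \<and> u \<noteq> v}" by (rule finite_subset[of _ "set E"]) auto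
  then show ?thesis by (simp add: items_def)
qed

lemma good_length: "good L \<Longrightarrow> length L \<le> 2 * length (flat E)"
  using card_mono[OF finite_items, of "set L"] card_items by (simp add: good_def distinct_card)

lemma good_sum:
  assumes "good L"
  shows "sum_list L \<le> 4 * length (flat E) * cap" "sum_list (map (\<lambda>x. x\<^sup>2) L) \<le> 8 * length (flat E) * cap\<^sup>2"
proof -
  have x: "x \<le> 2 * cap" if "x \<in> set L" for x using that assms item_le by (auto simp: good_def)
  have "sum_list (map f L) \<le> length L * b" if "\<And>x. x \<in> set L \<Longrightarrow> f x \<le> b" for f :: "nat \<Rightarrow> nat" and b
    using that by (induction L) (auto intro: add_mono)
  note sl = this
  have "sum_list L \<le> length L * (2 * cap)" using sl[of id "2 * cap"] x by simp
  also have "\<dots> \<le> (2 * length (flat E)) * (2 * cap)" by (rule mult_le_mono1[OF good_length[OF assms]])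
  finally show "sum_list L \<le> 4 * length (flat E) * cap" by simp
  have "sum_list (map (\<lambda>x. x\<^sup>2) L) \<le> length L * (2 * cap)\<^sup>2" using x by (intro sl power_mono) auto
  also have "\<dots> \<le> (2 * length (flat E)) * (2 * cap)\<^sup>2" by (rule mult_le_mono1[OF good_length[OF assms]])
  finally show "sum_list (map (\<lambda>x. x\<^sup>2) L) \<le> 8 * length (flat E) * cap\<^sup>2" by (simp add: power2_eq_square)
qed

lemma good_ins: "good L \<Longrightarrow> x \<in> items \<Longrightarrow> good (ins x L) \<and> set (ins x L) = insert x (set L)"
  by (auto simp: good_def ins_def)

text \<open>The dominating value is the sum of squared items: with m endpoints there are at most 2m
  items, each at most \<open>2 * cap\<close>, which gives 8 m cap^2. The factor 16 leaves room for
  the other quantities.\<close>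

definition bounded_by :: "nat \<Rightarrow> bool" where
  "bounded_by Z \<longleftrightarrow> 16 * (length (flat E) + 1) * cap\<^sup>2 \<le> Z \<and> n \<le> Z \<and> base \<le> Z \<and> (\<forall>v \<in> verts. v \<le> Z)"

lemma bounded_by_D:
  assumes "bounded_by Z"
  shows "n \<le> Z" "base \<le> Z" "k \<le> Z" "cap \<le> Z" "2 * cap \<le> Z" "v \<in> verts \<Longrightarrow> v \<le> Z"
    "16 * (length (flat E) + 1) \<le> Z" "length (flat E) \<le> Z" "1 \<le> Z" "h v' \<le> Z"
    "good L \<Longrightarrow> y \<in> set L \<Longrightarrow> y \<le> Z" "good L \<Longrightarrow> length L \<le> Z" "good L \<Longrightarrow> sum_list L \<le> Z"
    "good L \<Longrightarrow> sum_list (map (\<lambda>x. x\<^sup>2) L) \<le> Z"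
proof -
  let ?m = "length (flat E)"
  have b: "16 * (?m + 1) * cap\<^sup>2 \<le> Z" using assms by (simp add: bounded_by_def)
  have c2: "cap \<le> cap\<^sup>2" "1 \<le> cap\<^sup>2" using cap_pos by (auto simp: power2_eq_square)
  have mono: "a * d \<le> Z" if "a \<le> 16 * (?m + 1)" "d \<le> cap\<^sup>2" for a d
    using mult_le_mono[OF that] b by linarith
  show "n \<le> Z" "base \<le> Z" "v \<in> verts \<Longrightarrow> v \<le> Z" using assms by (auto simp: bounded_by_def)
  then show "k \<le> Z" by (simp add: base_def)
  show c: "2 * cap \<le> Z" "cap \<le> Z" using mono[of 2 cap] mono[of 1 cap] c2 by auto
  show "16 * (?m + 1) \<le> Z" using mono[of "16 * (?m + 1)" 1] c2 by simp
  then show l: "?m \<le> Z" "1 \<le> Z" by auto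
  show "h v' \<le> Z" using h_le_cap[of v'] c by simp
  show "good L \<Longrightarrow> y \<in> set L \<Longrightarrow> y \<le> Z" using item_le[of y] c by (auto simp: good_def)
  show "good L \<Longrightarrow> length L \<le> Z" using good_length[of L] mono[of "2 * ?m" 1] c2 by simp
  show "good L \<Longrightarrow> sum_list L \<le> Z" using good_sum(1)[of L] mono[of "4 * ?m" cap] c2 by simp
  show "good L \<Longrightarrow> sum_list (map (\<lambda>x. x\<^sup>2) L) \<le> Z" using good_sum(2)[of L] mono[of "8 * ?m" "cap\<^sup>2"] by simp
qed

end

text \<open>\<sigma> is the part of the environment that stays fixed while pairs are processed;
  \<open>st\<close> overlays the stacks that change.\<close>

locale program_state = clique_instance +
  fixes \<sigma> :: env and Z :: nat
  assumes Z: "bounded_by Z"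
    and \<sigma>: "\<sigma> 3 = [n]" "\<sigma> 4 = [k]" "\<sigma> 7 = rev (flat E)" "\<sigma> 8 = []" "\<sigma> 10 = [base]" "\<sigma> 11 = [cap]"
begin

definition st :: "nat list \<Rightarrow> nat list \<Rightarrow> nat \<Rightarrow> nat \<Rightarrow> nat \<Rightarrow> nat \<Rightarrow> nat \<Rightarrow> nat \<Rightarrow> env" where
  "st fl L a b c d e f = with_items (\<sigma>(9 := fl, 12 := [a], 13 := [b], 16 := [c], 20 := [d], 21 := [e], 22 := [f])) L"

lemma runs_insert_st:
  assumes "good L" "c \<le> Z" "d \<le> Z"
  shows "\<exists>c' \<le> Z. runs Z insert_prog (st fl L a b c d e f) (14 * length (flat E) + 9) (st fl (ins d L) a b c' d e f)"
proof -
  let ?s = "\<sigma>(9 := fl, 12 := [a], 13 := [b], 16 := [c], 20 := [d], 21 := [e], 22 := [f])"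
  obtain v where v: "v \<le> length L"
    and r: "runs Z insert_prog (with_items ?s L) (length L * 7 + 9) (with_items (?s(16 := [v])) (ins d L))"
    using runs_insert[of ?s c Z d L] assms bounded_by_D(11-14)[OF Z assms(1)] by auto
  have e: "?s(16 := [v]) = \<sigma>(9 := fl, 12 := [a], 13 := [b], 16 := [v], 20 := [d], 21 := [e], 22 := [f])"
    by (rule ext) auto
  have "runs Z insert_prog (st fl L a b c d e f) (14 * length (flat E) + 9) (st fl (ins d L) a b v d e f)"
    using good_length[OF assms(1)] unfolding st_def by (intro runs_weaken[OF r]) (simp, simp only: e)
  moreover have "v \<le> Z" using v bounded_by_D(12)[OF Z assms(1)] by simp
  ultimately show ?thesis by blast
qed

lemma runs_code_st:
  assumes "a \<le> Z" "b \<le> Z" "e \<le> Z" "f \<le> Z"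
  shows "runs Z code_prog (st fl L a b c d e f) (8 * length (flat E) + 4) (st fl L (h e) (h f) c d e f)"
  by (rule runs_weaken[OF runs_code[where fl = "flat E" and B = base and u = e and v = f and w = a and w' = b]])
    (use assms \<sigma> bounded_by_D[OF Z] base3 in \<open>auto simp: st_def with_items_def h_def cap_def[symmetric]\<close>)

lemma runs_vertex_st:
  assumes L: "good L" and b: "c \<le> Z" "d \<le> Z" and uv: "u \<in> verts" "v \<in> verts" and x: "x = 12 \<and> w = u \<or> x = 13 \<and> w = v"
  shows "\<exists>c' \<le> Z. runs Z (vertex_prog x) (st fl L (h u) (h v) c d u v) (14 * length (flat E) + 10)
    (st fl (ins (vertex_item w) L) (h u) (h v) c' (vertex_item w) u v)"
proof -
  let ?d = "vertex_item w"
  have w: "w \<in> verts" using x uv by auto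
  then have "?d \<in> items" by (auto simp: items_def)
  then have dZ: "?d \<le> Z" using item_le[of ?d] bounded_by_D(5)[OF Z] by simp
  have 1: "runs Z (Assign 20 (Sub (Var 11) (Mul (Sub (Var 4) (Num 1)) (Var x)))) (st fl L (h u) (h v) c d u v) 1
      (st fl L (h u) (h v) c ?d u v)"
    by (rule runs_weaken[OF runs_Assign[where w = d]])
      (use x b \<sigma> bounded_by_D[OF Z] in \<open>auto simp: st_def with_items_def vertex_item_def\<close>)
  obtain c' where c': "c' \<le> Z" and 2: "runs Z insert_prog (st fl L (h u) (h v) c ?d u v) (14 * length (flat E) + 9)
      (st fl (ins ?d L) (h u) (h v) c' ?d u v)"
    using runs_insert_st[OF L b(1) dZ] by blast
  show ?thesis unfolding vertex_prog_def
    by (rule exI[of _ c'], rule conjI[OF c'], rule runs_weaken[OF runs_Sq[OF 1 2]]) auto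
qed

definition contribution :: "(nat \<times> nat) list \<Rightarrow> nat set" where
  "contribution F = vertex_item ` set (flat F) \<union> edge_item ` {(u, v) \<in> set F. u < n \<and> v < n \<and> u \<noteq> v}"

text \<open>The order of the items and the contents of the auxiliary stacks are irrelevant for what
  follows, hence the existential form: only distinctness, the set of items and the bounds by Z are
  passed on.\<close>

lemma runs_pair:
  assumes L: "good L" and uv: "(u, v) \<in> set E" and b: "a \<le> Z" "b \<le> Z" "c \<le> Z" "d \<le> Z" "e \<le> Z" "f \<le> Z"
  shows "\<exists>L' c' d'. runs Z pair_prog (st (u # v # fl) L a b c d e f) (60 * (length (flat E) + 1)) (st fl L' (h u) (h v) c' d' u v)
    \<and> good L' \<and> set L' = set L \<union> contribution [(u, v)] \<and> c' \<le> Z \<and> d' \<le> Z"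
proof -
  have V: "u \<in> verts" "v \<in> verts" using uv by (force simp: set_flat)+
  let ?m = "length (flat E)"
  have uvZ: "u \<le> Z" "v \<le> Z" using V bounded_by_D(6)[OF Z] by auto
  have 1: "runs Z (Assign 21 (Var 9)) (st (u # v # fl) L a b c d e f) 1 (st (u # v # fl) L a b c d u f)"
    by (rule runs_weaken[OF runs_Assign[where w = e]]) (use b uvZ in \<open>auto simp: st_def with_items_def\<close>)
  have 2: "runs Z (Drop 9) (st (u # v # fl) L a b c d u f) 1 (st (v # fl) L a b c d u f)"
    by (rule runs_weaken[OF runs_Drop[where w = u and ws = "v # fl"]]) (use uvZ in \<open>auto simp: st_def with_items_def\<close>)
  have 3: "runs Z (Assign 22 (Var 9)) (st (v # fl) L a b c d u f) 1 (st (v # fl) L a b c d u v)"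
    by (rule runs_weaken[OF runs_Assign[where w = f]]) (use b uvZ in \<open>auto simp: st_def with_items_def\<close>)
  have 4: "runs Z (Drop 9) (st (v # fl) L a b c d u v) 1 (st fl L a b c d u v)"
    by (rule runs_weaken[OF runs_Drop[where w = v and ws = fl]]) (use uvZ in \<open>auto simp: st_def with_items_def\<close>)
  have 5: "runs Z code_prog (st fl L a b c d u v) (8 * ?m + 4) (st fl L (h u) (h v) c d u v)"
    by (rule runs_code_st) (use b uvZ in auto)
  have vi: "vertex_item u \<in> items" "vertex_item v \<in> items" using V by (auto simp: items_def)
  then have viZ: "vertex_item u \<le> Z" "vertex_item v \<le> Z" using item_le bounded_by_D(5)[OF Z] by (meson order_trans)+
  let ?L1 = "ins (vertex_item u) L"
  let ?L2 = "ins (vertex_item v) ?L1"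
  have g1: "good ?L1 \<and> set ?L1 = insert (vertex_item u) (set L)" by (rule good_ins[OF L vi(1)])
  then have g2: "good ?L2 \<and> set ?L2 = insert (vertex_item v) (set ?L1)" using good_ins vi(2) by blast
  obtain c1 where c1: "c1 \<le> Z" and 6: "runs Z (vertex_prog 12) (st fl L (h u) (h v) c d u v) (14 * ?m + 10)
      (st fl ?L1 (h u) (h v) c1 (vertex_item u) u v)"
    using runs_vertex_st[OF L b(3,4) V, of 12 u] by auto
  obtain c2 where c2: "c2 \<le> Z" and 7: "runs Z (vertex_prog 13) (st fl ?L1 (h u) (h v) c1 (vertex_item u) u v) (14 * ?m + 10)
      (st fl ?L2 (h u) (h v) c2 (vertex_item v) u v)"
    using runs_vertex_st[OF conjunct1[OF g1] c1 viZ(1) V, of 13 v] by auto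
  let ?s = "st fl ?L2 (h u) (h v) c2 (vertex_item v) u v"
  let ?e = "Mul (Mul (Sub (Var 3) (Var 21)) (Sub (Var 3) (Var 22))) (Add (Sub (Var 21) (Var 22)) (Sub (Var 22) (Var 21)))"
  let ?c = "Assign 20 (Add (Var 12) (Var 13)) ; insert_prog"
  have se: "safe Z ?e ?s" using \<sigma> bounded_by_D[OF Z] uvZ by (auto simp: st_def with_items_def)
  have ev: "eval ?e ?s \<noteq> 0 \<longleftrightarrow> u < n \<and> v < n \<and> u \<noteq> v" using \<sigma> by (auto simp: st_def with_items_def)
  have "\<exists>L' c' d'. runs Z (if eval ?e ?s \<noteq> 0 then ?c else Nop) ?s (14 * ?m + 10) (st fl L' (h u) (h v) c' d' u v)
    \<and> good L' \<and> set L' = set L \<union> contribution [(u, v)] \<and> c' \<le> Z \<and> d' \<le> Z"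
  proof (cases "u < n \<and> v < n \<and> u \<noteq> v")
    case True
    let ?x = "h u + h v"
    have xi: "?x \<in> items" using True uv by (force simp: items_def edge_item_def)
    then have xZ: "?x \<le> Z" using item_le bounded_by_D(5)[OF Z] order_trans by blast
    have p: "runs Z (Assign 20 (Add (Var 12) (Var 13))) ?s 1 (st fl ?L2 (h u) (h v) c2 ?x u v)"
      by (rule runs_weaken[OF runs_Assign[where w = "vertex_item v"]])
        (use viZ bounded_by_D[OF Z] in \<open>auto simp: st_def with_items_def\<close>)
    obtain c3 where c3: "c3 \<le> Z" and q: "runs Z insert_prog (st fl ?L2 (h u) (h v) c2 ?x u v) (14 * ?m + 9)
        (st fl (ins ?x ?L2) (h u) (h v) c3 ?x u v)"
      using runs_insert_st[OF conjunct1[OF g2] c2 xZ] by blast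
    have g3: "good (ins ?x ?L2) \<and> set (ins ?x ?L2) = insert ?x (set ?L2)" using good_ins g2 xi by blast
    have "(if eval ?e ?s \<noteq> 0 then ?c else Nop) = ?c" by (rule if_P) (use ev True in blast)
    moreover have "runs Z ?c ?s (14 * ?m + 10) (st fl (ins ?x ?L2) (h u) (h v) c3 ?x u v)"
      by (rule runs_weaken[OF runs_Sq[OF p q]]) auto
    ultimately have "runs Z (if eval ?e ?s \<noteq> 0 then ?c else Nop) ?s (14 * ?m + 10) (st fl (ins ?x ?L2) (h u) (h v) c3 ?x u v)"
      by (simp only:)
    moreover have "set (ins ?x ?L2) = set L \<union> contribution [(u, v)]"
    proof -
      have "{(u', v') \<in> set [(u, v)]. u' < n \<and> v' < n \<and> u' \<noteq> v'} = {(u, v)}" using True by auto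
      then have "contribution [(u, v)] = {vertex_item u, vertex_item v, ?x}" by (auto simp: contribution_def edge_item_def)
      then show ?thesis using g1 g2 g3 by auto
    qed
    ultimately show ?thesis using g3 c3 xZ by blast
  next
    case False
    have "(if eval ?e ?s \<noteq> 0 then ?c else Nop) = Nop" by (rule if_not_P) (use ev False in blast)
    moreover have "runs Z Nop ?s (14 * ?m + 10) ?s" by (rule runs_weaken[OF runs_Nop]) auto
    ultimately have "runs Z (if eval ?e ?s \<noteq> 0 then ?c else Nop) ?s (14 * ?m + 10) ?s" by (simp only:)
    moreover have "set ?L2 = set L \<union> contribution [(u, v)]"
    proof -
      have "{(u', v') \<in> set [(u, v)]. u' < n \<and> v' < n \<and> u' \<noteq> v'} = {}" using False by auto
      then have "contribution [(u, v)] = {vertex_item u, vertex_item v}" by (auto simp: contribution_def)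
      then show ?thesis using g1 g2 by auto
    qed
    ultimately show ?thesis using g2 c2 viZ by blast
  qed
  then obtain L' c' d' where 8: "runs Z (if eval ?e ?s \<noteq> 0 then ?c else Nop) ?s (14 * ?m + 10) (st fl L' (h u) (h v) c' d' u v)"
    and fin: "good L' \<and> set L' = set L \<union> contribution [(u, v)] \<and> c' \<le> Z \<and> d' \<le> Z" by blast
  have "runs Z pair_prog (st (u # v # fl) L a b c d e f) (60 * (?m + 1)) (st fl L' (h u) (h v) c' d' u v)"
    unfolding pair_prog_def
    by (rule runs_weaken[OF runs_Sq[OF 1 runs_Sq[OF 2 runs_Sq[OF 3 runs_Sq[OF 4 runs_Sq[OF 5 runs_Sq[OF 6 runs_Sq[OF 7
      runs_If[OF se 8]]]]]]]]]) auto
  then show ?thesis using fin by blast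
qed

lemma contribution_Cons: "contribution (p # F) = contribution [p] \<union> contribution F"
  by (cases p) (auto simp: contribution_def)

lemma runs_pairs:
  assumes "set F \<subseteq> set E" "good L" "a \<le> Z" "b \<le> Z" "c \<le> Z" "d \<le> Z" "e \<le> Z" "f \<le> Z"
  shows "\<exists>L' a' b' c' d' e' f'. runs Z (While (Nonempty 9) pair_prog) (st (flat F) L a b c d e f)
      (length F * (60 * (length (flat E) + 1) + 1) + 1) (st [] L' a' b' c' d' e' f')
    \<and> good L' \<and> set L' = set L \<union> contribution F"
  using assms
proof (induction F arbitrary: L a b c d e f)
  case Nil
  have "runs Z (While (Nonempty 9) pair_prog) (st (flat []) L a b c d e f) (length [] * (60 * (length (flat E) + 1) + 1) + 1) (st [] L a b c d e f)"
    by (rule runs_weaken[OF runs_WhileE]) (auto simp: st_def with_items_def)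
  then show ?case using Nil(2) by (intro exI conjI) (assumption, auto simp: contribution_def)
next
  case (Cons p F)
  obtain u v where p: "p = (u, v)" by (cases p)
  let ?s = "st (flat (p # F)) L a b c d e f"
  obtain L1 c1 d1 where 1: "runs Z pair_prog ?s (60 * (length (flat E) + 1)) (st (flat F) L1 (h u) (h v) c1 d1 u v)"
    and L1: "good L1" "set L1 = set L \<union> contribution [(u, v)]" "c1 \<le> Z" "d1 \<le> Z"
    using runs_pair[of L u v a b c d e f "flat F"] Cons.prems p by auto
  have uv: "u \<le> Z" "v \<le> Z"
    using Cons.prems(1) p bounded_by_D(6)[OF Z] by (force simp: set_flat)+
  obtain L' a' b' c' d' e' f' where 2: "runs Z (While (Nonempty 9) pair_prog) (st (flat F) L1 (h u) (h v) c1 d1 u v)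
      (length F * (60 * (length (flat E) + 1) + 1) + 1) (st [] L' a' b' c' d' e' f')"
    and L': "good L'" "set L' = set L1 \<union> contribution F"
    using Cons.IH[OF _ L1(1) bounded_by_D(10)[OF Z] bounded_by_D(10)[OF Z] L1(3,4) uv] Cons.prems(1) by fastforce
  have e: "eval (Nonempty 9) ?s \<noteq> 0" "safe Z (Nonempty 9) ?s" by (auto simp: st_def with_items_def p)
  have "runs Z (While (Nonempty 9) pair_prog) ?s (length (p # F) * (60 * (length (flat E) + 1) + 1) + 1) (st [] L' a' b' c' d' e' f')"
    by (rule runs_weaken[OF runs_WhileC[OF e(2,1) 1 2]]) auto
  moreover have "set L' = set L \<union> contribution (p # F)" using L' L1 contribution_Cons[of p F] p by auto
  ultimately show ?case using L'(1) by blast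
qed

lemma contribution_E: "contribution E = items"
  by (simp add: contribution_def items_def)

end

text \<open>If all items together do not reach T, there is no solution, and the empty word is a no-instance of
  scheduling as well. In the other case the truncated subtractions are exact.\<close>
definition sched_output :: "nat \<Rightarrow> nat \<Rightarrow> nat list \<Rightarrow> nat list" where
  "sched_output k T L = (if sum_list L < T then [] else
     k * k # ((sum_list L)\<^sup>2 + sum_list (map (\<lambda>x. x\<^sup>2) L) - T\<^sup>2) # 3 * length L # triples (sum_list L - T) (rev L))"

context clique_instance begin

lemma runs_general:
  assumes Z: "bounded_by Z"
    and s: "s 3 = [n]" "s 4 = [k]" "s 6 = [length (flat E)]" "s 7 = rev (flat E)" "s 2 = []"
      "\<And>a. a \<in> {8..22} \<Longrightarrow> s a = []"
  shows "\<exists>s' L. runs Z general_prog s (200 * (length (flat E) + 1)\<^sup>2) s' \<and> distinct L \<and> set L = items \<and> s' 2 = sched_output k (k * cap) L"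
proof -
  let ?m = "length (flat E)"
  note bd = bounded_by_D[OF Z]
  let ?s1 = "s(10 := [base], 11 := [1])"
  have 1: "runs Z (PushE 10 (Add (Add (Var 6) (Var 4)) (Num 1))) s 1 (s(10 := [base]))"
    by (rule runs_weaken[OF runs_PushE]) (use s bd in \<open>auto simp: base_def\<close>)
  have 2: "runs Z (PushE 11 (Num 1)) (s(10 := [base])) 1 ?s1"
    by (rule runs_weaken[OF runs_PushE]) (use s in auto)
  define \<tau> where "\<tau> = (\<lambda>(l, c). s(10 := [base], 9 := l, 11 := [c :: nat]))"
  define f where "f = (\<lambda>(w::nat) (l, c). (w # l, c * base))"
  define I where "I = (\<lambda>i (l :: nat list, c). c = base ^ i)"
  let ?B = "PushE 9 (Var 7) ; Assign 11 (Mul (Var 11) (Var 10))"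
  have sc: "runs Z (scan 7 8 ?B) ((\<tau> ([], 1))(7 := rev (flat E), 8 := [])) (length (rev (flat E)) * (2 + 6) + 2)
      ((\<tau> (fold f (rev (flat E)) ([], 1)))(7 := rev (flat E), 8 := []))
      \<and> I (length (rev (flat E))) (fold f (rev (flat E)) ([], 1))"
  proof (rule runs_scan)
    fix i p ws ws' assume i: "i < length (rev (flat E))" "I i p"
    obtain l c where p: "p = (l, c)" by (cases p)
    let ?y = "rev (flat E) ! i"
    have "?y \<in> verts" using i nth_mem[OF i(1)] by simp
    then have y: "?y \<le> Z" by (rule bd)
    have "base ^ i \<le> cap" using i base3 unfolding cap_def by (intro power_increasing) auto
    then have c: "c \<le> Z" using i p bd by (auto simp: I_def)
    have "runs Z ?B ((\<tau> p)(7 := ?y # ws, 8 := ws')) 2 ((\<tau> (f ?y p))(7 := ?y # ws, 8 := ws'))"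
      by (rule runs_weaken, (rule runs_basic | simp add: \<tau>_def p s bd y c; fail)+)
        (use s in \<open>auto simp: \<tau>_def p f_def\<close>)
    then show "runs Z ?B ((\<tau> p)(7 := ?y # ws, 8 := ws')) 2 ((\<tau> (f ?y p))(7 := ?y # ws, 8 := ws'))
       \<and> I (Suc i) (f ?y p)"
      using i(2) by (auto simp: f_def p I_def)
  qed (use bd in \<open>auto simp: I_def\<close>)
  have fo: "fold f ys (l, c) = (rev ys @ l, c * base ^ length ys)" for ys l c
    by (induction ys arbitrary: l c) (auto simp: f_def)
  let ?s2 = "s(10 := [base], 9 := flat E, 11 := [cap])"
  have a: "(\<tau> ([], 1))(7 := rev (flat E), 8 := []) = ?s1" using s by (auto simp: \<tau>_def)
  have b: "(\<tau> (flat E, cap))(7 := rev (flat E), 8 := []) = ?s2" using s by (auto simp: \<tau>_def)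
  have 3: "runs Z (scan 7 8 ?B) ?s1 (?m * 8 + 2) ?s2"
    using sc unfolding fo a by (simp add: cap_def[symmetric] b)
  interpret program_state n k E "s(10 := [base], 11 := [cap])" Z
    by unfold_locales (use Z s in auto)
  let ?st = "st (flat E) [] 0 0 0 0 0 0"
  let ?I = "PushE 12 (Num 0) ; PushE 13 (Num 0) ; PushE 16 (Num 0) ; PushE 17 (Num 0) ; PushE 18 (Num 0) ;
     PushE 19 (Num 0) ; PushE 20 (Num 0) ; PushE 21 (Num 0) ; PushE 22 (Num 0)"
  have init: "runs Z (PushE 12 (Num 0) ; PushE 13 (Num 0) ; PushE 16 (Num 0) ; PushE 17 (Num 0) ; PushE 18 (Num 0) ;
     PushE 19 (Num 0) ; PushE 20 (Num 0) ; PushE 21 (Num 0) ; PushE 22 (Num 0) ; c) ?s2 (9 + T) s'"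
    if "runs Z c ?st T s'" for c T s'
  proof -
    have e: "?s2(12 := [0], 13 := [0], 16 := [0], 17 := [0], 18 := [0], 19 := [0], 20 := [0], 21 := [0], 22 := [0]) = ?st"
      using s by (auto simp: st_def with_items_def)
    have p: "runs Z (PushE a (Num 0) ; c) t (1 + T) s'" if "runs Z c (t(a := [0])) T s'" "t a = []" "a \<noteq> 0" for a c t T
      using runs_Sq[OF runs_weaken[OF runs_PushE[of a Z "Num 0" t], of 1] that(1)] that by simp
    have "runs Z (PushE 12 (Num 0) ; PushE 13 (Num 0) ; PushE 16 (Num 0) ; PushE 17 (Num 0) ; PushE 18 (Num 0) ;
     PushE 19 (Num 0) ; PushE 20 (Num 0) ; PushE 21 (Num 0) ; PushE 22 (Num 0) ; c) ?s2
       (1 + (1 + (1 + (1 + (1 + (1 + (1 + (1 + (1 + T))))))))) s'"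
      by (intro p) (use that s in \<open>simp_all add: e\<close>)
    then show ?thesis by (rule runs_weaken) auto
  qed
  obtain L a b c d e f where 4: "runs Z (While (Nonempty 9) pair_prog) ?st (length E * (60 * (?m + 1) + 1) + 1) (st [] L a b c d e f)"
    and L: "good L" "set L = items"
    using runs_pairs[of E "[]" 0 0 0 0 0 0] by (auto simp: good_def contribution_E)
  let ?t = "st [] L a b c d e f"
  let ?P = "sum_list L" and ?q = "sum_list (map (\<lambda>x. x\<^sup>2) L)"
  let ?c = "Sub (Mul (Var 4) (Var 11)) (Var 18)"
  have t: "?t 14 = L" "?t 18 = [?P]" "?t 4 = [k]" "?t 11 = [cap]" "?t 17 = [length L]" "?t 19 = [?q]" "?t 2 = []"
    using s by (auto simp: st_def with_items_def)
  have sf: "safe Z ?c ?t" using t bd(3,4) bd(13)[OF L(1)] by simp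
  have ev: "eval ?c ?t \<noteq> 0 \<longleftrightarrow> ?P < k * cap" using t by auto
  have em: "runs Z emit_prog ?t (5 * length L + 4)
    (?t(14 := [], 2 := k * k # (?P\<^sup>2 + ?q - (k * cap)\<^sup>2) # 3 * length L # triples (?P - k * cap) (rev L) @ ?t 2))"
    by (rule runs_emit[OF t(1-6)]) (use bd(3,4,9) bd(11-14)[OF L(1)] in auto)
  have "\<exists>s'. runs Z (if eval ?c ?t \<noteq> 0 then Nop else emit_prog) ?t (10 * ?m + 4) s' \<and> s' 2 = sched_output k (k * cap) L"
  proof (cases "?P < k * cap")
    case True
    have "(if eval ?c ?t \<noteq> 0 then Nop else emit_prog) = Nop" by (rule if_P) (use ev True in blast)
    moreover have "runs Z Nop ?t (10 * ?m + 4) ?t" by (rule runs_weaken[OF runs_Nop]) auto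
    moreover have "?t 2 = sched_output k (k * cap) L" using True t by (simp add: sched_output_def)
    ultimately show ?thesis by auto
  next
    case False
    have "(if eval ?c ?t \<noteq> 0 then Nop else emit_prog) = emit_prog" by (rule if_not_P) (use ev False in blast)
    moreover have "runs Z emit_prog ?t (10 * ?m + 4)
      (?t(14 := [], 2 := k * k # (?P\<^sup>2 + ?q - (k * cap)\<^sup>2) # 3 * length L # triples (?P - k * cap) (rev L) @ ?t 2))"
      by (rule runs_weaken[OF em]) (use good_length[OF L(1)] in auto)
    ultimately show ?thesis using False t by (auto simp: sched_output_def)
  qed
  then obtain s' where 5: "runs Z (if eval ?c ?t \<noteq> 0 then Nop else emit_prog) ?t (10 * ?m + 4) s'"
    and s': "s' 2 = sched_output k (k * cap) L" by blast
  have "length E * (60 * (?m + 1) + 1) \<le> ?m * (60 * (?m + 1) + 1)" by (rule mult_le_mono1) (simp add: length_flat)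
  then have tm: "1 + (1 + (?m * 8 + 2 + (9 + (length E * (60 * (?m + 1) + 1) + 1 + Suc (10 * ?m + 4))))) \<le> 200 * (?m + 1)\<^sup>2"
    by (simp add: power2_eq_square algebra_simps)
  have "runs Z general_prog s (200 * (?m + 1)\<^sup>2) s'" unfolding general_prog_def
    by (rule runs_weaken[OF runs_Sq[OF 1 runs_Sq[OF 2 runs_Sq[OF 3 init[OF runs_Sq[OF 4 runs_If[OF sf 5]]]]]] tm refl])
  then show ?thesis using L s' unfolding good_def by blast
qed

end

section \<open>Parsing of the instance\<close>

definition count_prog :: prog where
  "count_prog = While (Nonempty 1) (Assign 6 (Add (Var 6) (Num 1)) ; Assign 23 (Sub (Num 1) (Var 23)) ; PushE 7 (Var 1) ; Drop 1)"

definition accept_prog :: prog where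
  "accept_prog = PushE 2 (Num 0) ; PushE 2 (Num 0) ; PushE 2 (Num 0)"

text \<open>Truncated differences serve as tests: the announced and the actual number of endpoints
  must agree and be even; \<open>2 - k\<close> is nonzero exactly for k < 2, and
  \<open>k - n\<close> exactly for k > n.\<close>

definition body_prog :: prog where
  "body_prog = PushE 6 (Num 0) ; PushE 23 (Num 0) ; count_prog ;
     If (Add (Add (Sub (Var 5) (Var 6)) (Sub (Var 6) (Var 5))) (Var 23)) Nop
       (If (Sub (Num 2) (Var 4)) (If (Sub (Var 4) (Var 3)) Nop accept_prog) general_prog)"

definition main_prog :: prog where
  "main_prog = If (Nonempty 1) (PushE 3 (Var 1) ; Drop 1 ;
     If (Nonempty 1) (PushE 4 (Var 1) ; Drop 1 ;
       If (Nonempty 1) (PushE 5 (Var 1) ; Drop 1 ; body_prog) Nop) Nop) Nop"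

lemma runs_count:
  assumes "\<And>x. x \<in> set xs \<Longrightarrow> x \<le> Z" "length xs + c \<le> Z" "1 \<le> Z" "b \<le> 1"
  shows "runs Z count_prog (s(1 := xs, 6 := [c], 23 := [b], 7 := ys)) (5 * length xs + 1)
    (s(1 := [], 6 := [c + length xs], 23 := [(b + length xs) mod 2], 7 := rev xs @ ys))"
  using assms
proof (induction xs arbitrary: c b ys)
  case Nil
  show ?case unfolding count_prog_def by (rule runs_weaken[OF runs_WhileE]) (use Nil in auto)
next
  case (Cons x xs)
  let ?s = "s(1 := x # xs, 6 := [c], 23 := [b], 7 := ys)"
  let ?t = "s(1 := xs, 6 := [c + 1], 23 := [1 - b], 7 := x # ys)"
  have 1: "runs Z (Assign 6 (Add (Var 6) (Num 1)) ; Assign 23 (Sub (Num 1) (Var 23)) ; PushE 7 (Var 1) ; Drop 1) ?s 4 ?t"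
    by (rule runs_weaken, (rule runs_basic | use Cons.prems in simp; fail)+) (auto intro!: ext)
  have 2: "runs Z count_prog ?t (5 * length xs + 1)
      (s(1 := [], 6 := [c + 1 + length xs], 23 := [(1 - b + length xs) mod 2], 7 := rev xs @ x # ys))"
    by (rule Cons.IH) (use Cons.prems in auto)
  have e: "eval (Nonempty 1) ?s \<noteq> 0" "safe Z (Nonempty 1) ?s" by auto
  have par: "(1 - b + length xs) mod 2 = (b + length (x # xs)) mod 2"
    using Cons.prems(4) by (cases b) (auto simp: mod2_Suc_Suc)
  show ?case unfolding count_prog_def
    by (rule runs_weaken[OF runs_WhileC[OF e(2,1) 1 2[unfolded count_prog_def par]]]) auto
qed

lemma even_flat: "even (length fl) \<Longrightarrow> \<exists>E. flat E = fl"
proof (induction "length fl" arbitrary: fl rule: less_induct)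
  case less
  show ?case
  proof (cases fl)
    case Nil
    then show ?thesis by (intro exI[of _ "[]"]) simp
  next
    case (Cons u fl')
    then obtain v fl2 where f: "fl = u # v # fl2" using less.prems by (cases fl') auto
    then obtain E where "flat E = fl2" using less by fastforce
    then show ?thesis using f by (intro exI[of _ "(u, v) # E"]) simp
  qed
qed

text \<open>For k < 2 the construction of items breaks down, and [0, 0, 0] is the instance without jobs, which
  is a yes-instance.\<close>
definition reduces :: "nat list \<Rightarrow> nat list \<Rightarrow> bool" where
  "reduces xs out \<longleftrightarrow> (if \<exists>n k E. xs = n # k # length (flat E) # flat E
     then \<exists>n k E. xs = n # k # length (flat E) # flat E \<and>
       (if k < 2 then out = (if k \<le> n then [0, 0, 0] else [])
        else \<exists>L. distinct L \<and> set L = clique_instance.items n k E \<and> out = sched_output k (k * clique_instance.cap k E) L)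
     else out = [])"

lemma runs_branch_true:
  assumes "runs Z c1 s T s'" "s a = x # xs" "a \<noteq> 0"
  shows "runs Z (If (Nonempty a) c1 c2) s (Suc T) s'"
proof -
  have "(if eval (Nonempty a) s \<noteq> 0 then c1 else c2) = c1" using assms by simp
  then show ?thesis using assms by (intro runs_If) auto
qed

lemma runs_branch_false:
  assumes "s a = []" "a \<noteq> 0"
  shows "runs Z (If (Nonempty a) c1 Nop) s 2 s"
proof -
  have "(if eval (Nonempty a) s \<noteq> 0 then c1 else Nop) = Nop" using assms by simp
  then have "runs Z (if eval (Nonempty a) s \<noteq> 0 then c1 else Nop) s 1 s" by (simp only: runs_Nop)
  then show ?thesis by (rule_tac runs_weaken[OF runs_If]) (use assms in auto)
qed

lemma runs_body:
  assumes Z: "\<And>x. x \<in> set fl \<Longrightarrow> x \<le> Z" "length fl \<le> Z" "1 \<le> Z" "n \<le> Z" "k \<le> Z" "m \<le> Z"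
    and bounded: "\<And>E. fl = flat E \<Longrightarrow> 2 \<le> k \<Longrightarrow> clique_instance.bounded_by n k E Z"
  shows "\<exists>s'. runs Z body_prog ((\<lambda>_. [])(1 := fl, 3 := [n], 4 := [k], 5 := [m])) (250 * (length fl + 1)\<^sup>2) s'
     \<and> reduces (n # k # m # fl) (s' 2)"
proof -
  let ?s = "(\<lambda>_. [])(1 := fl, 3 := [n], 4 := [k], 5 := [m]) :: env"
  let ?l = "length fl"
  have 1: "runs Z (PushE 6 (Num 0)) ?s 1 (?s(6 := [0]))"
    by (rule runs_weaken[OF runs_PushE]) auto
  have 2: "runs Z (PushE 23 (Num 0)) (?s(6 := [0])) 1 (?s(1 := fl, 6 := [0], 23 := [0], 7 := []))"
    by (rule runs_weaken[OF runs_PushE]) auto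
  let ?t = "?s(1 := [], 6 := [0 + ?l], 23 := [(0 + ?l) mod 2], 7 := rev fl @ [])"
  have 3: "runs Z count_prog (?s(1 := fl, 6 := [0], 23 := [0], 7 := [])) (5 * ?l + 1) ?t"
    by (rule runs_count) (use Z in auto)
  let ?e = "Add (Add (Sub (Var 5) (Var 6)) (Sub (Var 6) (Var 5))) (Var 23)"
  let ?G = "If (Sub (Num 2) (Var 4)) (If (Sub (Var 4) (Var 3)) Nop accept_prog) general_prog"
  have par: "?l mod 2 \<le> Z" using Z(3) mod_less_divisor[of 2 ?l] by linarith
  have se: "safe Z ?e ?t" using Z par by simp
  have ev: "eval ?e ?t \<noteq> 0 \<longleftrightarrow> \<not> (?l = m \<and> even ?l)" by (cases "even ?l") (auto elim: oddE)
  have tlen: "1 + (1 + (5 * ?l + 1 + Suc (220 * (?l + 1)\<^sup>2))) \<le> 250 * (?l + 1)\<^sup>2"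
    by (simp add: power2_eq_square algebra_simps)
  \<comment> \<open>All cases share the instructions up to the format test; only the branch taken
    after it remains to be supplied.\<close>
  have wrap: "\<exists>s'. runs Z body_prog ?s (250 * (?l + 1)\<^sup>2) s' \<and> reduces (n # k # m # fl) (s' 2)"
    if "runs Z (if eval ?e ?t \<noteq> 0 then Nop else ?G) ?t (220 * (?l + 1)\<^sup>2) s'" "reduces (n # k # m # fl) (s' 2)" for s'
    unfolding body_prog_def
    using runs_weaken[OF runs_Sq[OF 1 runs_Sq[OF 2 runs_Sq[OF 3 runs_If[OF se that(1)]]]] tlen refl] that(2) by blast
  show ?thesis
  proof (cases "?l = m \<and> even ?l")
    case False
    have nE: "\<not> (\<exists>n' k' E. n # k # m # fl = n' # k' # length (flat E) # flat E)"
    proof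
      assume "\<exists>n' k' E. n # k # m # fl = n' # k' # length (flat E) # flat E"
      then obtain E where "m = length (flat E)" "fl = flat E" by blast
      then show False using False length_flat[of E] by simp
    qed
    have "(if eval ?e ?t \<noteq> 0 then Nop else ?G) = Nop" by (rule if_P) (use ev False in blast)
    moreover have "runs Z Nop ?t (220 * (?l + 1)\<^sup>2) ?t" by (rule runs_weaken[OF runs_Nop]) auto
    ultimately have "runs Z (if eval ?e ?t \<noteq> 0 then Nop else ?G) ?t (220 * (?l + 1)\<^sup>2) ?t" by (simp only:)
    moreover have "reduces (n # k # m # fl) (?t 2)" unfolding reduces_def if_not_P[OF nE] by simp
    ultimately show ?thesis by (rule wrap)
  next
    case True
    then obtain E where E: "flat E = fl" using even_flat by blast
    then have xs: "n # k # m # fl = n # k # length (flat E) # flat E" using True by simp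
    then have ex: "\<exists>n' k' E. n # k # m # fl = n' # k' # length (flat E) # flat E" by blast
    have G: "(if eval ?e ?t \<noteq> 0 then Nop else ?G) = ?G" by (rule if_not_P) (use ev True in blast)
    show ?thesis
    proof (cases "k < 2")
      case k: True
      let ?o = "if k \<le> n then [0, 0, 0] else []"
      have "(if eval (Sub (Var 4) (Var 3)) ?t \<noteq> 0 then Nop else accept_prog) = (if k \<le> n then accept_prog else Nop)"
        by simp
      moreover have "runs Z (if k \<le> n then accept_prog else Nop) ?t 3 (?t(2 := ?o))"
      proof (cases "k \<le> n")
        case True
        have "runs Z accept_prog ?t 3 (?t(2 := [0, 0, 0]))" unfolding accept_prog_def
          by (rule runs_weaken, (rule runs_basic | simp; fail)+)
        then show ?thesis using True by simp
      next
        case False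
        have "runs Z Nop ?t 3 (?t(2 := []))" by (rule runs_weaken[OF runs_Nop]) auto
        then show ?thesis using False by simp
      qed
      ultimately have "runs Z (if eval (Sub (Var 4) (Var 3)) ?t \<noteq> 0 then Nop else accept_prog) ?t 3 (?t(2 := ?o))"
        by (simp only:)
      then have i: "runs Z (If (Sub (Var 4) (Var 3)) Nop accept_prog) ?t (Suc 3) (?t(2 := ?o))"
        by (rule runs_If[rotated]) (use Z in simp)
      have "(if eval (Sub (Num 2) (Var 4)) ?t \<noteq> 0 then If (Sub (Var 4) (Var 3)) Nop accept_prog else general_prog)
          = If (Sub (Var 4) (Var 3)) Nop accept_prog" using k by simp
      then have "runs Z (if eval (Sub (Num 2) (Var 4)) ?t \<noteq> 0 then If (Sub (Var 4) (Var 3)) Nop accept_prog else general_prog)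
          ?t (Suc 3) (?t(2 := ?o))" using i by (simp only:)
      then have g: "runs Z ?G ?t (Suc (Suc 3)) (?t(2 := ?o))" by (rule runs_If[rotated]) (use Z in simp)
      have "runs Z (if eval ?e ?t \<noteq> 0 then Nop else ?G) ?t (220 * (?l + 1)\<^sup>2) (?t(2 := ?o))"
        unfolding G by (rule runs_weaken[OF g]) (auto simp: power2_eq_square)
      moreover have "reduces (n # k # m # fl) ((?t(2 := ?o)) 2)"
        unfolding reduces_def if_P[OF ex] using k by (intro exI conjI, rule_tac xs) simp
      ultimately show ?thesis by (rule wrap)
    next
      case False
      then interpret clique_instance n k E by unfold_locales simp
      have bd: "bounded_by Z" using bounded[of E] E False by simp
      obtain s' L where r: "runs Z general_prog ?t (200 * (length (flat E) + 1)\<^sup>2) s'"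
        and L: "distinct L" "set L = items" and o: "s' 2 = sched_output k (k * cap) L"
        using runs_general[OF bd, of ?t] E by auto
      have "(if eval (Sub (Num 2) (Var 4)) ?t \<noteq> 0 then If (Sub (Var 4) (Var 3)) Nop accept_prog else general_prog)
          = general_prog" using False by simp
      then have "runs Z (if eval (Sub (Num 2) (Var 4)) ?t \<noteq> 0 then If (Sub (Var 4) (Var 3)) Nop accept_prog else general_prog)
          ?t (200 * (length (flat E) + 1)\<^sup>2) s'" using r by (simp only:)
      then have g: "runs Z ?G ?t (Suc (200 * (length (flat E) + 1)\<^sup>2)) s'" by (rule runs_If[rotated]) (use Z in simp)
      have "runs Z (if eval ?e ?t \<noteq> 0 then Nop else ?G) ?t (220 * (?l + 1)\<^sup>2) s'"
        unfolding G by (rule runs_weaken[OF g]) (auto simp: E power2_eq_square)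
      moreover have "reduces (n # k # m # fl) (s' 2)"
        unfolding reduces_def if_P[OF ex] using False L o by (intro exI conjI, rule_tac xs) auto
      ultimately show ?thesis by (rule wrap)
    qed
  qed
qed

lemma reduces_short: "length xs < 3 \<Longrightarrow> reduces xs []"
  by (auto simp: reduces_def)

lemma runs_main:
  assumes Z: "\<And>x. x \<in> set xs \<Longrightarrow> x \<le> Z" "length xs \<le> Z" "1 \<le> Z"
    and bounded: "\<And>n k m E. xs = n # k # m # flat E \<Longrightarrow> 2 \<le> k \<Longrightarrow> clique_instance.bounded_by n k E Z"
  shows "\<exists>s'. runs Z main_prog (input_env xs) (300 * (length xs + 1)\<^sup>2) s' \<and> reduces xs (s' 2)"
proof -
  let ?T = "300 * (length xs + 1)\<^sup>2"
  have T: "9 + 250 * (length xs + 1)\<^sup>2 \<le> ?T" by (simp add: power2_eq_square)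
  have pd: "runs Z (PushE a (Var 1) ; Drop 1 ; c) s (2 + t) s'"
    if "runs Z c (s(a := x # s a, 1 := ys)) t s'" "s 1 = x # ys" "x \<le> Z" "a \<noteq> 0" "a \<noteq> 1" for a c s t s' x ys
  proof -
    have 1: "runs Z (PushE a (Var 1)) s 1 (s(a := x # s a))"
      by (rule runs_weaken[OF runs_PushE]) (use that in auto)
    have 2: "runs Z (Drop 1) (s(a := x # s a)) 1 (s(a := x # s a, 1 := ys))"
      by (rule runs_Drop) (use that in auto)
    show ?thesis by (rule runs_weaken[OF runs_Sq[OF 1 runs_Sq[OF 2 that(1)]]]) auto
  qed
  let ?I2 = "If (Nonempty 1) (PushE 5 (Var 1) ; Drop 1 ; body_prog) Nop"
  let ?I1 = "If (Nonempty 1) (PushE 4 (Var 1) ; Drop 1 ; ?I2) Nop"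
  show ?thesis
  proof (cases xs)
    case Nil
    have "runs Z main_prog (input_env xs) ?T (input_env xs)" unfolding main_prog_def
      by (rule runs_weaken[OF runs_branch_false]) (use T Nil in \<open>auto simp: input_env_def\<close>)
    then show ?thesis using Nil reduces_short[of xs] by (auto simp: input_env_def)
  next
    case xs1: (Cons n ys1)
    show ?thesis
    proof (cases ys1)
      case Nil
      let ?s = "(input_env xs)(3 := n # input_env xs 3, 1 := ys1)"
      have f: "runs Z ?I1 ?s 2 ?s" by (rule runs_branch_false) (use Nil in auto)
      have "runs Z main_prog (input_env xs) ?T ?s" unfolding main_prog_def
        by (rule runs_weaken[OF runs_branch_true[OF pd[OF f]]]) (use T Z xs1 in \<open>auto simp: input_env_def\<close>)
      then show ?thesis using Nil xs1 reduces_short[of xs] by (intro exI[of _ ?s] conjI) (auto simp: input_env_def)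
    next
      case xs2: (Cons k ys2)
      let ?s = "(input_env xs)(3 := n # input_env xs 3, 1 := ys1)"
      let ?t = "?s(4 := k # ?s 4, 1 := ys2)"
      show ?thesis
      proof (cases ys2)
        case Nil
        have f: "runs Z ?I2 ?t 2 ?t" by (rule runs_branch_false) (use Nil in auto)
        have g: "runs Z ?I1 ?s (Suc (2 + 2)) ?t"
          by (rule runs_branch_true[OF pd[OF f]]) (use Z xs1 xs2 in auto)
        have "runs Z main_prog (input_env xs) ?T ?t" unfolding main_prog_def
          by (rule runs_weaken[OF runs_branch_true[OF pd[OF g]]]) (use T Z xs1 in \<open>auto simp: input_env_def\<close>)
        then show ?thesis using Nil xs1 xs2 reduces_short[of xs] by (intro exI[of _ ?t] conjI) (auto simp: input_env_def)
      next
        case xs3: (Cons m fl)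
        let ?u = "?t(5 := m # ?t 5, 1 := fl)"
        have u: "?u = (\<lambda>_. [])(1 := fl, 3 := [n], 4 := [k], 5 := [m])" by (rule ext) (auto simp: input_env_def)
        obtain s' where b: "runs Z body_prog ?u (250 * (length fl + 1)\<^sup>2) s'" and r: "reduces (n # k # m # fl) (s' 2)"
          unfolding u using runs_body[of fl Z n k m] Z bounded xs1 xs2 xs3 by auto
        have g: "runs Z ?I2 ?t (Suc (2 + 250 * (length fl + 1)\<^sup>2)) s'"
          by (rule runs_branch_true[OF pd[OF b]]) (use Z xs1 xs2 xs3 in auto)
        have h: "runs Z ?I1 ?s (Suc (2 + Suc (2 + 250 * (length fl + 1)\<^sup>2))) s'"
          by (rule runs_branch_true[OF pd[OF g]]) (use Z xs1 xs2 in auto)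
        have "(length fl + 1)\<^sup>2 \<le> (length xs + 1)\<^sup>2" using xs1 xs2 xs3 by (intro power_mono) auto
        then have t: "Suc (2 + Suc (2 + Suc (2 + 250 * (length fl + 1)\<^sup>2))) \<le> ?T" using T by linarith
        have "runs Z main_prog (input_env xs) ?T s'" unfolding main_prog_def
          by (rule runs_weaken[OF runs_branch_true[OF pd[OF h]] t]) (use Z xs1 in \<open>auto simp: input_env_def\<close>)
        then show ?thesis using r xs1 xs2 xs3 by auto
      qed
    qed
  qed
qed

section \<open>Digit lengths in terms of the input length\<close>

lemma length_enc_nat: "length (enc_nat n) = 2 * lb n + 2"
  by (simp add: enc_nat_dbl length_dbl)

lemma element_bits: "x \<in> set xs \<Longrightarrow> lb x \<le> length (encs xs)"
proof (induction xs)
  case (Cons y ys)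
  then show ?case using length_enc_nat[of y] by (cases "x = y") simp_all
qed simp

lemma length_le_encs: "2 * length xs \<le> length (encs xs)"
proof (induction xs)
  case (Cons y ys)
  then show ?case using length_enc_nat[of y] by simp
qed simp

lemma less_exp_encs:
  assumes "x \<in> set xs"
  shows "x < 2 ^ length (encs xs)"
proof -
  have "x < 2 ^ lb x" using val_less[of "bits x"] unfolding val_bits .
  also have "\<dots> \<le> 2 ^ length (encs xs)" by (rule power_increasing[OF element_bits[OF assms]]) simp
  finally show ?thesis .
qed

text \<open>The cap is a power whose exponent and whose base's digit length are both linear in the
  input length l. So it has about l (l + 1) digits, its square twice as many, and 2 (l + 2)^2 digits
  cover the remaining factors: values are exponential, digit lengths quadratic.\<close>

lemma runs_main_encs:
  fixes xs :: "nat list"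
  defines "b \<equiv> length (encs xs) + 2"
  shows "\<exists>s'. runs (2 ^ (2 * b\<^sup>2)) main_prog (input_env xs) (300 * b\<^sup>2) s' \<and> reduces xs (s' 2)"
proof -
  let ?Z = "2 ^ (2 * b\<^sup>2) :: nat"
  let ?l = "length (encs xs)"
  have pow: "2 ^ j \<le> ?Z" if "j \<le> 2 * b\<^sup>2" for j using that by (intro power_increasing) auto
  have lz: "?l \<le> 2 * b\<^sup>2" by (simp add: b_def power2_eq_square)
  have el: "x \<le> ?Z" if "x \<in> set xs" for x using less_exp_encs[OF that] pow[OF lz] by linarith
  have len: "length xs < 2 ^ ?l" using length_le_encs[of xs] less_exp[of ?l] by linarith
  have bounded: "clique_instance.bounded_by n k E ?Z" if xs: "xs = n # k # m # flat E" and k: "2 \<le> k" for n k m E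
  proof -
    interpret clique_instance n k E using k by unfold_locales
    let ?m = "length (flat E)"
    have ml: "?m + 1 \<le> 2 ^ ?l" "?m \<le> ?l" using len length_le_encs[of xs] xs by auto
    have "k < 2 ^ ?l" using less_exp_encs[of k xs] xs by simp
    then have base: "base \<le> 2 ^ (?l + 1)" using ml by (simp add: base_def)
    then have "cap \<le> (2 ^ (?l + 1)) ^ ?m" unfolding cap_def by (rule power_mono) simp
    also have "\<dots> \<le> (2 ^ (?l + 1)) ^ ?l" using ml by (intro power_increasing) auto
    also have "\<dots> = 2 ^ ((?l + 1) * ?l)" by (simp only: power_mult)
    finally have cap: "cap \<le> 2 ^ ((?l + 1) * ?l)" .
    have "cap\<^sup>2 \<le> (2 ^ ((?l + 1) * ?l))\<^sup>2" using cap by (rule power_mono) simp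
    also have "\<dots> = 2 ^ (2 * ((?l + 1) * ?l))" by (simp only: power_mult[symmetric] mult.commute)
    finally have "16 * (?m + 1) * cap\<^sup>2 \<le> 2 ^ 4 * 2 ^ ?l * 2 ^ (2 * ((?l + 1) * ?l))"
      using ml by (intro mult_le_mono) auto
    also have "\<dots> = 2 ^ (4 + ?l + 2 * ((?l + 1) * ?l))" by (simp only: power_add)
    also have "\<dots> \<le> ?Z" by (rule pow) (simp add: b_def power2_eq_square algebra_simps)
    finally have "16 * (?m + 1) * cap\<^sup>2 \<le> ?Z" .
    moreover have "base \<le> ?Z" using base pow[of "?l + 1"] by (simp add: b_def power2_eq_square)
    ultimately show ?thesis unfolding bounded_by_def using el xs by auto
  qed
  have "length xs \<le> ?Z" "1 \<le> ?Z" using len pow[OF lz] by linarith+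
  note zz = this
  have "\<exists>s'. runs ?Z main_prog (input_env xs) (300 * (length xs + 1)\<^sup>2) s' \<and> reduces xs (s' 2)"
    by (rule runs_main[OF _ zz]) (fact el, fact bounded)
  then obtain s' where r: "runs ?Z main_prog (input_env xs) (300 * (length xs + 1)\<^sup>2) s'" and s': "reduces xs (s' 2)"
    by blast
  have "length xs + 1 \<le> b" using length_le_encs[of xs] by (simp add: b_def)
  then have "300 * (length xs + 1)\<^sup>2 \<le> 300 * b\<^sup>2" by (intro mult_le_mono2 power_mono) auto
  then show ?thesis using runs_weaken[OF r _ refl] s' by blast
qed

section \<open>Encodings and the composed reduction\<close>

text \<open>The terminator 01 is the first pair of unequal bits, so it cannot be mistaken for a
  digit.\<close>

lemma dbl_prefix_free:
  "dbl ds @ False # True # r = dbl ds' @ False # True # r' \<Longrightarrow> ds = ds' \<and> r = r'"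
proof (induction ds arbitrary: ds')
  case Nil
  then show ?case by (cases ds') auto
next
  case (Cons d ds)
  then show ?case by (cases ds') auto
qed

lemma encs_inj: "encs xs = encs ys \<Longrightarrow> xs = ys"
proof (induction xs arbitrary: ys)
  case Nil
  show ?case using Nil.prems[symmetric, unfolded encs_simps encs_eq_Nil] by (rule sym)
next
  case (Cons x xs)
  have "encs ys \<noteq> []" unfolding Cons.prems[symmetric] encs_eq_Nil by simp
  then obtain y ys' where ys: "ys = y # ys'" by (metis encs_simps(1) list.exhaust)
  have "dbl (bits x) @ False # True # encs xs = dbl (bits y) @ False # True # encs ys'"
    using Cons.prems unfolding ys encs_simps enc_nat_dbl append_assoc append_Cons append_Nil .
  then have e: "bits x = bits y" "encs xs = encs ys'" using dbl_prefix_free by blast+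
  have "x = y" using arg_cong[OF e(1), of val] by (simp only: val_bits)
  then show ?case using Cons.IH[OF e(2)] ys by simp
qed

lemma encs_eq_iff: "encs xs = encs ys \<longleftrightarrow> xs = ys"
  using encs_inj by blast

lemma decode_encs: "decode (encs xs) = xs"
  using encs_inj[of xs "decode (encs xs)"] encs_decode[of "encs xs"] by simp

lemma flat_inj: "flat E = flat E' \<Longrightarrow> E = E'"
proof (induction E arbitrary: E')
  case Nil
  then show ?case by (cases E') auto
next
  case (Cons p E)
  then show ?case by (cases p; cases E') auto
qed

lemma enc_clique_encs: "enc_clique n k E = encs (n # k # length (flat E) # flat E)"
  by (simp add: enc_clique_def enc_list_def encs_def flat_def)

definition flat3 :: "(nat \<times> nat \<times> nat) list \<Rightarrow> nat list" where
  "flat3 J = concat (map (\<lambda>(p, w, e). [p, w, e]) J)"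

lemma flat3_inj: "flat3 J = flat3 J' \<Longrightarrow> J = J'"
proof (induction J arbitrary: J')
  case Nil
  then show ?case by (cases J') (auto simp: flat3_def)
next
  case (Cons p J)
  then show ?case by (cases p; cases J') (auto simp: flat3_def)
qed

lemma enc_sched_encs: "enc_sched k B J = encs (k # B # length (flat3 J) # flat3 J)"
  by (simp add: enc_sched_def enc_list_def encs_def flat3_def)

lemma CLIQUE_iff: "enc_clique n k E \<in> CLIQUE \<longleftrightarrow> has_clique n k E"
proof
  assume "enc_clique n k E \<in> CLIQUE"
  then obtain n' k' E' where e: "enc_clique n k E = enc_clique n' k' E'" and h: "has_clique n' k' E'"
    by (auto simp: CLIQUE_def)
  then have "n = n'" "k = k'" "E = E'" unfolding enc_clique_encs encs_eq_iff using flat_inj by auto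
  then show "has_clique n k E" using h by simp
qed (auto simp: CLIQUE_def)

lemma SCHED_REJ_iff:
  "enc_sched k B J \<in> SCHED_REJ \<longleftrightarrow> (\<exists>Rej S. feasible_sched J k Rej S \<and> sched_cost J Rej S \<le> B)"
proof
  assume "enc_sched k B J \<in> SCHED_REJ"
  then obtain k' B' J' where e: "enc_sched k B J = enc_sched k' B' J'"
    and h: "\<exists>Rej S. feasible_sched J' k' Rej S \<and> sched_cost J' Rej S \<le> B'"
    unfolding SCHED_REJ_def by blast
  then have "k = k'" "B = B'" "J = J'" unfolding enc_sched_encs encs_eq_iff using flat3_inj by auto
  then show "\<exists>Rej S. feasible_sched J k Rej S \<and> sched_cost J Rej S \<le> B" using h by simp
qed (unfold SCHED_REJ_def, blast)

lemma kappa_clique_enc: "kappa_clique (enc_clique n k E) = k"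
proof -
  have "(THE k'. \<exists>n' E'. enc_clique n k E = enc_clique n' k' E') = k"
    by (rule the_equality) (auto simp: enc_clique_encs encs_eq_iff simp del: encs_simps)
  then show ?thesis unfolding kappa_clique_def by auto
qed

lemma kappa_sched_enc: "kappa_sched (enc_sched k B J) = k"
proof -
  have "(THE k'. \<exists>B' J'. enc_sched k B J = enc_sched k' B' J') = k"
    by (rule the_equality) (auto simp: enc_sched_encs encs_eq_iff simp del: encs_simps)
  then show ?thesis unfolding kappa_sched_def by auto
qed

lemma Nil_not_enc: "[] \<noteq> enc_sched k B J" "[] \<noteq> enc_clique n k E"
  unfolding enc_sched_encs enc_clique_encs by (metis encs_eq_Nil list.distinct(1))+

lemma Nil_sched: "[] \<notin> SCHED_REJ" "kappa_sched [] = 0"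
  using Nil_not_enc(1) by (auto simp: SCHED_REJ_def kappa_sched_def)

lemma length_triples: "length (triples D its) = 3 * length its"
  by (induction its) auto

lemma (in clique_instance) sched_output_correct:
  assumes L: "distinct L" "set L = items"
  shows "(encs (sched_output k (k * cap) L) \<in> SCHED_REJ \<longleftrightarrow> has_clique n k E)
     \<and> kappa_sched (encs (sched_output k (k * cap) L)) \<le> k * k"
proof -
  let ?T = "k * cap"
  have sum: "sum_list L = \<Sum>items" using L by (metis sum_list_distinct_conv_sum_set map_ident)
  have clique: "has_clique n k E \<longleftrightarrow> (\<exists>Y \<subseteq> items. card Y \<le> k * k \<and> \<Sum>Y = ?T)"
    using clique_from_selection selection_from_clique by meson
  show ?thesis
  proof (cases "sum_list L < ?T")
    case True
    have "\<Sum>Y \<noteq> ?T" if "Y \<subseteq> items" for Y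
    proof -
      have "\<Sum>Y \<le> \<Sum>items" by (rule sum_mono2[OF finite_items that]) simp
      then show ?thesis using True unfolding sum by linarith
    qed
    then have "\<not> has_clique n k E" unfolding clique by blast
    then show ?thesis using True Nil_sched by (simp add: sched_output_def)
  next
    case False
    let ?J = "job_list (sum_list L - ?T) (rev L)"
    let ?B = "(sum_list L)\<^sup>2 + sum_list (map (\<lambda>x. x\<^sup>2) L) - ?T\<^sup>2"
    have "triples (sum_list L - ?T) (rev L) = flat3 ?J" by (simp add: triples_def flat3_def)
    then have e: "encs (sched_output k ?T L) = enc_sched (k * k) ?B ?J"
      using False length_triples[of "sum_list L - ?T" "rev L"]
      by (simp add: sched_output_def enc_sched_encs)
    have "(\<exists>Rej S. feasible_sched ?J (k * k) Rej S \<and> sched_cost ?J Rej S \<le> ?B)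
       \<longleftrightarrow> (\<exists>Y \<subseteq> set (rev L). card Y \<le> k * k \<and> \<Sum>Y = ?T)"
      using rejection_iff_subset_sum[of "rev L" ?T "k * k"] L items_pos False
      by (simp add: sum_list_rev rev_map[symmetric])
    then show ?thesis unfolding e SCHED_REJ_iff kappa_sched_enc clique using L by simp
  qed
qed

text \<open>A set with at most one element contains no pair that would have to be adjacent.\<close>

lemma has_clique_small:
  assumes "k < 2"
  shows "has_clique n k E \<longleftrightarrow> k \<le> n"
proof
  assume "has_clique n k E"
  then obtain S where "S \<subseteq> {..<n}" "card S = k" unfolding has_clique_def by blast
  then show "k \<le> n" using card_mono[of "{..<n}" S] by simp
next
  assume "k \<le> n"
  then have "{..<k} \<subseteq> {..<n}" "card {..<k} = k" by auto
  moreover have "u = v" if "u \<in> {..<k}" "v \<in> {..<k}" for u v using that assms by auto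
  ultimately show "has_clique n k E" unfolding has_clique_def by blast
qed

lemma reduces_correct:
  assumes "reduces (decode y) out"
  shows "(encs out \<in> SCHED_REJ \<longleftrightarrow> y \<in> CLIQUE) \<and> kappa_sched (encs out) \<le> kappa_clique y ^ 2"
proof (cases "\<exists>n k E. y = enc_clique n k E")
  case False
  have "\<not> (\<exists>n k E. decode y = n # k # length (flat E) # flat E)"
  proof
    assume "\<exists>n k E. decode y = n # k # length (flat E) # flat E"
    then obtain n k E where d: "decode y = n # k # length (flat E) # flat E" by blast
    \<comment> \<open>Words outside the range decode to the empty list, which does not have the form
      of an instance.\<close>
    then have "y \<in> range encs" using encs_decode[of y] by (metis encs_eq_Nil list.distinct(1))
    then have "y = enc_clique n k E" using encs_decode[of y] d by (simp add: enc_clique_encs)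
    then show False using False by blast
  qed
  then have "out = []" using assms unfolding reduces_def by simp
  moreover have "y \<notin> CLIQUE" using False by (auto simp: CLIQUE_def)
  ultimately show ?thesis using Nil_sched by simp
next
  case True
  then obtain n k E where y: "y = enc_clique n k E" by blast
  then have d: "decode y = n # k # length (flat E) # flat E" by (simp only: enc_clique_encs decode_encs)
  obtain n' k' E' where "decode y = n' # k' # length (flat E') # flat E'"
    and o': "if k' < 2 then out = (if k' \<le> n' then [0, 0, 0] else [])
        else \<exists>L. distinct L \<and> set L = clique_instance.items n' k' E' \<and> out = sched_output k' (k' * clique_instance.cap k' E') L"
    using assms d unfolding reduces_def by metis
  then have "n' = n" "k' = k" "E' = E" using d flat_inj by auto
  note o = o'[unfolded this]
  show ?thesis
  proof (cases "k < 2")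
    case True
    have e: "encs [0, 0, 0] = enc_sched 0 0 []" by (simp add: enc_sched_encs flat3_def)
    have "enc_sched 0 0 [] \<in> SCHED_REJ"
      unfolding SCHED_REJ_iff by (intro exI[of _ "{}"] exI[of _ "\<lambda>_. 0"]) (simp add: feasible_sched_def sched_cost_def)
    then show ?thesis using o True Nil_sched has_clique_small[OF True, of n E] e kappa_sched_enc[of 0 0 "[]"]
      unfolding y CLIQUE_iff by (cases "k \<le> n") (simp_all del: encs_simps(2))
  next
    case False
    then interpret clique_instance n k E by unfold_locales simp
    obtain L where L: "distinct L" "set L = items" "out = sched_output k (k * cap) L" using o False by auto
    show ?thesis using sched_output_correct[OF L(1,2)] unfolding y CLIQUE_iff L(3) kappa_clique_enc
      by (simp add: power2_eq_square)
  qed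
qed

section \<open>Computable bounds and the composed reduction\<close>

fun power_exp :: "nat \<Rightarrow> exp" where
  "power_exp 0 = Num 1"
| "power_exp (Suc d) = Mul (Add (Var 1) (Num 1)) (power_exp d)"

lemma power_exp:
  "eval (power_exp d) s = (hd (s 1) + 1) ^ d"
  "s 1 \<noteq> [] \<Longrightarrow> hd (s 1) \<le> Z \<Longrightarrow> safe Z (power_exp d) s"
  by (induction d) auto

text \<open>The bounds in an fpt-reduction must be computable. The polynomial overheads turn the
  given f and g into functions of this shape, computed by attaching a power program to the given
  machine.\<close>

lemma computable_majorant:
  assumes "computable_nat f"
  shows "computable_nat (\<lambda>n. a * (f n + 1) ^ d)"
proof -
  obtain M where wf: "wf_tm M" and M: "\<And>n. \<exists>t. halted M ((tm_step M ^^ t) (tm_init (enc_nat n)))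
       \<and> tm_output ((tm_step M ^^ t) (tm_init (enc_nat n))) = enc_nat (f n)"
    using assms unfolding computable_nat_def by blast
  let ?p = "PushE 2 (Mul (Num a) (power_exp d))"
  obtain M' b where wf': "wf_tm M'" and M': "\<And>x t u Z s'. halted M ((tm_step M ^^ t) (tm_init x)) \<Longrightarrow>
    bs Z ?p (input_env (decode (tm_output ((tm_step M ^^ t) (tm_init x))))) u s' \<Longrightarrow>
    (\<exists>n \<le> b * (length x + t + u * (lb Z + 1) ^ 2 + 1) ^ 2. halted M' ((tm_step M' ^^ n) (tm_init x))
       \<and> tm_output ((tm_step M' ^^ n) (tm_init x)) = encs (s' 2))"
    using pipeline[OF wf, of ?p] by blast
  have "\<exists>t. halted M' ((tm_step M' ^^ t) (tm_init (enc_nat n)))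
       \<and> tm_output ((tm_step M' ^^ t) (tm_init (enc_nat n))) = enc_nat (a * (f n + 1) ^ d)" for n
  proof -
    obtain t where t: "halted M ((tm_step M ^^ t) (tm_init (enc_nat n)))"
       "tm_output ((tm_step M ^^ t) (tm_init (enc_nat n))) = enc_nat (f n)" using M by blast
    have d: "decode (enc_nat (f n)) = [f n]" using decode_encs[of "[f n]"] by simp
    let ?s = "input_env [f n]"
    have "bs (f n) ?p ?s 1 (?s(2 := eval (Mul (Num a) (power_exp d)) ?s # ?s 2))"
      by (rule bs.PushE) (auto simp: input_env_def intro!: power_exp)
    then have "\<exists>m. halted M' ((tm_step M' ^^ m) (tm_init (enc_nat n)))
       \<and> tm_output ((tm_step M' ^^ m) (tm_init (enc_nat n))) = encs ((?s(2 := eval (Mul (Num a) (power_exp d)) ?s # ?s 2)) 2)"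
      using M'[OF t(1), of "f n" 1] unfolding t(2) d by blast
    then show ?thesis by (simp add: power_exp input_env_def)
  qed
  then show ?thesis using wf' unfolding computable_nat_def by blast
qed

text \<open>Reuses the simulation by a stack program: it leaves the output on a stack, and stacks
  grow by at most one bit per step.\<close>

lemma output_length:
  assumes "wf_tm M"
  shows "\<exists>C. \<forall>x t. halted M ((tm_step M ^^ t) (tm_init x)) \<longrightarrow>
    length (tm_output ((tm_step M ^^ t) (tm_init x))) \<le> C * (length x + t + 1)"
proof -
  obtain C where C: "\<And>x t. halted M ((tm_step M ^^ t) (tm_init x)) \<Longrightarrow>
    run (simulate M) (init_store x) (C * (length x + t + 1)) (input_store (tm_output ((tm_step M ^^ t) (tm_init x))))"
    using run_simulate[OF assms] by blast
  have "length (tm_output ((tm_step M ^^ t) (tm_init x))) \<le> C * (length x + t + 1)"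
    if "halted M ((tm_step M ^^ t) (tm_init x))" for x t
    using run_length[OF C[OF that], of "V 1"] by (simp add: input_store_def init_store_def)
  then show ?thesis by blast
qed

text \<open>Here b stands for the length of the intermediate instance plus 2, u for the program
  steps and l for the digit length of Z. A step costs about l^2, so the total is 300 b^2 (4 b^2)^2 =
  4800 b^6.\<close>

lemma work_bound:
  fixes b C N u :: nat
  assumes b: "b \<le> C * N" and u: "u \<le> 300 * b\<^sup>2" and l: "l \<le> 2 * b\<^sup>2 + 1" and b1: "1 \<le> b" and N: "1 \<le> N"
  shows "N + u * (l + 1)\<^sup>2 \<le> (4800 * C ^ 6 + 1) * N ^ 6"
proof -
  have "1 \<le> b\<^sup>2" using b1 by simp
  then have "l + 1 \<le> 4 * b\<^sup>2" using l by linarith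
  then have "(l + 1)\<^sup>2 \<le> (4 * b\<^sup>2)\<^sup>2" by (rule power_mono) simp
  then have "u * (l + 1)\<^sup>2 \<le> (300 * b\<^sup>2) * (4 * b\<^sup>2)\<^sup>2" using u by (intro mult_le_mono)
  also have "\<dots> = 4800 * b ^ 6" by (simp add: power_mult_distrib power_mult[symmetric] power_add[symmetric])
  also have "\<dots> \<le> 4800 * (C * N) ^ 6" using b by (intro mult_le_mono2 power_mono) auto
  finally have "u * (l + 1)\<^sup>2 \<le> 4800 * C ^ 6 * N ^ 6" by (simp add: power_mult_distrib)
  moreover have "N ^ 1 \<le> N ^ 6" using N by (intro power_increasing) auto
  ultimately show ?thesis by (simp add: algebra_simps)
qed

theorem mainTheorem6:
  shows "W1_hard (SCHED_REJ, kappa_sched)"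
proof -
  have "fpt_reducible (Q, \<kappa>) (SCHED_REJ, kappa_sched)" if red: "fpt_reducible (Q, \<kappa>) (CLIQUE, kappa_clique)" for Q \<kappa>
  proof -
    obtain R where R: "fpt_reduction (Q, \<kappa>) (CLIQUE, kappa_clique) R"
      using red unfolding fpt_reducible_def by blast
    then have QR: "x \<in> Q \<longleftrightarrow> R x \<in> CLIQUE" for x
      unfolding fpt_reduction_def prod.case by blast
    obtain f M c where f: "computable_nat f"
      and M: "tm_computes_on M UNIV R (\<lambda>x. f (\<kappa> x) * (length x + 1) ^ c)"
      using R unfolding fpt_reduction_def prod.case by blast
    obtain g where g: "computable_nat g" "\<And>x. kappa_clique (R x) \<le> g (\<kappa> x)"
      using R unfolding fpt_reduction_def prod.case by blast
    have wf: "wf_tm M" using M by (simp add: tm_computes_on_def)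
    have "\<forall>x. \<exists>t. t \<le> f (\<kappa> x) * (length x + 1) ^ c \<and> halted M ((tm_step M ^^ t) (tm_init x))
         \<and> tm_output ((tm_step M ^^ t) (tm_init x)) = R x"
      using M unfolding tm_computes_on_def by blast
    then obtain t where t: "\<And>x. t x \<le> f (\<kappa> x) * (length x + 1) ^ c"
      "\<And>x. halted M ((tm_step M ^^ t x) (tm_init x))" "\<And>x. tm_output ((tm_step M ^^ t x) (tm_init x)) = R x"
      by metis
    obtain C where C: "\<And>x. length (R x) \<le> C * (length x + t x + 1)"
      using output_length[OF wf] t(2,3) by metis
    define b where "b = (\<lambda>x. length (encs (decode (R x))) + 2)"
    have "\<forall>x. \<exists>u s. u \<le> 300 * (b x)\<^sup>2 \<and> bs (2 ^ (2 * (b x)\<^sup>2)) main_prog (input_env (decode (R x))) u s \<and> reduces (decode (R x)) (s 2)"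
      using runs_main_encs unfolding runs_def b_def by blast
    then obtain u s where u: "\<And>x. u x \<le> 300 * (b x)\<^sup>2"
      and bs: "\<And>x. bs (2 ^ (2 * (b x)\<^sup>2)) main_prog (input_env (decode (R x))) (u x) (s x)"
      and out: "\<And>x. reduces (decode (R x)) (s x 2)" by metis
    \<comment> \<open>\<open>reduces\<close> leaves the order of the items open, so the reduction is
      fixed by a choice of final environments; \<open>pipeline\<close> shows that M' outputs exactly
      these.\<close>
    define R' where "R' = (\<lambda>x. encs (s x 2))"
    obtain M' a where wf': "wf_tm M'" and M': "\<And>x t u Z s'. halted M ((tm_step M ^^ t) (tm_init x)) \<Longrightarrow>
      bs Z main_prog (input_env (decode (tm_output ((tm_step M ^^ t) (tm_init x))))) u s' \<Longrightarrow>
      (\<exists>n \<le> a * (length x + t + u * (lb Z + 1) ^ 2 + 1) ^ 2. halted M' ((tm_step M' ^^ n) (tm_init x))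
         \<and> tm_output ((tm_step M' ^^ n) (tm_init x)) = encs (s' 2))"
      using pipeline[OF wf, of main_prog] by blast
    define D where "D = 4800 * (C + 2) ^ 6 + 1"
    \<comment> \<open>The exponent 12 is the work N^6 of \<open>work_bound\<close>, squared by the
      simulation on a single tape.\<close>
    define f' where "f' = (\<lambda>k. (a * D\<^sup>2) * (f k + 1) ^ 12)"
    have "\<exists>n \<le> f' (\<kappa> x) * (length x + 1) ^ ((c + 1) * 12). halted M' ((tm_step M' ^^ n) (tm_init x))
         \<and> tm_output ((tm_step M' ^^ n) (tm_init x)) = R' x" for x
    proof -
      define N where "N = length x + t x + 1"
      let ?Z = "2 ^ (2 * (b x)\<^sup>2) :: nat"
      obtain n where n: "n \<le> a * (length x + t x + u x * (lb ?Z + 1) ^ 2 + 1) ^ 2"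
        "halted M' ((tm_step M' ^^ n) (tm_init x))" "tm_output ((tm_step M' ^^ n) (tm_init x)) = encs (s x 2)"
        using M'[OF t(2), unfolded t(3), OF bs] by blast
      have "length (encs (decode (R x))) \<le> C * N" using C[of x] by (simp add: encs_decode N_def)
      moreover have "1 \<le> N" by (simp add: N_def)
      ultimately have bN: "b x \<le> (C + 2) * N" by (simp add: b_def algebra_simps)
      have lZ: "lb ?Z \<le> 2 * (b x)\<^sup>2 + 1" by (rule length_bits_le) simp
      have "N + u x * (lb ?Z + 1)\<^sup>2 \<le> D * N ^ 6"
        unfolding D_def by (rule work_bound[OF bN u lZ]) (auto simp: b_def N_def)
      then have "length x + t x + u x * (lb ?Z + 1) ^ 2 + 1 \<le> D * N ^ 6" by (simp add: N_def)
      then have "a * (length x + t x + u x * (lb ?Z + 1) ^ 2 + 1) ^ 2 \<le> a * (D * N ^ 6) ^ 2"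
        by (intro mult_le_mono2 power_mono) auto
      also have "\<dots> = a * D\<^sup>2 * N ^ 12" by (simp add: power_mult_distrib power_mult[symmetric])
      also have "\<dots> \<le> a * D\<^sup>2 * ((f (\<kappa> x) + 1) * (length x + 1) ^ (c + 1)) ^ 12"
      proof (intro mult_le_mono2 power_mono)
        \<comment> \<open>Exponent c + 1 instead of c also covers the summand
          \<open>length x + 1\<close> when c = 0.\<close>
        have "(length x + 1) ^ 1 \<le> (length x + 1) ^ (c + 1)" "(length x + 1) ^ c \<le> (length x + 1) ^ (c + 1)"
          by (intro power_increasing; simp)+
        then have "length x + 1 \<le> (length x + 1) ^ (c + 1)" "t x \<le> f (\<kappa> x) * (length x + 1) ^ (c + 1)"
          using le_trans[OF t(1) mult_le_mono2] by (simp_all only: power_one_right)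
        then show "N \<le> (f (\<kappa> x) + 1) * (length x + 1) ^ (c + 1)"
          unfolding N_def add_mult_distrib by linarith
      qed simp
      also have "\<dots> = f' (\<kappa> x) * (length x + 1) ^ ((c + 1) * 12)"
        unfolding f'_def power_mult_distrib by (simp only: power_mult mult.assoc)
      finally show ?thesis using n unfolding R'_def by (meson order_trans)
    qed
    then have "tm_computes_on M' UNIV R' (\<lambda>x. f' (\<kappa> x) * (length x + 1) ^ ((c + 1) * 12))"
      unfolding tm_computes_on_def using wf' by blast
    moreover have "computable_nat f'" unfolding f'_def by (rule computable_majorant[OF f])
    moreover have "x \<in> Q \<longleftrightarrow> R' x \<in> SCHED_REJ" for x
      unfolding QR R'_def using reduces_correct[OF out] by blast
    \<comment> \<open>The new parameter is at most the square of the clique parameter; the slack + 1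
      and the factor 1 bring the bound into the form of \<open>computable_majorant\<close>.\<close>
    moreover have "kappa_sched (R' x) \<le> 1 * (g (\<kappa> x) + 1)\<^sup>2" for x
    proof -
      have "kappa_sched (R' x) \<le> (kappa_clique (R x))\<^sup>2" unfolding R'_def using reduces_correct[OF out] by blast
      also have "\<dots> \<le> (g (\<kappa> x) + 1)\<^sup>2" using g(2)[of x] by (intro power_mono) auto
      finally show ?thesis by simp
    qed
    moreover have "computable_nat (\<lambda>k. 1 * (g k + 1)\<^sup>2)" by (rule computable_majorant[OF g(1)])
    ultimately have "fpt_reduction (Q, \<kappa>) (SCHED_REJ, kappa_sched) R'"
      unfolding fpt_reduction_def prod.case by blast
    then show ?thesis unfolding fpt_reducible_def by blast
  qed
  then show ?thesis unfolding W1_hard_def W1_def by auto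
qed

end
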